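(* Let $\mathcal C$ be an exact Mal'tsev category with coequalizers. Consider a double extension (with respect to the class $\mathcal F$ of fibrations) in $2\text{-}\mathbf{Eq}(\mathcal C)$, given by morphisms $f:\mathbb X\to\mathbb Y$, $g:\mathbb X\to\mathbb Z$, $h:\mathbb Z\to\mathbb W$, $j:\mathbb Y\to\mathbb W$ with $hg=jf$ and $\mathbb X=(X,R,S)$, viewed as a morphism $(g,j):f\to h$ of extensions. If it is a double $\Gamma_{\mathcal F}$-central extension, then $$[Eq[f],Eq[g]]=\Delta_{X}=[Eq[f]\wedge Eq[g],R\vee S].$$
   Context: A Mal'tsev category is a finitely complete category in which every reflexive relation is an equivalence relation; "exact" means Barr exact. $Eq[f]$ denotes the kernel pair of $f$ in $\mathcal C$, $\Delta_X$ the smallest equivalence relation on $X$, and $\wedge,\vee$ the meet and join of equivalence relations on an object. For a regular epimorphism $q$ with domain $X$ and an equivalence relation $R$ on $X$, $q(R)$ is the direct (regular) image of $R$ along $q$; it is an equivalence relation. Centralization and commutator. Equivalence relations $R,S$ on $X$ centralize each other if there is a (necessarily unique) morphism $p:R\times_X S\to X$ with $p(x,y,y)=x$ and $p(y,y,z)=z$ (in generalized elements), where $R\times_X S$ is the pullback of the second projection of $R$ and the first projection of $S$ (elements $(x,y,z)$ with $xRy$, $ySz$). The commutator $[R,S]$ is the smallest equivalence relation on $X$ whose coequalizer $q$ is such that $q(R)$ and $q(S)$ centralize each other. The category $2\text{-}\mathbf{Eq}(\mathcal C)$. Objects are triples $(X,R,S)$ with $R,S$ equivalence relations on the object $X$ of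 $\mathcal C$; morphisms $(X,R,S)\to(X',R',S')$ are morphisms $f:X\to X'$ in $\mathcal C$ with $f(R)\le R'$ and $f(S)\le S'$ (i.e. $f$ restricts to $R\to R'$ and $S\to S'$). Limits are computed pointwise, and $f$ is a regular epimorphism there iff $f$ is a regular epimorphism in $\mathcal C$ with $f(R)=R'$ and $f(S)=S'$. $\mathbf{Conn}(\mathcal C)$ is the full subcategory of triples $(X,R,S)$ with $R$ and $S$ centralizing each other; it is reflective, with reflector $I(X,R,S)=(X/[R,S],q(R),q(S))$ and unit the quotient $q=q_{[R,S]}:X\to X/[R,S]$. Fibrations. A fibration is a regular epimorphism $f:(X,R,S)\to(X',R',S')$ in $2\text{-}\mathbf{Eq}(\mathcal C)$ such that $f^{-1}(R')=R$ and $f^{-1}(S')=S$ (equivalently $Eq[f]\le R\wedge S$). $\mathcal F$ is the class of fibrations. Galois-theoretic notions. Let $\mathcal A$ be a category, $\mathcal B$ a full reflective subcategory with reflector $J$, and $\mathcal G$ a class of morphisms of $\mathcal A$ (the extensions) containing isomorphisms, stable under pullback and closed under composition. $\mathcal A\downarrow_{\mathcal G}B$ is the full subcategory of the slice category $\mathcal A/B$ whose objects are extensions; an extension $p:E\to B$ is monadic if $p^*:\mathcal A\downarrow_{\mathcal G}B\to\mathcal A\downarrow_{\mathcal G}E$ is monadic. An extension is trivial if the naturality square of the unit of the reflection at it is a pullback. An extension $u:A\to B$ is central if there is a monadic extension $p:E\to B$ such that the pullback of $u$ along $p$ is trivial. $\Gamma_{\mathcal F}$-central extensions are the central extensions for $\mathcal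 A=2\text{-}\mathbf{Eq}(\mathcal C)$, $\mathcal B=\mathbf{Conn}(\mathcal C)$, $J=I$, $\mathcal G=\mathcal F$. Double extensions. $\mathbf{Ext}_{\mathcal F}(2\text{-}\mathbf{Eq}(\mathcal C))$ is the category whose objects are the morphisms in $\mathcal F$ and whose morphisms $(g,j):f\to h$ are commutative squares $hg=jf$ in $2\text{-}\mathbf{Eq}(\mathcal C)$. A double extension is such a square in which $f,g,h,j$ and the comparison $\langle f,g\rangle:\mathbb X\to\mathbb Y\times_{\mathbb W}\mathbb Z$ are all in $\mathcal F$; $\mathcal F^1$ is the class of double extensions, seen as a class of morphisms of $\mathbf{Ext}_{\mathcal F}(2\text{-}\mathbf{Eq}(\mathcal C))$. The full subcategory $\mathbf{CExt}_{\mathcal F}(2\text{-}\mathbf{Eq}(\mathcal C))$ of $\Gamma_{\mathcal F}$-central extensions is reflective in $\mathbf{Ext}_{\mathcal F}(2\text{-}\mathbf{Eq}(\mathcal C))$, with reflector denoted $I^1$. A double $\Gamma_{\mathcal F}$-central extension is a double extension that is central for $\mathcal A=\mathbf{Ext}_{\mathcal F}(2\text{-}\mathbf{Eq}(\mathcal C))$, $\mathcal B=\mathbf{CExt}_{\mathcal F}(2\text{-}\mathbf{Eq}(\mathcal C))$, $J=I^1$, $\mathcal G=\mathcal F^1$. *)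

theory Defs
  imports Main
begin

section \<open>Categories\<close>

record ('o, 'm) cat =
  Obj :: "'o set"
  Arr :: "'m set"
  Dom :: "'m \<Rightarrow> 'o"
  Cod :: "'m \<Rightarrow> 'o"
  Ide :: "'o \<Rightarrow> 'm"
  Comp :: "'m \<Rightarrow> 'm \<Rightarrow> 'm"  (infixl "\<cdot>\<index>" 70)

definition hom :: "('o, 'm) cat \<Rightarrow> 'o \<Rightarrow> 'o \<Rightarrow> 'm set" where
  "hom C x y = {f \<in> Arr C. Dom C f = x \<and> Cod C f = y}"

locale category =
  fixes C :: "('o, 'm) cat"  (structure)
  assumes Dom_Obj: "f \<in> Arr C \<Longrightarrow> Dom C f \<in> Obj C"
    and Cod_Obj: "f \<in> Arr C \<Longrightarrow> Cod C f \<in> Obj C"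
    and Ide_hom: "x \<in> Obj C \<Longrightarrow> Ide C x \<in> hom C x x"
    and Comp_hom: "f \<in> hom C x y \<Longrightarrow> g \<in> hom C y z \<Longrightarrow> g \<cdot> f \<in> hom C x z"
    and Comp_Ide: "f \<in> hom C x y \<Longrightarrow> f \<cdot> Ide C x = f"
    and Ide_Comp: "f \<in> hom C x y \<Longrightarrow> Ide C y \<cdot> f = f"
    and Comp_assoc: "f \<in> hom C w x \<Longrightarrow> g \<in> hom C x y \<Longrightarrow> h \<in> hom C y z \<Longrightarrow>
        (h \<cdot> g) \<cdot> f = h \<cdot> (g \<cdot> f)"

definition is_iso :: "('o, 'm) cat \<Rightarrow> 'm \<Rightarrow> bool" where
  "is_iso C f \<longleftrightarrow> f \<in> Arr C \<and> (\<exists>g \<in> hom C (Cod C f) (Dom C f).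
     g \<cdot>\<^bsub>C\<^esub> f = Ide C (Dom C f) \<and> f \<cdot>\<^bsub>C\<^esub> g = Ide C (Cod C f))"

definition is_terminal :: "('o, 'm) cat \<Rightarrow> 'o \<Rightarrow> bool" where
  "is_terminal C t \<longleftrightarrow> t \<in> Obj C \<and> (\<forall>x \<in> Obj C. \<exists>!f. f \<in> hom C x t)"

text \<open>\<^term>\<open>is_pullback C f g p q\<close>: the square \<open>f \<cdot> p = g \<cdot> q\<close> is a pullback of the cospan
  \<open>(f, g)\<close>, with \<open>p\<close> the projection to the domain of \<open>f\<close>.\<close>

definition is_pullback :: "('o, 'm) cat \<Rightarrow> 'm \<Rightarrow> 'm \<Rightarrow> 'm \<Rightarrow> 'm \<Rightarrow> bool" where
  "is_pullback C f g p q \<longleftrightarrow>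
     f \<in> Arr C \<and> g \<in> Arr C \<and> Cod C f = Cod C g \<and>
     p \<in> hom C (Dom C p) (Dom C f) \<and> q \<in> hom C (Dom C p) (Dom C g) \<and>
     f \<cdot>\<^bsub>C\<^esub> p = g \<cdot>\<^bsub>C\<^esub> q \<and>
     (\<forall>t \<in> Obj C. \<forall>a \<in> hom C t (Dom C f). \<forall>b \<in> hom C t (Dom C g).
        f \<cdot>\<^bsub>C\<^esub> a = g \<cdot>\<^bsub>C\<^esub> b \<longrightarrow>
        (\<exists>!u. u \<in> hom C t (Dom C p) \<and> p \<cdot>\<^bsub>C\<^esub> u = a \<and> q \<cdot>\<^bsub>C\<^esub> u = b))"

definition is_coequalizer :: "('o, 'm) cat \<Rightarrow> 'm \<Rightarrow> 'm \<Rightarrow> 'm \<Rightarrow> bool" where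
  "is_coequalizer C a b q \<longleftrightarrow>
     a \<in> Arr C \<and> b \<in> hom C (Dom C a) (Cod C a) \<and> q \<in> hom C (Cod C a) (Cod C q) \<and>
     q \<cdot>\<^bsub>C\<^esub> a = q \<cdot>\<^bsub>C\<^esub> b \<and>
     (\<forall>y \<in> Obj C. \<forall>k \<in> hom C (Cod C a) y.
        k \<cdot>\<^bsub>C\<^esub> a = k \<cdot>\<^bsub>C\<^esub> b \<longrightarrow> (\<exists>!u. u \<in> hom C (Cod C q) y \<and> u \<cdot>\<^bsub>C\<^esub> q = k))"

definition regular_epi :: "('o, 'm) cat \<Rightarrow> 'm \<Rightarrow> bool" where
  "regular_epi C q \<longleftrightarrow> (\<exists>a b. is_coequalizer C a b q)"

definition has_coequalizers :: "('o, 'm) cat \<Rightarrow> bool" where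
  "has_coequalizers C \<longleftrightarrow>
     (\<forall>a \<in> Arr C. \<forall>b \<in> hom C (Dom C a) (Cod C a). \<exists>q. is_coequalizer C a b q)"

definition finitely_complete :: "('o, 'm) cat \<Rightarrow> bool" where
  "finitely_complete C \<longleftrightarrow> category C \<and> (\<exists>t. is_terminal C t) \<and>
     (\<forall>f \<in> Arr C. \<forall>g \<in> Arr C. Cod C f = Cod C g \<longrightarrow> (\<exists>p q. is_pullback C f g p q))"


section \<open>Internal relations\<close>

text \<open>A relation on \<open>X\<close> is given by a jointly monic pair of arrows into \<open>X\<close>, that is, by a
  representative of a subobject of \<open>X \<times> X\<close>. Accordingly relations are compared by \<open>rel_le\<close> and
  identified by \<open>rel_eq\<close>, never by HOL equality.\<close>

type_synonym 'm rl = "'m \<times> 'm"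

definition is_rel :: "('o, 'm) cat \<Rightarrow> 'o \<Rightarrow> 'm rl \<Rightarrow> bool" where
  "is_rel C X R \<longleftrightarrow>
     fst R \<in> hom C (Dom C (fst R)) X \<and> snd R \<in> hom C (Dom C (fst R)) X \<and>
     (\<forall>t \<in> Obj C. \<forall>u \<in> hom C t (Dom C (fst R)). \<forall>v \<in> hom C t (Dom C (fst R)).
        fst R \<cdot>\<^bsub>C\<^esub> u = fst R \<cdot>\<^bsub>C\<^esub> v \<and> snd R \<cdot>\<^bsub>C\<^esub> u = snd R \<cdot>\<^bsub>C\<^esub> v \<longrightarrow> u = v)"

text \<open>Membership of a pair \<open>(a, b)\<close> of generalized elements.\<close>

definition rel_mem :: "('o, 'm) cat \<Rightarrow> 'm rl \<Rightarrow> 'm \<Rightarrow> 'm \<Rightarrow> bool" where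
  "rel_mem C R a b \<longleftrightarrow>
     (\<exists>u \<in> hom C (Dom C a) (Dom C (fst R)). fst R \<cdot>\<^bsub>C\<^esub> u = a \<and> snd R \<cdot>\<^bsub>C\<^esub> u = b)"

definition rel_le :: "('o, 'm) cat \<Rightarrow> 'm rl \<Rightarrow> 'm rl \<Rightarrow> bool" where
  "rel_le C R S \<longleftrightarrow> rel_mem C S (fst R) (snd R)"

definition rel_eq :: "('o, 'm) cat \<Rightarrow> 'm rl \<Rightarrow> 'm rl \<Rightarrow> bool" where
  "rel_eq C R S \<longleftrightarrow> rel_le C R S \<and> rel_le C S R"

definition reflexive_rel :: "('o, 'm) cat \<Rightarrow> 'o \<Rightarrow> 'm rl \<Rightarrow> bool" where
  "reflexive_rel C X R \<longleftrightarrow> is_rel C X R \<and> rel_mem C R (Ide C X) (Ide C X)"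

definition equiv_rel :: "('o, 'm) cat \<Rightarrow> 'o \<Rightarrow> 'm rl \<Rightarrow> bool" where
  "equiv_rel C X R \<longleftrightarrow> reflexive_rel C X R \<and>
     rel_mem C R (snd R) (fst R) \<and>
     (\<forall>t \<in> Obj C. \<forall>a \<in> hom C t X. \<forall>b \<in> hom C t X. \<forall>c \<in> hom C t X.
        rel_mem C R a b \<and> rel_mem C R b c \<longrightarrow> rel_mem C R a c)"

definition diag :: "('o, 'm) cat \<Rightarrow> 'o \<Rightarrow> 'm rl" where
  "diag C X = (Ide C X, Ide C X)"

definition is_kernel_pair :: "('o, 'm) cat \<Rightarrow> 'm \<Rightarrow> 'm rl \<Rightarrow> bool" where
  "is_kernel_pair C f R \<longleftrightarrow> is_pullback C f f (fst R) (snd R)"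

definition is_meet :: "('o, 'm) cat \<Rightarrow> 'o \<Rightarrow> 'm rl \<Rightarrow> 'm rl \<Rightarrow> 'm rl \<Rightarrow> bool" where
  "is_meet C X R S T \<longleftrightarrow> equiv_rel C X T \<and> rel_le C T R \<and> rel_le C T S \<and>
     (\<forall>T'. equiv_rel C X T' \<and> rel_le C T' R \<and> rel_le C T' S \<longrightarrow> rel_le C T' T)"

definition is_join :: "('o, 'm) cat \<Rightarrow> 'o \<Rightarrow> 'm rl \<Rightarrow> 'm rl \<Rightarrow> 'm rl \<Rightarrow> bool" where
  "is_join C X R S T \<longleftrightarrow> equiv_rel C X T \<and> rel_le C R T \<and> rel_le C S T \<and>
     (\<forall>T'. equiv_rel C X T' \<and> rel_le C R T' \<and> rel_le C S T' \<longrightarrow> rel_le C T T')"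

text \<open>The regular image \<open>q(R)\<close>: the (regular epi, mono) factorization of
  \<open>R \<rightarrow> X \<times> X \<rightarrow> Y \<times> Y\<close>.\<close>

definition is_image :: "('o, 'm) cat \<Rightarrow> 'm \<Rightarrow> 'm rl \<Rightarrow> 'm rl \<Rightarrow> bool" where
  "is_image C q R T \<longleftrightarrow> is_rel C (Cod C q) T \<and>
     (\<exists>e \<in> hom C (Dom C (fst R)) (Dom C (fst T)). regular_epi C e \<and>
        fst T \<cdot>\<^bsub>C\<^esub> e = q \<cdot>\<^bsub>C\<^esub> fst R \<and> snd T \<cdot>\<^bsub>C\<^esub> e = q \<cdot>\<^bsub>C\<^esub> snd R)"

text \<open>\<open>R = f\<^sup>-\<^sup>1(R')\<close> for relations \<open>R\<close>, \<open>R'\<close> on the domain and codomain of \<open>f\<close>.\<close>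

definition is_inverse_image :: "('o, 'm) cat \<Rightarrow> 'm \<Rightarrow> 'm rl \<Rightarrow> 'm rl \<Rightarrow> bool" where
  "is_inverse_image C f R' R \<longleftrightarrow>
     (\<forall>t \<in> Obj C. \<forall>a \<in> hom C t (Dom C f). \<forall>b \<in> hom C t (Dom C f).
        rel_mem C R a b \<longleftrightarrow> rel_mem C R' (f \<cdot>\<^bsub>C\<^esub> a) (f \<cdot>\<^bsub>C\<^esub> b))"

definition restricts :: "('o, 'm) cat \<Rightarrow> 'm \<Rightarrow> 'm rl \<Rightarrow> 'm rl \<Rightarrow> bool" where
  "restricts C f R R' \<longleftrightarrow> rel_mem C R' (f \<cdot>\<^bsub>C\<^esub> fst R) (f \<cdot>\<^bsub>C\<^esub> snd R)"


section \<open>Exact Mal'tsev categories and the commutator\<close>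

definition maltsev_category :: "('o, 'm) cat \<Rightarrow> bool" where
  "maltsev_category C \<longleftrightarrow> finitely_complete C \<and>
     (\<forall>X \<in> Obj C. \<forall>R. reflexive_rel C X R \<longrightarrow> equiv_rel C X R)"

definition regular_category :: "('o, 'm) cat \<Rightarrow> bool" where
  "regular_category C \<longleftrightarrow> finitely_complete C \<and>
     (\<forall>f R. is_kernel_pair C f R \<longrightarrow> (\<exists>q. is_coequalizer C (fst R) (snd R) q)) \<and>
     (\<forall>f g p q. is_pullback C f g p q \<and> regular_epi C g \<longrightarrow> regular_epi C p)"

definition exact_category :: "('o, 'm) cat \<Rightarrow> bool" where
  "exact_category C \<longleftrightarrow> regular_category C \<and>
     (\<forall>X \<in> Obj C. \<forall>R. equiv_rel C X R \<longrightarrow> (\<exists>f. is_kernel_pair C f R))"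

text \<open>Here \<open>\<pi>\<^sub>1\<close>, \<open>\<pi>\<^sub>2\<close> project \<open>R \<times>\<^sub>X S\<close> to \<open>R\<close> and \<open>S\<close>; a generalized element \<open>w\<close> of
  \<open>R \<times>\<^sub>X S\<close> is a triple \<open>(x, y, z)\<close> with \<open>x R y S z\<close>.\<close>

definition centralize :: "('o, 'm) cat \<Rightarrow> 'o \<Rightarrow> 'm rl \<Rightarrow> 'm rl \<Rightarrow> bool" where
  "centralize C X R S \<longleftrightarrow>
     (\<exists>\<pi>\<^sub>1 \<pi>\<^sub>2 p. is_pullback C (snd R) (fst S) \<pi>\<^sub>1 \<pi>\<^sub>2 \<and> p \<in> hom C (Dom C \<pi>\<^sub>1) X \<and>
        (\<forall>t \<in> Obj C. \<forall>w \<in> hom C t (Dom C \<pi>\<^sub>1).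
           let x = fst R \<cdot>\<^bsub>C\<^esub> (\<pi>\<^sub>1 \<cdot>\<^bsub>C\<^esub> w);
               y = snd R \<cdot>\<^bsub>C\<^esub> (\<pi>\<^sub>1 \<cdot>\<^bsub>C\<^esub> w);
               z = snd S \<cdot>\<^bsub>C\<^esub> (\<pi>\<^sub>2 \<cdot>\<^bsub>C\<^esub> w)
           in (y = z \<longrightarrow> p \<cdot>\<^bsub>C\<^esub> w = x) \<and> (x = y \<longrightarrow> p \<cdot>\<^bsub>C\<^esub> w = z)))"

definition centralized_by :: "('o, 'm) cat \<Rightarrow> 'o \<Rightarrow> 'm rl \<Rightarrow> 'm rl \<Rightarrow> 'm rl \<Rightarrow> bool" where
  "centralized_by C X R S T \<longleftrightarrow> equiv_rel C X T \<and>
     (\<exists>q R' S'. is_coequalizer C (fst T) (snd T) q \<and> is_image C q R R' \<and> is_image C q S S' \<and>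
        centralize C (Cod C q) R' S')"

definition is_commutator :: "('o, 'm) cat \<Rightarrow> 'o \<Rightarrow> 'm rl \<Rightarrow> 'm rl \<Rightarrow> 'm rl \<Rightarrow> bool" where
  "is_commutator C X R S T \<longleftrightarrow> centralized_by C X R S T \<and>
     (\<forall>T'. centralized_by C X R S T' \<longrightarrow> rel_le C T T')"

text \<open>Chosen representatives; each is determined up to \<open>rel_eq\<close>.\<close>

definition kernel_pair :: "('o, 'm) cat \<Rightarrow> 'm \<Rightarrow> 'm rl" where
  "kernel_pair C f = (SOME R. is_kernel_pair C f R)"

definition meet :: "('o, 'm) cat \<Rightarrow> 'o \<Rightarrow> 'm rl \<Rightarrow> 'm rl \<Rightarrow> 'm rl" where
  "meet C X R S = (SOME T. is_meet C X R S T)"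

definition join :: "('o, 'm) cat \<Rightarrow> 'o \<Rightarrow> 'm rl \<Rightarrow> 'm rl \<Rightarrow> 'm rl" where
  "join C X R S = (SOME T. is_join C X R S T)"

definition commutator :: "('o, 'm) cat \<Rightarrow> 'o \<Rightarrow> 'm rl \<Rightarrow> 'm rl \<Rightarrow> 'm rl" where
  "commutator C X R S = (SOME T. is_commutator C X R S T)"


section \<open>Functors and monadicity\<close>

record ('o, 'm, 'p, 'n) funct =
  OMap :: "'o \<Rightarrow> 'p"
  AMap :: "'m \<Rightarrow> 'n"

definition is_functor :: "('o, 'm) cat \<Rightarrow> ('p, 'n) cat \<Rightarrow> ('o, 'm, 'p, 'n) funct \<Rightarrow> bool" where
  "is_functor A B F \<longleftrightarrow>
     (\<forall>x \<in> Obj A. OMap F x \<in> Obj B \<and> AMap F (Ide A x) = Ide B (OMap F x)) \<and>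
     (\<forall>f \<in> Arr A. AMap F f \<in> hom B (OMap F (Dom A f)) (OMap F (Cod A f))) \<and>
     (\<forall>f \<in> Arr A. \<forall>g \<in> Arr A. Dom A g = Cod A f \<longrightarrow>
        AMap F (g \<cdot>\<^bsub>A\<^esub> f) = AMap F g \<cdot>\<^bsub>B\<^esub> AMap F f)"

definition id_funct :: "('o, 'm, 'o, 'm) funct" where
  "id_funct = \<lparr>OMap = (\<lambda>x. x), AMap = (\<lambda>f. f)\<rparr>"

definition comp_funct ::
  "('p, 'n, 'q, 'k) funct \<Rightarrow> ('o, 'm, 'p, 'n) funct \<Rightarrow> ('o, 'm, 'q, 'k) funct" where
  "comp_funct G F = \<lparr>OMap = OMap G \<circ> OMap F, AMap = AMap G \<circ> AMap F\<rparr>"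

definition is_nat_trans ::
  "('o, 'm) cat \<Rightarrow> ('p, 'n) cat \<Rightarrow> ('o, 'm, 'p, 'n) funct \<Rightarrow> ('o, 'm, 'p, 'n) funct \<Rightarrow>
     ('o \<Rightarrow> 'n) \<Rightarrow> bool" where
  "is_nat_trans A B F G \<tau> \<longleftrightarrow>
     (\<forall>x \<in> Obj A. \<tau> x \<in> hom B (OMap F x) (OMap G x)) \<and>
     (\<forall>f \<in> Arr A. \<tau> (Cod A f) \<cdot>\<^bsub>B\<^esub> AMap F f = AMap G f \<cdot>\<^bsub>B\<^esub> \<tau> (Dom A f))"

definition is_nat_iso ::
  "('o, 'm) cat \<Rightarrow> ('p, 'n) cat \<Rightarrow> ('o, 'm, 'p, 'n) funct \<Rightarrow> ('o, 'm, 'p, 'n) funct \<Rightarrow>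
     ('o \<Rightarrow> 'n) \<Rightarrow> bool" where
  "is_nat_iso A B F G \<tau> \<longleftrightarrow> is_nat_trans A B F G \<tau> \<and> (\<forall>x \<in> Obj A. is_iso B (\<tau> x))"

definition is_equivalence ::
  "('o, 'm) cat \<Rightarrow> ('p, 'n) cat \<Rightarrow> ('o, 'm, 'p, 'n) funct \<Rightarrow> bool" where
  "is_equivalence A B F \<longleftrightarrow> is_functor A B F \<and>
     (\<exists>G \<sigma> \<tau>. is_functor B A G \<and>
        is_nat_iso A A id_funct (comp_funct G F) \<sigma> \<and>
        is_nat_iso B B (comp_funct F G) id_funct \<tau>)"

text \<open>\<open>L : B \<rightarrow> A\<close> is left adjoint to \<open>U : A \<rightarrow> B\<close>, with unit \<open>\<eta>\<close> and counit \<open>\<epsilon>\<close>.\<close>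

definition is_adjunction ::
  "('o, 'm) cat \<Rightarrow> ('p, 'n) cat \<Rightarrow> ('p, 'n, 'o, 'm) funct \<Rightarrow> ('o, 'm, 'p, 'n) funct \<Rightarrow>
     ('p \<Rightarrow> 'n) \<Rightarrow> ('o \<Rightarrow> 'm) \<Rightarrow> bool" where
  "is_adjunction A B L U \<eta> \<epsilon> \<longleftrightarrow>
     is_functor B A L \<and> is_functor A B U \<and>
     is_nat_trans B B id_funct (comp_funct U L) \<eta> \<and>
     is_nat_trans A A (comp_funct L U) id_funct \<epsilon> \<and>
     (\<forall>b \<in> Obj B. \<epsilon> (OMap L b) \<cdot>\<^bsub>A\<^esub> AMap L (\<eta> b) = Ide A (OMap L b)) \<and>
     (\<forall>a \<in> Obj A. AMap U (\<epsilon> a) \<cdot>\<^bsub>B\<^esub> \<eta> (OMap U a) = Ide B (OMap U a))"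

text \<open>The Eilenberg-Moore category of a monad \<open>(T, \<eta>, \<mu>)\<close> on \<open>B\<close>.\<close>

definition em_algebras ::
  "('p, 'n) cat \<Rightarrow> ('p, 'n, 'p, 'n) funct \<Rightarrow> ('p \<Rightarrow> 'n) \<Rightarrow> ('p \<Rightarrow> 'n) \<Rightarrow> ('p \<times> 'n) set" where
  "em_algebras B T \<eta> \<mu> = {(b, \<alpha>). b \<in> Obj B \<and> \<alpha> \<in> hom B (OMap T b) b \<and>
     \<alpha> \<cdot>\<^bsub>B\<^esub> \<eta> b = Ide B b \<and> \<alpha> \<cdot>\<^bsub>B\<^esub> \<mu> b = \<alpha> \<cdot>\<^bsub>B\<^esub> AMap T \<alpha>}"

definition em_category ::
  "('p, 'n) cat \<Rightarrow> ('p, 'n, 'p, 'n) funct \<Rightarrow> ('p \<Rightarrow> 'n) \<Rightarrow> ('p \<Rightarrow> 'n) \<Rightarrow>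
     ('p \<times> 'n, ('p \<times> 'n) \<times> 'n \<times> ('p \<times> 'n)) cat" where
  "em_category B T \<eta> \<mu> =
     \<lparr>Obj = em_algebras B T \<eta> \<mu>,
      Arr = {(x, k, y). x \<in> em_algebras B T \<eta> \<mu> \<and> y \<in> em_algebras B T \<eta> \<mu> \<and>
               k \<in> hom B (fst x) (fst y) \<and> k \<cdot>\<^bsub>B\<^esub> snd x = snd y \<cdot>\<^bsub>B\<^esub> AMap T k},
      Dom = (\<lambda>(x, k, y). x), Cod = (\<lambda>(x, k, y). y),
      Ide = (\<lambda>x. (x, Ide B (fst x), x)),
      Comp = (\<lambda>(y', l, z) (x, k, y). (x, l \<cdot>\<^bsub>B\<^esub> k, z))\<rparr>"

definition comparison_funct ::
  "('o, 'm) cat \<Rightarrow> ('o, 'm, 'p, 'n) funct \<Rightarrow> ('o \<Rightarrow> 'm) \<Rightarrow>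
     ('o, 'm, 'p \<times> 'n, ('p \<times> 'n) \<times> 'n \<times> ('p \<times> 'n)) funct" where
  "comparison_funct A U \<epsilon> =
     (let K = \<lambda>a. (OMap U a, AMap U (\<epsilon> a))
      in \<lparr>OMap = K, AMap = (\<lambda>f. (K (Dom A f), AMap U f, K (Cod A f)))\<rparr>)"

definition monadic :: "('o, 'm) cat \<Rightarrow> ('p, 'n) cat \<Rightarrow> ('o, 'm, 'p, 'n) funct \<Rightarrow> bool" where
  "monadic A B U \<longleftrightarrow>
     (\<exists>L \<eta> \<epsilon>. is_adjunction A B L U \<eta> \<epsilon> \<and>
        is_equivalence A
          (em_category B (comp_funct U L) \<eta> (\<lambda>b. AMap U (\<epsilon> (OMap L b))))
          (comparison_funct A U \<epsilon>))"


section \<open>Categorical Galois theory\<close>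

text \<open>Throughout, a class of extensions is a set \<open>G\<close> of arrows of \<open>A\<close>, and a full subcategory is
  given by its set \<open>B\<close> of objects, a reflector by its universal arrows \<open>is_reflection_unit\<close>. An arrow of the slice is stored with its domain and codomain.\<close>

definition ext_slice ::
  "('o, 'm) cat \<Rightarrow> 'm set \<Rightarrow> 'o \<Rightarrow> ('m, 'm \<times> 'm \<times> 'm) cat" where
  "ext_slice A G b =
     (let X = {u \<in> G. u \<in> Arr A \<and> Cod A u = b} in
      \<lparr>Obj = X,
       Arr = {(u, k, v). u \<in> X \<and> v \<in> X \<and> k \<in> hom A (Dom A u) (Dom A v) \<and> v \<cdot>\<^bsub>A\<^esub> k = u},
       Dom = (\<lambda>(u, k, v). u), Cod = (\<lambda>(u, k, v). v),
       Ide = (\<lambda>u. (u, Ide A (Dom A u), u)),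
       Comp = (\<lambda>(v', l, w) (u, k, v). (u, l \<cdot>\<^bsub>A\<^esub> k, w))\<rparr>)"

text \<open>\<open>P\<close> is a change-of-base functor \<open>p\<^sup>*\<close>; \<open>\<rho> u\<close> is the second projection of the chosen
  pullback of \<open>u\<close> along \<open>p\<close>. Any two such functors are naturally isomorphic.\<close>

definition is_pullback_funct ::
  "('o, 'm) cat \<Rightarrow> 'm set \<Rightarrow> 'm \<Rightarrow> ('m, 'm \<times> 'm \<times> 'm, 'm, 'm \<times> 'm \<times> 'm) funct \<Rightarrow> bool" where
  "is_pullback_funct A G p P \<longleftrightarrow>
     is_functor (ext_slice A G (Cod A p)) (ext_slice A G (Dom A p)) P \<and>
     (\<exists>\<rho>. (\<forall>u \<in> Obj (ext_slice A G (Cod A p)). is_pullback A p u (OMap P u) (\<rho> u)) \<and>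
        (\<forall>(u, k, v) \<in> Arr (ext_slice A G (Cod A p)).
           \<rho> v \<cdot>\<^bsub>A\<^esub> fst (snd (AMap P (u, k, v))) = k \<cdot>\<^bsub>A\<^esub> \<rho> u))"

definition monadic_extension :: "('o, 'm) cat \<Rightarrow> 'm set \<Rightarrow> 'm \<Rightarrow> bool" where
  "monadic_extension A G p \<longleftrightarrow> p \<in> G \<and>
     (\<exists>P. is_pullback_funct A G p P \<and>
        monadic (ext_slice A G (Cod A p)) (ext_slice A G (Dom A p)) P)"

definition is_reflection_unit :: "('o, 'm) cat \<Rightarrow> 'o set \<Rightarrow> 'o \<Rightarrow> 'm \<Rightarrow> bool" where
  "is_reflection_unit A B a e \<longleftrightarrow> e \<in> hom A a (Cod A e) \<and> Cod A e \<in> B \<and>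
     (\<forall>b \<in> B. \<forall>f \<in> hom A a b. \<exists>!k. k \<in> hom A (Cod A e) b \<and> k \<cdot>\<^bsub>A\<^esub> e = f)"

text \<open>In the next definition \<open>v\<close> is the reflection of \<open>u\<close>; the units are unique up to isomorphism,
  so their choice is immaterial.\<close>

definition trivial_extension :: "('o, 'm) cat \<Rightarrow> 'o set \<Rightarrow> 'm set \<Rightarrow> 'm \<Rightarrow> bool" where
  "trivial_extension A B G u \<longleftrightarrow> u \<in> G \<and>
     (\<exists>e e' v. is_reflection_unit A B (Dom A u) e \<and> is_reflection_unit A B (Cod A u) e' \<and>
        v \<in> hom A (Cod A e) (Cod A e') \<and> v \<cdot>\<^bsub>A\<^esub> e = e' \<cdot>\<^bsub>A\<^esub> u \<and>
        is_pullback A v e' e u)"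

definition central_extension :: "('o, 'm) cat \<Rightarrow> 'o set \<Rightarrow> 'm set \<Rightarrow> 'm \<Rightarrow> bool" where
  "central_extension A B G u \<longleftrightarrow> u \<in> G \<and>
     (\<exists>p u' q. monadic_extension A G p \<and> is_pullback A p u u' q \<and> trivial_extension A B G u')"


section \<open>The category of pairs of equivalence relations\<close>

type_synonym ('o, 'm) obj2 = "'o \<times> 'm rl \<times> 'm rl"
type_synonym ('o, 'm) arr2 = "('o, 'm) obj2 \<times> 'm \<times> ('o, 'm) obj2"

definition two_Eq_obj :: "('o, 'm) cat \<Rightarrow> ('o, 'm) obj2 set" where
  "two_Eq_obj C = {(X, R, S). X \<in> Obj C \<and> equiv_rel C X R \<and> equiv_rel C X S}"

definition two_Eq :: "('o, 'm) cat \<Rightarrow> (('o, 'm) obj2, ('o, 'm) arr2) cat" where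
  "two_Eq C =
     \<lparr>Obj = two_Eq_obj C,
      Arr = {((X, R, S), f, (X', R', S')) | X R S f X' R' S'.
               (X, R, S) \<in> two_Eq_obj C \<and> (X', R', S') \<in> two_Eq_obj C \<and> f \<in> hom C X X' \<and>
               restricts C f R R' \<and> restricts C f S S'},
      Dom = (\<lambda>(x, f, y). x), Cod = (\<lambda>(x, f, y). y),
      Ide = (\<lambda>x. (x, Ide C (fst x), x)),
      Comp = (\<lambda>(y', g, z) (x, f, y). (x, g \<cdot>\<^bsub>C\<^esub> f, z))\<rparr>"

definition base_arr :: "('o, 'm) arr2 \<Rightarrow> 'm" where
  "base_arr F = fst (snd F)"

definition Conn :: "('o, 'm) cat \<Rightarrow> ('o, 'm) obj2 set" where
  "Conn C = {(X, R, S) \<in> two_Eq_obj C. centralize C X R S}"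

definition fibrations :: "('o, 'm) cat \<Rightarrow> ('o, 'm) arr2 set" where
  "fibrations C = {((X, R, S), f, (X', R', S')) | X R S f X' R' S'.
     regular_epi (two_Eq C) ((X, R, S), f, (X', R', S')) \<and>
     is_inverse_image C f R' R \<and> is_inverse_image C f S' S}"

definition CExt :: "('o, 'm) cat \<Rightarrow> ('o, 'm) arr2 set" where
  "CExt C = {f. central_extension (two_Eq C) (Conn C) (fibrations C) f}"


section \<open>Double extensions\<close>

text \<open>The arrow \<open>(f, (g, j), h)\<close> of \<open>Ext A G\<close> is the square \<open>h \<cdot> g = j \<cdot> f\<close> seen as
  \<open>(g, j) : f \<rightarrow> h\<close>.\<close>

type_synonym 'm sq = "'m \<times> ('m \<times> 'm) \<times> 'm"

definition Ext :: "('o, 'm) cat \<Rightarrow> 'm set \<Rightarrow> ('m, 'm sq) cat" where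
  "Ext A G =
     \<lparr>Obj = G,
      Arr = {(f, (g, j), h). f \<in> G \<and> h \<in> G \<and>
               g \<in> hom A (Dom A f) (Dom A h) \<and> j \<in> hom A (Cod A f) (Cod A h) \<and>
               h \<cdot>\<^bsub>A\<^esub> g = j \<cdot>\<^bsub>A\<^esub> f},
      Dom = (\<lambda>(f, gj, h). f), Cod = (\<lambda>(f, gj, h). h),
      Ide = (\<lambda>f. (f, (Ide A (Dom A f), Ide A (Cod A f)), f)),
      Comp = (\<lambda>(h', (k, l), m) (f, (g, j), h). (f, (k \<cdot>\<^bsub>A\<^esub> g, l \<cdot>\<^bsub>A\<^esub> j), m))\<rparr>"

definition double_extensions :: "('o, 'm) cat \<Rightarrow> 'm set \<Rightarrow> 'm sq set" where
  "double_extensions A G = {(f, (g, j), h). (f, (g, j), h) \<in> Arr (Ext A G) \<and> g \<in> G \<and> j \<in> G \<and>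
     (\<exists>p q c. is_pullback A j h p q \<and> c \<in> hom A (Dom A f) (Dom A p) \<and>
        p \<cdot>\<^bsub>A\<^esub> c = f \<and> q \<cdot>\<^bsub>A\<^esub> c = g \<and> c \<in> G)}"

definition double_fibrations :: "('o, 'm) cat \<Rightarrow> ('o, 'm) arr2 sq set" where
  "double_fibrations C = double_extensions (two_Eq C) (fibrations C)"

definition double_central_extension :: "('o, 'm) cat \<Rightarrow> ('o, 'm) arr2 sq \<Rightarrow> bool" where
  "double_central_extension C u \<longleftrightarrow>
     central_extension (Ext (two_Eq C) (fibrations C)) (CExt C) (double_fibrations C) u"

end

theory Submission
  imports Defs
begin

text \<open>
  Think of the double extension as a group \<open>X\<close> with normal subgroups \<open>K\<close> and \<open>L\<close> (the kernels of
  \<open>f\<close> and \<open>g\<close>), both contained in \<open>R \<inter> S\<close>. Double centrality provides a regular epimorphism \<open>q :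
  X' \<rightarrow> X\<close>, obtained by pulling back along a double extension, and an object \<open>I\<close>, the domain of a
  central extension \<open>f\<^sub>I\<close>, such that \<open>X'\<close> embeds as a pullback in \<open>I \<times> E\<close>. Elements of the kernel
  \<open>L'\<close> of \<open>X' \<rightarrow> E\<close> have the form \<open>(l, 1)\<close> and those of the kernel \<open>K'\<close> of the pulled back
  extension have their first coordinate in the kernel of \<open>f\<^sub>I\<close>. Hence \<open>[(k, x), (l, 1)] = ([k, l],
  1)\<close>, and this is trivial because \<open>l\<close> belongs to the relations of \<open>I\<close>, with which the kernel of
  \<open>f\<^sub>I\<close> commutes; in the same way elements of \<open>K' \<inter> L'\<close>, of the form \<open>(k, 1)\<close>, commute with \<open>R'\<close>
  and \<open>S'\<close>. Everything is then transported along \<open>q\<close>. That the kernel of a central extension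
  commutes with both relations is the same argument one level lower: there \<open>I\<close> carries two
  relations that centralize each other.

  In an arbitrary exact Mal'tsev category the argument runs on generalized elements. Two
  equivalence relations centralize each other exactly when there is a natural operation \<open>c x y z\<close>
  on generalized elements (\<open>centralize_connector\<close> and \<open>centralizeI\<close>; the latter glues values that
  exist only over a regular epimorphism). The rigidity of such operations comes from one
  principle, \<open>maltsev_square\<close>: equality of two arrows propagates from three corners of a rectangle
  to the fourth. From it follow the three ways of producing centralizing pairs that the proof
  uses: lifting along a pullback (\<open>centralize_pullback\<close>), descent along a regular epimorphism
  (\<open>centralize_descent\<close>), and passing to the join \<open>R \<or> S = R \<circ> S\<close> (\<open>centralize_composite\<close>).

  Pullbacks of pairs of equivalence relations and of extensions are known only through their
  universal property. Their concrete shape is recovered by probing with well-chosen objects: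
  discrete pairs and identities on them (\<open>two_Eq_pullback_base\<close>, \<open>Ext_pullback_top\<close>), and the
  pointwise pullback itself (\<open>two_Eq_pullback_fibration_rel\<close>, \<open>Ext_pullback_domain\<close>).
\<close>

section \<open>Generalized elements\<close>

context category
begin

text \<open>The typing of composites is delegated to the simplifier: \<open>hom_iff\<close> splits a hom-set
  membership into domain and codomain equations, which discharge the conditions of the rewrite
  rules below.\<close>

lemma hom_Obj: "f \<in> hom C x y \<Longrightarrow> x \<in> Obj C" "f \<in> hom C x y \<Longrightarrow> y \<in> Obj C"
  by (auto simp: hom_def Dom_Obj Cod_Obj)

lemma hom_iff: "f \<in> hom C x y \<longleftrightarrow> f \<in> Arr C \<and> Dom C f = x \<and> Cod C f = y"
  by (auto simp: hom_def)

lemma Arr_Comp [simp]: "f \<in> Arr C \<Longrightarrow> g \<in> Arr C \<Longrightarrow> Cod C f = Dom C g \<Longrightarrow> g \<cdot> f \<in> Arr C"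
  and Dom_Comp [simp]: "f \<in> Arr C \<Longrightarrow> g \<in> Arr C \<Longrightarrow> Cod C f = Dom C g \<Longrightarrow> Dom C (g \<cdot> f) = Dom C f"
  and Cod_Comp [simp]: "f \<in> Arr C \<Longrightarrow> g \<in> Arr C \<Longrightarrow> Cod C f = Dom C g \<Longrightarrow> Cod C (g \<cdot> f) = Cod C g"
  using Comp_hom[of f "Dom C f" "Cod C f" g "Cod C g"] by (auto simp: hom_def)

lemma Comp_assoc_Arr [simp]:
  "f \<in> Arr C \<Longrightarrow> g \<in> Arr C \<Longrightarrow> h \<in> Arr C \<Longrightarrow> Cod C f = Dom C g \<Longrightarrow> Cod C g = Dom C h \<Longrightarrow>
    (h \<cdot> g) \<cdot> f = h \<cdot> (g \<cdot> f)"
  using Comp_assoc[of f "Dom C f" "Cod C f" g "Cod C g" h "Cod C h"] by (auto simp: hom_def)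

lemma Ide_Arr [simp]: "x \<in> Obj C \<Longrightarrow> Ide C x \<in> Arr C"
  and Dom_Ide [simp]: "x \<in> Obj C \<Longrightarrow> Dom C (Ide C x) = x"
  and Cod_Ide [simp]: "x \<in> Obj C \<Longrightarrow> Cod C (Ide C x) = x"
  using Ide_hom by (auto simp: hom_def)

lemma Comp_Ide_Arr [simp]: "f \<in> Arr C \<Longrightarrow> Dom C f = x \<Longrightarrow> f \<cdot> Ide C x = f"
  and Ide_Comp_Arr [simp]: "f \<in> Arr C \<Longrightarrow> Cod C f = x \<Longrightarrow> Ide C x \<cdot> f = f"
  using Comp_Ide[of f "Dom C f" "Cod C f"] Ide_Comp[of f "Dom C f" "Cod C f"]
  by (auto simp: hom_def)

lemma Obj_Dom [simp]: "f \<in> Arr C \<Longrightarrow> Dom C f \<in> Obj C"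
  and Obj_Cod [simp]: "f \<in> Arr C \<Longrightarrow> Cod C f \<in> Obj C"
  by (fact Dom_Obj, fact Cod_Obj)

lemma comp_in_hom: "f \<in> hom C x y \<Longrightarrow> g \<in> hom C y z \<Longrightarrow> g \<cdot> f \<in> hom C x z"
  by (rule Comp_hom)

lemma comp_assoc_hom: "h \<in> hom C y z \<Longrightarrow> g \<in> hom C x y \<Longrightarrow> f \<in> hom C w x \<Longrightarrow>
    h \<cdot> (g \<cdot> f) = (h \<cdot> g) \<cdot> f"
  by (simp add: Comp_assoc)

lemma square_comp:
  assumes "g \<cdot> f = k \<cdot> l" "w \<in> hom C t x" "f \<in> hom C x y" "g \<in> hom C y z"
    "l \<in> hom C x y'" "k \<in> hom C y' z"
  shows "g \<cdot> (f \<cdot> w) = k \<cdot> (l \<cdot> w)"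
  using comp_assoc_hom[OF assms(4,3,2)] comp_assoc_hom[OF assms(6,5,2)] assms(1) by simp

lemma comp_eq_comp:
  assumes "g \<cdot> f = a" "w \<in> hom C t x" "f \<in> hom C x y" "g \<in> hom C y z"
  shows "g \<cdot> (f \<cdot> w) = a \<cdot> w"
  using comp_assoc_hom[OF assms(4,3,2)] assms(1) by simp


lemma rel_memI:
  "u \<in> hom C t (Dom C (fst R)) \<Longrightarrow> a \<in> hom C t x \<Longrightarrow> fst R \<cdot> u = a \<Longrightarrow> snd R \<cdot> u = b \<Longrightarrow> rel_mem C R a b"
  by (auto simp: rel_mem_def hom_def)

lemma rel_memE:
  assumes "rel_mem C R a b" "a \<in> hom C t x"
  obtains u where "u \<in> hom C t (Dom C (fst R))" "fst R \<cdot> u = a" "snd R \<cdot> u = b"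
  using assms by (auto simp: rel_mem_def hom_def)

text \<open>A relation is handled through its generalized elements \<^const>\<open>rel_mem\<close>; its two legs form the
  generic related pair.\<close>

lemma is_rel_fst: "is_rel C X R \<Longrightarrow> fst R \<in> hom C (Dom C (fst R)) X"
  and is_rel_snd: "is_rel C X R \<Longrightarrow> snd R \<in> hom C (Dom C (fst R)) X"
  by (auto simp: is_rel_def)

lemma is_rel_eqD:
  assumes "is_rel C X R" "u \<in> hom C t (Dom C (fst R))" "v \<in> hom C t (Dom C (fst R))"
    "fst R \<cdot> u = fst R \<cdot> v" "snd R \<cdot> u = snd R \<cdot> v"
  shows "u = v"
  using assms hom_Obj(1)[OF assms(2)] by (auto simp: is_rel_def)

lemma rel_mem_comp:
  assumes "is_rel C X R" "rel_mem C R a b" "a \<in> hom C t X" "s \<in> hom C t' t"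
  shows "rel_mem C R (a \<cdot> s) (b \<cdot> s)"
proof -
  obtain u where u: "u \<in> hom C t (Dom C (fst R))" "fst R \<cdot> u = a" "snd R \<cdot> u = b"
    using assms(2,3) by (rule rel_memE)
  show ?thesis
  proof (rule rel_memI[of "u \<cdot> s" t'])
    show "fst R \<cdot> (u \<cdot> s) = a \<cdot> s" by (rule comp_eq_comp[OF u(2) assms(4) u(1) is_rel_fst[OF assms(1)]])
    show "snd R \<cdot> (u \<cdot> s) = b \<cdot> s" by (rule comp_eq_comp[OF u(3) assms(4) u(1) is_rel_snd[OF assms(1)]])
  qed (use u assms in \<open>auto simp: hom_iff\<close>)
qed

lemma rel_mem_snd_hom:
  assumes "is_rel C X R" "rel_mem C R a b" "a \<in> hom C t X"
  shows "b \<in> hom C t X"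
  using assms is_rel_snd by (metis rel_memE comp_in_hom)

lemma rel_le_mem:
  assumes "is_rel C X R" "is_rel C X S" "rel_le C R S" "rel_mem C R a b" "a \<in> hom C t X"
  shows "rel_mem C S a b"
  using assms rel_mem_comp[of X S "fst R" "snd R" "Dom C (fst R)"] is_rel_fst
  by (metis rel_memE rel_le_def)

lemma rel_leI:
  assumes "is_rel C X R"
    and "\<And>t a b. a \<in> hom C t X \<Longrightarrow> b \<in> hom C t X \<Longrightarrow> rel_mem C R a b \<Longrightarrow> rel_mem C S a b"
  shows "rel_le C R S"
  unfolding rel_le_def
proof (rule assms(2))
  have f: "fst R \<in> hom C (Dom C (fst R)) X" using assms(1) by (rule is_rel_fst)
  show "fst R \<in> hom C (Dom C (fst R)) X" "snd R \<in> hom C (Dom C (fst R)) X"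
    using assms(1) is_rel_fst is_rel_snd by auto
  show "rel_mem C R (fst R) (snd R)"
    using f is_rel_snd[OF assms(1)]
    by (intro rel_memI[of "Ide C (Dom C (fst R))"]) (auto simp: hom_def)
qed

lemma reflexive_rel_mem:
  assumes "reflexive_rel C X R" "a \<in> hom C t X"
  shows "rel_mem C R a a"
proof -
  have "rel_mem C R (Ide C X \<cdot> a) (Ide C X \<cdot> a)"
    using assms hom_Obj(2)[OF assms(2)]
    by (intro rel_mem_comp[of X _ _ _ X]) (auto simp: reflexive_rel_def intro: Ide_hom)
  then show ?thesis using assms(2) by (simp add: Ide_Comp)
qed

lemma equiv_rel_reflexive: "equiv_rel C X R \<Longrightarrow> reflexive_rel C X R"
  and reflexive_rel_is_rel: "reflexive_rel C X R \<Longrightarrow> is_rel C X R"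
  and equiv_rel_is_rel: "equiv_rel C X R \<Longrightarrow> is_rel C X R"
  by (auto simp: equiv_rel_def reflexive_rel_def)

lemma equiv_rel_sym:
  assumes "equiv_rel C X R" "rel_mem C R a b" "a \<in> hom C t X"
  shows "rel_mem C R b a"
proof -
  have R: "is_rel C X R" using assms(1) by (rule equiv_rel_is_rel)
  obtain u where u: "u \<in> hom C t (Dom C (fst R))" "fst R \<cdot> u = a" "snd R \<cdot> u = b"
    using assms(2,3) by (rule rel_memE)
  have "rel_mem C R (snd R \<cdot> u) (fst R \<cdot> u)"
    using assms(1) R u is_rel_snd[OF R] by (intro rel_mem_comp[of X]) (auto simp: equiv_rel_def)
  then show ?thesis using u by simp
qed

lemma equiv_rel_trans:
  assumes "equiv_rel C X R" "rel_mem C R a b" "rel_mem C R b c" "a \<in> hom C t X"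
  shows "rel_mem C R a c"
proof -
  have R: "is_rel C X R" using assms(1) by (rule equiv_rel_is_rel)
  have b: "b \<in> hom C t X" using R assms(2,4) by (rule rel_mem_snd_hom)
  have c: "c \<in> hom C t X" using R assms(3) b by (rule rel_mem_snd_hom)
  have "rel_mem C R a b \<and> rel_mem C R b c \<longrightarrow> rel_mem C R a c"
    using assms(1) unfolding equiv_rel_def
    by (elim conjE) (drule bspec[OF _ hom_Obj(1)[OF b]], drule bspec[OF _ assms(4)], drule bspec[OF _ b], drule
        bspec[OF _ c])
  then show ?thesis using assms(2,3) by simp
qed

lemma is_pullbackI:
  assumes "f \<in> hom C A Z" "g \<in> hom C B Z" "p \<in> hom C P A" "q \<in> hom C P B" "f \<cdot> p = g \<cdot> q"
    and "\<And>t a b. a \<in> hom C t A \<Longrightarrow> b \<in> hom C t B \<Longrightarrow> f \<cdot> a = g \<cdot> b \<Longrightarrow>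
      \<exists>!u. u \<in> hom C t P \<and> p \<cdot> u = a \<and> q \<cdot> u = b"
  shows "is_pullback C f g p q"
proof -
  have "Dom C f = A" "Dom C g = B" "Dom C p = P" using assms(1-3) by (auto simp: hom_iff)
  moreover have "f \<in> Arr C" "g \<in> Arr C" "Cod C f = Cod C g" using assms(1,2) by (auto simp: hom_iff)
  ultimately show ?thesis using assms(3-6) unfolding is_pullback_def by simp
qed

lemma is_pullback_hom:
  assumes "is_pullback C f g p q" "f \<in> hom C A Z" "g \<in> hom C B Z"
  shows "p \<in> hom C (Dom C p) A" "q \<in> hom C (Dom C p) B" "f \<cdot> p = g \<cdot> q"
  using assms by (auto simp: is_pullback_def hom_def)

lemma is_pullback_ex:
  assumes "is_pullback C f g p q" "f \<in> hom C A Z" "g \<in> hom C B Z" "p \<in> hom C P A"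
    "a \<in> hom C t A" "b \<in> hom C t B" "f \<cdot> a = g \<cdot> b"
  obtains u where "u \<in> hom C t P" "p \<cdot> u = a" "q \<cdot> u = b"
proof -
  have "Dom C f = A" "Dom C g = B" "Dom C p = P" using assms(2-4) by (auto simp: hom_iff)
  then have "\<forall>t \<in> Obj C. \<forall>a \<in> hom C t A. \<forall>b \<in> hom C t B. f \<cdot> a = g \<cdot> b \<longrightarrow>
        (\<exists>!u. u \<in> hom C t P \<and> p \<cdot> u = a \<and> q \<cdot> u = b)"
    using assms(1) by (simp add: is_pullback_def)
  then show ?thesis using assms(5-7) hom_Obj(1)[OF assms(5)] that by metis
qed

lemma is_pullback_eqD:
  assumes "is_pullback C f g p q" "f \<in> hom C A Z" "g \<in> hom C B Z" "p \<in> hom C P A"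
    "u \<in> hom C t P" "v \<in> hom C t P" "p \<cdot> u = p \<cdot> v" "q \<cdot> u = q \<cdot> v"
  shows "u = v"
proof -
  have d: "Dom C f = A" "Dom C g = B" "Dom C p = P" using assms(2-4) by (auto simp: hom_iff)
  have q: "q \<in> hom C P B" and sq: "f \<cdot> p = g \<cdot> q" using is_pullback_hom[OF assms(1-3)] d by auto
  have "f \<cdot> (p \<cdot> u) = g \<cdot> (q \<cdot> u)" by (rule square_comp[OF sq assms(5,4,2) q assms(3)])
  moreover have "p \<cdot> u \<in> hom C t A" "q \<cdot> u \<in> hom C t B" using assms(4,5) q by (auto simp: hom_iff)
  ultimately have "\<exists>!w. w \<in> hom C t P \<and> p \<cdot> w = p \<cdot> u \<and> q \<cdot> w = q \<cdot> u"
    using hom_Obj(1)[OF assms(5)] d assms(1) by (simp add: is_pullback_def)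
  then show ?thesis using assms by metis
qed

lemma kernel_pair_is_rel:
  assumes "is_kernel_pair C f K" "f \<in> hom C X Y"
  shows "is_rel C X K"
proof -
  have fs: "fst K \<in> hom C (Dom C (fst K)) X" "snd K \<in> hom C (Dom C (fst K)) X"
    and uni: "\<And>t a b. t \<in> Obj C \<Longrightarrow> a \<in> hom C t X \<Longrightarrow> b \<in> hom C t X \<Longrightarrow> f \<cdot> a = f \<cdot> b \<Longrightarrow>
      \<exists>!u. u \<in> hom C t (Dom C (fst K)) \<and> fst K \<cdot> u = a \<and> snd K \<cdot> u = b"
    and sq: "f \<cdot> fst K = f \<cdot> snd K"
    using assms by (auto simp: is_kernel_pair_def is_pullback_def hom_def)
  show ?thesis unfolding is_rel_def
  proof (intro conjI ballI impI fs)
    fix t u v assume *: "t \<in> Obj C" "u \<in> hom C t (Dom C (fst K))" "v \<in> hom C t (Dom C (fst K))"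
      "fst K \<cdot> u = fst K \<cdot> v \<and> snd K \<cdot> u = snd K \<cdot> v"
    have "f \<cdot> (fst K \<cdot> u) = f \<cdot> (snd K \<cdot> u)" by (rule square_comp[OF sq *(2) fs(1) assms(2) fs(2) assms(2)])
    then show "u = v" using uni[of t "fst K \<cdot> u" "snd K \<cdot> u"] * fs by (metis comp_in_hom)
  qed
qed

lemma kernel_pair_mem:
  assumes "is_kernel_pair C f K" "f \<in> hom C X Y" "a \<in> hom C t X" "b \<in> hom C t X"
  shows "rel_mem C K a b \<longleftrightarrow> f \<cdot> a = f \<cdot> b"
proof
  have fs: "fst K \<in> hom C (Dom C (fst K)) X" "snd K \<in> hom C (Dom C (fst K)) X"
    and sq: "f \<cdot> fst K = f \<cdot> snd K"
    using assms by (auto simp: is_kernel_pair_def is_pullback_def hom_def)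
  assume "rel_mem C K a b"
  then show "f \<cdot> a = f \<cdot> b" 
    using square_comp[OF sq _ fs(1) assms(2) fs(2) assms(2)] rel_memE[OF _ assms(3)] by metis
next
  assume "f \<cdot> a = f \<cdot> b"
  then obtain u where "u \<in> hom C t (Dom C (fst K))" "fst K \<cdot> u = a" "snd K \<cdot> u = b"
    using is_pullback_ex[OF assms(1)[unfolded is_kernel_pair_def] assms(2,2) is_rel_fst assms(3,4)]
      kernel_pair_is_rel[OF assms(1,2)] by metis
  then show "rel_mem C K a b" using assms(3) by (metis rel_memI)
qed

lemma kernel_pair_reflexive:
  assumes "is_kernel_pair C f K" "f \<in> hom C X Y"
  shows "reflexive_rel C X K"
  using kernel_pair_is_rel[OF assms] kernel_pair_mem[OF assms, of "Ide C X" X] hom_Obj[OF assms(2)]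
  by (auto simp: reflexive_rel_def Ide_hom)

lemma diag_is_rel: "X \<in> Obj C \<Longrightarrow> is_rel C X (diag C X)"
  by (auto simp: is_rel_def diag_def hom_def)

lemma diag_mem:
  assumes "a \<in> hom C t X" "b \<in> hom C t X"
  shows "rel_mem C (diag C X) a b \<longleftrightarrow> a = b"
  using assms by (auto simp: rel_mem_def diag_def hom_def)

end


locale lex_category = category C for C :: "('o, 'm) cat" (structure) +
  assumes finitely_complete: "finitely_complete C"
begin

lemma pullbackE:
  assumes "f \<in> hom C A Z" "g \<in> hom C B Z"
  obtains P p q where "is_pullback C f g p q" "p \<in> hom C P A" "q \<in> hom C P B" "f \<cdot> p = g \<cdot> q"
proof -
  have "\<exists>p q. is_pullback C f g p q"
    using assms finitely_complete by (auto simp: finitely_complete_def hom_def)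
  then obtain p q where pb: "is_pullback C f g p q" by auto
  show ?thesis by (rule that[OF pb is_pullback_hom[OF pb assms]])
qed

lemma kernel_pair_ex:
  assumes "f \<in> hom C X Y"
  shows "\<exists>K. is_kernel_pair C f K"
proof -
  obtain P p q where "is_pullback C f f p q" by (rule pullbackE[OF assms assms])
  then have "is_kernel_pair C f (p, q)" by (simp add: is_kernel_pair_def)
  then show ?thesis by blast
qed

lemma is_kernel_pair_kernel_pair:
  "f \<in> hom C X Y \<Longrightarrow> is_kernel_pair C f (kernel_pair C f)"
  unfolding kernel_pair_def using kernel_pair_ex by (rule someI_ex)

lemma product_ex:
  assumes "A \<in> Obj C" "B \<in> Obj C"
  shows "\<exists>P p q. p \<in> hom C P A \<and> q \<in> hom C P B \<and>
    (\<forall>t. \<forall>a \<in> hom C t A. \<forall>b \<in> hom C t B. \<exists>u \<in> hom C t P. p \<cdot> u = a \<and> q \<cdot> u = b) \<and>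
    (\<forall>t. \<forall>u \<in> hom C t P. \<forall>v \<in> hom C t P. p \<cdot> u = p \<cdot> v \<and> q \<cdot> u = q \<cdot> v \<longrightarrow> u = v)"
proof -
  obtain T where T: "is_terminal C T"
    using finitely_complete by (auto simp: finitely_complete_def)
  obtain f g where f: "f \<in> hom C A T" and g: "g \<in> hom C B T"
    using T assms by (meson is_terminal_def)
  have eq: "f \<cdot> a = g \<cdot> b" if "a \<in> hom C t A" "b \<in> hom C t B" for t a b
  proof -
    have "f \<cdot> a \<in> hom C t T" "g \<cdot> b \<in> hom C t T" using that f g by (auto simp: hom_iff)
    then show ?thesis using T hom_Obj(1)[OF that(1)] by (metis is_terminal_def)
  qed
  obtain P p q where pb: "is_pullback C f g p q" "p \<in> hom C P A" "q \<in> hom C P B"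
    by (rule pullbackE[OF f g])
  have "\<exists>u \<in> hom C t P. p \<cdot> u = a \<and> q \<cdot> u = b" if "a \<in> hom C t A" "b \<in> hom C t B" for t a b
    by (rule is_pullback_ex[OF pb(1) f g pb(2) that eq[OF that]]) blast
  moreover have "u = v" if "u \<in> hom C t P" "v \<in> hom C t P" "p \<cdot> u = p \<cdot> v" "q \<cdot> u = q \<cdot> v" for t u v
    by (rule is_pullback_eqD[OF pb(1) f g pb(2) that])
  ultimately show ?thesis using pb(2,3) by blast
qed

text \<open>An arrow whose kernel pair is the intersection of two given kernel pairs; it serves both to
  bundle several conditions into one arrow and to represent meets of kernel pairs.\<close>

lemma pairing_ex:
  assumes "a \<in> hom C W A" "b \<in> hom C W B"
  obtains Z m where "m \<in> hom C W Z"
    "\<And>t u v. u \<in> hom C t W \<Longrightarrow> v \<in> hom C t W \<Longrightarrow>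
      m \<cdot> u = m \<cdot> v \<longleftrightarrow> a \<cdot> u = a \<cdot> v \<and> b \<cdot> u = b \<cdot> v"
proof -
  obtain P p q where P: "p \<in> hom C P A" "q \<in> hom C P B"
    "\<forall>t. \<forall>a \<in> hom C t A. \<forall>b \<in> hom C t B. \<exists>u \<in> hom C t P. p \<cdot> u = a \<and> q \<cdot> u = b"
    "\<forall>t. \<forall>u \<in> hom C t P. \<forall>v \<in> hom C t P. p \<cdot> u = p \<cdot> v \<and> q \<cdot> u = q \<cdot> v \<longrightarrow> u = v"
    using product_ex[OF hom_Obj(2)[OF assms(1)] hom_Obj(2)[OF assms(2)]] by blast
  obtain m where m: "m \<in> hom C W P" "p \<cdot> m = a" "q \<cdot> m = b" using P(3) assms by blast
  have eq: "p \<cdot> (m \<cdot> u) = a \<cdot> u" "q \<cdot> (m \<cdot> u) = b \<cdot> u" if "u \<in> hom C t W" for t u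
    using comp_eq_comp[OF m(2) that m(1) P(1)] comp_eq_comp[OF m(3) that m(1) P(2)] by auto
  have "m \<cdot> u = m \<cdot> v \<longleftrightarrow> a \<cdot> u = a \<cdot> v \<and> b \<cdot> u = b \<cdot> v"
    if "u \<in> hom C t W" "v \<in> hom C t W" for t u v
  proof -
    have "m \<cdot> u \<in> hom C t P" "m \<cdot> v \<in> hom C t P" using m(1) that by (auto simp: hom_iff)
    then show ?thesis using P(4) eq[OF that(1)] eq[OF that(2)] by metis
  qed
  then show ?thesis using m(1) that by blast
qed

text \<open>The inverse image is the limit of \<open>p\<close>, \<open>R\<close> and \<open>p\<close>, built from two successive pullbacks.\<close>

lemma inverse_image_ex:
  assumes "is_rel C X R" "p \<in> hom C X' X"
  shows "\<exists>P. is_rel C X' P \<and>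
    (\<forall>t. \<forall>a \<in> hom C t X'. \<forall>b \<in> hom C t X'. rel_mem C P a b \<longleftrightarrow> rel_mem C R (p \<cdot> a) (p \<cdot> b))"
proof -
  note R = is_rel_fst[OF assms(1)] is_rel_snd[OF assms(1)]
  obtain A a r where pbA: "is_pullback C p (fst R) a r"
    and A: "a \<in> hom C A X'" "r \<in> hom C A (Dom C (fst R))" "p \<cdot> a = fst R \<cdot> r"
    by (rule pullbackE[OF assms(2) R(1)])
  have sr: "snd R \<cdot> r \<in> hom C A X" using A R by (auto simp: hom_iff)
  obtain B c d where pbB: "is_pullback C (snd R \<cdot> r) p c d"
    and B: "c \<in> hom C B A" "d \<in> hom C B X'" "(snd R \<cdot> r) \<cdot> c = p \<cdot> d"
    by (rule pullbackE[OF sr assms(2)])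
  let ?P = "(a \<cdot> c, d)"
  have dom: "Dom C (a \<cdot> c) = B" using A B by (simp add: hom_iff)
  have e1: "p \<cdot> ((a \<cdot> c) \<cdot> u) = fst R \<cdot> (r \<cdot> (c \<cdot> u))"
    and e2: "p \<cdot> (d \<cdot> u) = snd R \<cdot> (r \<cdot> (c \<cdot> u))" if "u \<in> hom C t B" for t u
  proof -
    have "p \<cdot> (a \<cdot> (c \<cdot> u)) = fst R \<cdot> (r \<cdot> (c \<cdot> u))"
      using that by (intro square_comp[OF A(3) _ A(1) assms(2) A(2) R(1)] comp_in_hom[OF _ B(1)])
    then show "p \<cdot> ((a \<cdot> c) \<cdot> u) = fst R \<cdot> (r \<cdot> (c \<cdot> u))"
      using that A(1) B(1) by (simp add: Comp_assoc)
    have "(snd R \<cdot> r) \<cdot> (c \<cdot> u) = p \<cdot> (d \<cdot> u)"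
      using that by (intro square_comp[OF B(3) _ B(1) sr B(2) assms(2)])
    then show "p \<cdot> (d \<cdot> u) = snd R \<cdot> (r \<cdot> (c \<cdot> u))"
      using Comp_assoc[OF comp_in_hom[OF that B(1)] A(2) R(2)] by simp
  qed
  have rel: "is_rel C X' ?P"
    unfolding is_rel_def fst_conv snd_conv dom
  proof (intro conjI ballI impI)
    fix t u v assume u: "u \<in> hom C t B" and v: "v \<in> hom C t B"
      and eq: "(a \<cdot> c) \<cdot> u = (a \<cdot> c) \<cdot> v \<and> d \<cdot> u = d \<cdot> v"
    have cu: "c \<cdot> u \<in> hom C t A" "c \<cdot> v \<in> hom C t A" using u v B by (auto simp: hom_iff)
    have "r \<cdot> (c \<cdot> u) = r \<cdot> (c \<cdot> v)"
    proof (rule is_rel_eqD[OF assms(1)])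
      show "fst R \<cdot> (r \<cdot> (c \<cdot> u)) = fst R \<cdot> (r \<cdot> (c \<cdot> v))" using e1[OF u] e1[OF v] eq by simp
      show "snd R \<cdot> (r \<cdot> (c \<cdot> u)) = snd R \<cdot> (r \<cdot> (c \<cdot> v))" using e2[OF u] e2[OF v] eq by simp
    qed (use cu A in \<open>auto simp: hom_iff\<close>)
    moreover have "a \<cdot> (c \<cdot> u) = a \<cdot> (c \<cdot> v)" using eq Comp_assoc[OF u B(1) A(1)] Comp_assoc[OF v B(1) A(1)]
        by simp
    ultimately have "c \<cdot> u = c \<cdot> v" using is_pullback_eqD[OF pbA assms(2) R(1) A(1)] cu by blast
    then show "u = v" using is_pullback_eqD[OF pbB sr assms(2) B(1)] u v eq by blast
  qed (use A B in \<open>auto simp: hom_iff\<close>)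
  have "rel_mem C ?P x y \<longleftrightarrow> rel_mem C R (p \<cdot> x) (p \<cdot> y)"
    if x: "x \<in> hom C t X'" and y: "y \<in> hom C t X'" for t x y
  proof
    assume "rel_mem C ?P x y"
    then obtain u where u: "u \<in> hom C t B" "(a \<cdot> c) \<cdot> u = x" "d \<cdot> u = y"
      using x rel_memE[of ?P x y t X'] dom by auto
    then show "rel_mem C R (p \<cdot> x) (p \<cdot> y)"
      using e1[OF u(1)] e2[OF u(1)] x A(2) B(1) R assms(2)
      by (intro rel_memI[of "r \<cdot> (c \<cdot> u)" t _ _ X]) (auto simp: hom_iff)
  next
    assume "rel_mem C R (p \<cdot> x) (p \<cdot> y)"
    then obtain u where u: "u \<in> hom C t (Dom C (fst R))" "fst R \<cdot> u = p \<cdot> x" "snd R \<cdot> u = p \<cdot> y"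
      using x assms(2) by (metis rel_memE comp_in_hom)
    obtain w where w: "w \<in> hom C t A" "a \<cdot> w = x" "r \<cdot> w = u" 
      using is_pullback_ex[OF pbA assms(2) R(1) A(1) x u(1)] u(2) by metis
    have "(snd R \<cdot> r) \<cdot> w = p \<cdot> y" using u w Comp_assoc[OF w(1) A(2) R(2)] by simp
    then obtain s where s: "s \<in> hom C t B" "c \<cdot> s = w" "d \<cdot> s = y" 
      using is_pullback_ex[OF pbB sr assms(2) B(1) w(1) y] by metis
    then show "rel_mem C ?P x y"
      using w x A(1) B(1) dom by (intro rel_memI[of s t]) (auto simp: Comp_assoc)
  qed
  then show ?thesis using rel by blast
qed

text \<open>With this relation on its codomain, every arrow of \<open>C\<close> is compatible with relations.\<close>

lemma indiscrete_ex:
  assumes "X \<in> Obj C"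
  shows "\<exists>P. is_rel C X P \<and> (\<forall>t. \<forall>a \<in> hom C t X. \<forall>b \<in> hom C t X. rel_mem C P a b)"
proof -
  obtain P p q where P: "p \<in> hom C P X" "q \<in> hom C P X"
    "\<forall>t. \<forall>a \<in> hom C t X. \<forall>b \<in> hom C t X. \<exists>u \<in> hom C t P. p \<cdot> u = a \<and> q \<cdot> u = b"
    "\<forall>t. \<forall>u \<in> hom C t P. \<forall>v \<in> hom C t P. p \<cdot> u = p \<cdot> v \<and> q \<cdot> u = q \<cdot> v \<longrightarrow> u = v"
    using product_ex[OF assms assms] by blast
  have d: "Dom C p = P" using P by (simp add: hom_iff)
  have "is_rel C X (p, q)" using P d by (auto simp: is_rel_def)
  moreover have "rel_mem C (p, q) a b" if "a \<in> hom C t X" "b \<in> hom C t X" for t a b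
    using P(3) that d by (auto simp: rel_mem_def hom_iff)
  ultimately show ?thesis by blast
qed

end

section \<open>Regular epimorphisms as covers\<close>

context category
begin

abbreviation cover :: "'m \<Rightarrow> 'o \<Rightarrow> 'o \<Rightarrow> bool" where
  "cover c s t \<equiv> regular_epi C c \<and> c \<in> hom C s t"

lemma coequalizerI:
  assumes "a \<in> hom C A S" "b \<in> hom C A S" "q \<in> hom C S T" "q \<cdot> a = q \<cdot> b"
    and "\<And>Y k. k \<in> hom C S Y \<Longrightarrow> k \<cdot> a = k \<cdot> b \<Longrightarrow> \<exists>u \<in> hom C T Y. u \<cdot> q = k"
    and "\<And>Y u v. u \<in> hom C T Y \<Longrightarrow> v \<in> hom C T Y \<Longrightarrow> u \<cdot> q = v \<cdot> q \<Longrightarrow> u = v"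
  shows "is_coequalizer C a b q"
proof -
  have d: "Dom C a = A" "Cod C a = S" "Cod C q = T" "a \<in> Arr C" using assms(1,3) by (auto simp: hom_iff)
  have "\<exists>!u. u \<in> hom C T Y \<and> u \<cdot> q = k" if k: "k \<in> hom C S Y" "k \<cdot> a = k \<cdot> b" for Y k
    using assms(5)[OF k] assms(6) by metis
  then show ?thesis using assms(2-4) d by (simp add: is_coequalizer_def)
qed

lemma coverE:
  assumes "cover c S T"
  obtains A a b where "a \<in> hom C A S" "b \<in> hom C A S" "c \<cdot> a = c \<cdot> b"
    "\<And>Y k. k \<in> hom C S Y \<Longrightarrow> k \<cdot> a = k \<cdot> b \<Longrightarrow> \<exists>!u. u \<in> hom C T Y \<and> u \<cdot> c = k"
proof -
  obtain a b where ab: "is_coequalizer C a b c" using assms by (auto simp: regular_epi_def)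
  have d: "Cod C a = S" "Cod C c = T" "a \<in> hom C (Dom C a) S" "b \<in> hom C (Dom C a) S"
    "c \<cdot> a = c \<cdot> b"
    using ab assms by (auto simp: is_coequalizer_def hom_iff)
  have *: "\<forall>y \<in> Obj C. \<forall>k \<in> hom C S y. k \<cdot> a = k \<cdot> b \<longrightarrow> (\<exists>!u. u \<in> hom C T y \<and> u \<cdot> c = k)"
    using ab d by (simp add: is_coequalizer_def)
  have "\<exists>!u. u \<in> hom C T Y \<and> u \<cdot> c = k" if k: "k \<in> hom C S Y" "k \<cdot> a = k \<cdot> b" for Y k
    using * k hom_Obj(2)[OF k(1)] by blast
  then show ?thesis using that[OF d(3-5)] by blast
qed

lemma cover_epi:
  assumes "cover c S T" "u \<in> hom C T Y" "v \<in> hom C T Y" "u \<cdot> c = v \<cdot> c"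
  shows "u = v"
proof -
  obtain A a b where ab: "a \<in> hom C A S" "b \<in> hom C A S" "c \<cdot> a = c \<cdot> b"
    and un: "\<And>Y k. k \<in> hom C S Y \<Longrightarrow> k \<cdot> a = k \<cdot> b \<Longrightarrow> \<exists>!u. u \<in> hom C T Y \<and> u \<cdot> c = k"
    using assms(1) by (rule coverE) blast
  have c: "c \<in> hom C S T" using assms(1) by simp
  have "(u \<cdot> c) \<cdot> a = (u \<cdot> c) \<cdot> b" using Comp_assoc[OF ab(1) c assms(2)] Comp_assoc[OF ab(2) c assms(2)] ab(3)
      by simp
  then have "\<exists>!w. w \<in> hom C T Y \<and> w \<cdot> c = u \<cdot> c" by (rule un[OF comp_in_hom[OF c assms(2)]])
  then show ?thesis using assms by metis
qed

text \<open>In place of a particular pair that \<open>c\<close> coequalizes, the condition ranges over all pairs of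
  elements that \<open>c\<close> identifies; it therefore only has to be checked on generalized elements.\<close>

lemma cover_factor:
  assumes "cover c S T" "\<phi> \<in> hom C S Y"
    and "\<And>t a b. a \<in> hom C t S \<Longrightarrow> b \<in> hom C t S \<Longrightarrow> c \<cdot> a = c \<cdot> b \<Longrightarrow> \<phi> \<cdot> a = \<phi> \<cdot> b"
  obtains \<psi> where "\<psi> \<in> hom C T Y" "\<psi> \<cdot> c = \<phi>"
proof -
  obtain A a b where ab: "a \<in> hom C A S" "b \<in> hom C A S" "c \<cdot> a = c \<cdot> b"
    and un: "\<And>Y k. k \<in> hom C S Y \<Longrightarrow> k \<cdot> a = k \<cdot> b \<Longrightarrow> \<exists>!u. u \<in> hom C T Y \<and> u \<cdot> c = k"
    using assms(1) by (rule coverE) blast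
  show ?thesis using un[OF assms(2) assms(3)[OF ab]] that by blast
qed

lemma cover_Ide: "X \<in> Obj C \<Longrightarrow> cover (Ide C X) X X"
  unfolding regular_epi_def
  by (intro conjI exI[of _ "Ide C X"] coequalizerI[of _ X X _ _ X]) (auto simp: hom_iff)

text \<open>Membership in a relation is local: a relation is a monomorphism, and regular epimorphisms
  are orthogonal to monomorphisms.\<close>

lemma cover_rel_mem:
  assumes "is_rel C X R" "cover c S T" "a \<in> hom C T X" "b \<in> hom C T X"
    "rel_mem C R (a \<cdot> c) (b \<cdot> c)"
  shows "rel_mem C R a b"
proof -
  have c: "c \<in> hom C S T" using assms(2) by simp
  note R = is_rel_fst[OF assms(1)] is_rel_snd[OF assms(1)]
  obtain u where u: "u \<in> hom C S (Dom C (fst R))" "fst R \<cdot> u = a \<cdot> c" "snd R \<cdot> u = b \<cdot> c"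
    using assms(5) comp_in_hom[OF c assms(3)] by (rule rel_memE)
  obtain w where w: "w \<in> hom C T (Dom C (fst R))" "w \<cdot> c = u"
  proof (rule cover_factor[OF assms(2) u(1)])
    fix t x y assume x: "x \<in> hom C t S" and y: "y \<in> hom C t S" and eq: "c \<cdot> x = c \<cdot> y"
    have 1: "fst R \<cdot> (u \<cdot> x) = a \<cdot> (c \<cdot> x)" "fst R \<cdot> (u \<cdot> y) = a \<cdot> (c \<cdot> y)"
      "snd R \<cdot> (u \<cdot> x) = b \<cdot> (c \<cdot> x)" "snd R \<cdot> (u \<cdot> y) = b \<cdot> (c \<cdot> y)"
      using square_comp[OF u(2) _ u(1) R(1) c assms(3)] square_comp[OF u(3) _ u(1) R(2) c assms(4)] x y
      by auto
    show "u \<cdot> x = u \<cdot> y"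
      by (rule is_rel_eqD[OF assms(1) comp_in_hom[OF x u(1)] comp_in_hom[OF y u(1)]]) (use 1 eq in auto)
  qed
  have "fst R \<cdot> w = a"
    by (rule cover_epi[OF assms(2) comp_in_hom[OF w(1) R(1)] assms(3)])
      (use Comp_assoc[OF c w(1) R(1)] w u in simp)
  moreover have "snd R \<cdot> w = b"
    by (rule cover_epi[OF assms(2) comp_in_hom[OF w(1) R(2)] assms(4)])
      (use Comp_assoc[OF c w(1) R(2)] w u in simp)
  ultimately show ?thesis by (rule rel_memI[OF w(1) assms(3)])
qed

end


locale regular_cat = lex_category C for C :: "('o, 'm) cat" (structure) +
  assumes regular: "regular_category C"
begin

text \<open>The lift exists on the pullback of \<open>c\<close> along \<open>a\<close>. This is how surjectivity is used
  throughout.\<close>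

lemma cover_lift:
  assumes "cover c S T" "a \<in> hom C t T"
  obtains t' d b where "cover d t' t" "b \<in> hom C t' S" "c \<cdot> b = a \<cdot> d"
proof -
  have c: "c \<in> hom C S T" using assms(1) by simp
  obtain P p q where pb: "is_pullback C a c p q" "p \<in> hom C P t" "q \<in> hom C P S" "a \<cdot> p = c \<cdot> q"
    by (rule pullbackE[OF assms(2) c])
  have "regular_epi C p" using pb(1) assms(1) regular unfolding regular_category_def by blast
  then show ?thesis using that[of p P q] pb by simp
qed

text \<open>The first factor is the coequalizer of the kernel pair of \<open>f\<close>. The second factor \<open>m\<close> is
  monic because two elements of \<open>I\<close> with the same value under \<open>m\<close> lift locally to elements of \<open>A\<close>
  with the same value under \<open>f\<close>.\<close>

lemma image_factorization:
  assumes "f \<in> hom C A B"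
  obtains I e m where "cover e A I" "m \<in> hom C I B" "m \<cdot> e = f"
    "\<And>t u v. u \<in> hom C t I \<Longrightarrow> v \<in> hom C t I \<Longrightarrow> m \<cdot> u = m \<cdot> v \<Longrightarrow> u = v"
proof -
  obtain K where K: "is_kernel_pair C f K" using kernel_pair_ex[OF assms] by blast
  note Kr = kernel_pair_is_rel[OF K assms]
  obtain e where e: "is_coequalizer C (fst K) (snd K) e"
    using K regular unfolding regular_category_def by blast
  have "e \<in> hom C A (Cod C e)" and ee: "e \<cdot> fst K = e \<cdot> snd K"
    using e is_rel_fst[OF Kr] by (auto simp: is_coequalizer_def hom_iff)
  then have ce: "cover e A (Cod C e)" and eh: "e \<in> hom C A (Cod C e)"
    using e by (auto simp: regular_epi_def)
  let ?I = "Cod C e"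
  have fK: "f \<cdot> fst K = f \<cdot> snd K"
    using is_pullback_hom(3)[OF K[unfolded is_kernel_pair_def] assms assms] .
  have eqe: "e \<cdot> a = e \<cdot> b" if ab: "a \<in> hom C t A" "b \<in> hom C t A" "f \<cdot> a = f \<cdot> b" for t a b
  proof -
    have "rel_mem C K a b" using kernel_pair_mem[OF K assms ab(1,2)] ab(3) by simp
    then obtain u where u: "u \<in> hom C t (Dom C (fst K))" "fst K \<cdot> u = a" "snd K \<cdot> u = b"
      using ab(1) by (rule rel_memE)
    show ?thesis using square_comp[OF ee u(1) is_rel_fst[OF Kr] eh is_rel_snd[OF Kr] eh] u by simp
  qed
  have "\<exists>m \<in> hom C ?I B. m \<cdot> e = f"
  proof -
    have *: "\<forall>y \<in> Obj C. \<forall>k \<in> hom C A y. k \<cdot> fst K = k \<cdot> snd K \<longrightarrow> (\<exists>!u. u \<in> hom C ?I y \<and> u \<cdot> e = k)"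
      using e is_rel_fst[OF Kr] by (simp add: is_coequalizer_def hom_iff)
    show ?thesis using * assms fK hom_Obj(2)[OF assms] by blast
  qed
  then obtain m where m: "m \<in> hom C ?I B" "m \<cdot> e = f" by blast
  have "u = v" if u: "u \<in> hom C t ?I" and v: "v \<in> hom C t ?I" and eq: "m \<cdot> u = m \<cdot> v" for t u v
  proof -
    obtain t1 c1 a1 where 1: "cover c1 t1 t" "a1 \<in> hom C t1 A" "e \<cdot> a1 = u \<cdot> c1"
      by (rule cover_lift[OF ce u])
    have c1: "c1 \<in> hom C t1 t" using 1 by simp
    have vc1: "v \<cdot> c1 \<in> hom C t1 ?I" using v c1 by (rule comp_in_hom[rotated])
    obtain t2 c2 a2 where 2: "cover c2 t2 t1" "a2 \<in> hom C t2 A" "e \<cdot> a2 = (v \<cdot> c1) \<cdot> c2"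
      by (rule cover_lift[OF ce vc1])
    have c2: "c2 \<in> hom C t2 t1" using 2 by simp
    have a12: "a1 \<cdot> c2 \<in> hom C t2 A" using 1(2) c2 by (rule comp_in_hom[rotated])
    have e1: "e \<cdot> (a1 \<cdot> c2) = (u \<cdot> c1) \<cdot> c2" using comp_eq_comp[OF 1(3) c2 1(2) eh] .
    have "f \<cdot> (a1 \<cdot> c2) = m \<cdot> (e \<cdot> (a1 \<cdot> c2))" using comp_eq_comp[OF m(2) a12 eh m(1)] by simp
    also have "\<dots> = (m \<cdot> u) \<cdot> (c1 \<cdot> c2)" using e1 u c1 c2 m(1) by (simp add: hom_iff)
    also have "\<dots> = m \<cdot> (e \<cdot> a2)" using eq 2(3) v c1 c2 m(1) by (simp add: hom_iff)
    also have "\<dots> = f \<cdot> a2" using comp_eq_comp[OF m(2) 2(2) eh m(1)] .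
    finally have "e \<cdot> (a1 \<cdot> c2) = e \<cdot> a2" by (rule eqe[OF a12 2(2)])
    then have "(u \<cdot> c1) \<cdot> c2 = (v \<cdot> c1) \<cdot> c2" using e1 2(3) by simp
    then have "u \<cdot> c1 = v \<cdot> c1"
      by (rule cover_epi[OF 2(1) comp_in_hom[OF c1 u] vc1])
    then show "u = v" by (rule cover_epi[OF 1(1) u v])
  qed
  then show ?thesis using that[OF ce m] by blast
qed

text \<open>Regular epimorphisms are exactly the arrows that factor through no proper subobject. This
  description makes it evident that covers compose and that any arrow through which a cover
  factors is again a cover.\<close>

lemma cover_extremal:
  assumes "cover c S T" "m \<in> hom C I T" "k \<in> hom C S I" "m \<cdot> k = c"
    "\<And>t u v. u \<in> hom C t I \<Longrightarrow> v \<in> hom C t I \<Longrightarrow> m \<cdot> u = m \<cdot> v \<Longrightarrow> u = v"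
  obtains n where "n \<in> hom C T I" "m \<cdot> n = Ide C T" "n \<cdot> m = Ide C I" "n \<cdot> c = k"
proof -
  have c: "c \<in> hom C S T" using assms(1) by simp
  obtain n where n: "n \<in> hom C T I" "n \<cdot> c = k"
  proof (rule cover_factor[OF assms(1,3)])
    fix t a b assume a: "a \<in> hom C t S" and b: "b \<in> hom C t S" and eq: "c \<cdot> a = c \<cdot> b"
    have "m \<cdot> (k \<cdot> a) = c \<cdot> a" "m \<cdot> (k \<cdot> b) = c \<cdot> b"
      using comp_eq_comp[OF assms(4) _ assms(3,2)] a b by auto
    then show "k \<cdot> a = k \<cdot> b"
      using assms(5)[OF comp_in_hom[OF a assms(3)] comp_in_hom[OF b assms(3)]] eq by simp
  qed
  have T: "T \<in> Obj C" "I \<in> Obj C" using assms(2) hom_Obj by auto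
  have "(m \<cdot> n) \<cdot> c = Ide C T \<cdot> c"
    using Comp_assoc[OF c n(1) assms(2)] n assms(4) Ide_Comp[OF c] by simp
  then have mn: "m \<cdot> n = Ide C T"
    using cover_epi[OF assms(1) comp_in_hom[OF n(1) assms(2)] Ide_hom[OF T(1)]] by simp
  have "m \<cdot> (n \<cdot> m) = m \<cdot> Ide C I"
    using Comp_assoc[OF assms(2) n(1) assms(2)] mn Ide_Comp[OF assms(2)] Comp_Ide[OF assms(2)] by simp
  then have "n \<cdot> m = Ide C I"
    using assms(5)[OF comp_in_hom[OF assms(2) n(1)] Ide_hom[OF T(2)]] by simp
  then show ?thesis using that n mn by simp
qed

lemma extremal_cover:
  assumes "c \<in> hom C S T"
    and "\<And>I m k. m \<in> hom C I T \<Longrightarrow> k \<in> hom C S I \<Longrightarrow> m \<cdot> k = c \<Longrightarrow>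
      (\<And>t u v. u \<in> hom C t I \<Longrightarrow> v \<in> hom C t I \<Longrightarrow> m \<cdot> u = m \<cdot> v \<Longrightarrow> u = v) \<Longrightarrow>
      \<exists>n \<in> hom C T I. m \<cdot> n = Ide C T"
  shows "cover c S T"
proof -
  obtain I e m where e: "cover e S I" and m: "m \<in> hom C I T" "m \<cdot> e = c"
    and mono: "\<And>t u v. u \<in> hom C t I \<Longrightarrow> v \<in> hom C t I \<Longrightarrow> m \<cdot> u = m \<cdot> v \<Longrightarrow> u = v"
    by (rule image_factorization[OF assms(1)]) blast
  have eh: "e \<in> hom C S I" using e by simp
  obtain n where n: "n \<in> hom C T I" "m \<cdot> n = Ide C T" using assms(2)[OF m(1) eh m(2)] mono by blast
  have I: "I \<in> Obj C" using eh hom_Obj by auto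
  have "m \<cdot> (n \<cdot> m) = m \<cdot> Ide C I"
    using Comp_assoc[OF m(1) n(1) m(1)] n Ide_Comp[OF m(1)] Comp_Ide[OF m(1)] by simp
  then have nm: "n \<cdot> m = Ide C I"
    using mono[OF comp_in_hom[OF m(1) n(1)] Ide_hom[OF I]] by simp
  have nc: "n \<cdot> c = e" using Comp_assoc[OF eh m(1) n(1)] nm m(2) Ide_Comp[OF eh] by simp
  obtain A a b where ab: "a \<in> hom C A S" "b \<in> hom C A S" "e \<cdot> a = e \<cdot> b"
    and un: "\<And>Y k. k \<in> hom C S Y \<Longrightarrow> k \<cdot> a = k \<cdot> b \<Longrightarrow> \<exists>!u. u \<in> hom C I Y \<and> u \<cdot> e = k"
    using e by (rule coverE) blast
  have "is_coequalizer C a b c"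
  proof (rule coequalizerI[OF ab(1,2) assms(1)])
    show "c \<cdot> a = c \<cdot> b" using Comp_assoc[OF ab(1) eh m(1)] Comp_assoc[OF ab(2) eh m(1)] ab(3) m(2) by simp
    fix Y
    show "\<exists>u \<in> hom C T Y. u \<cdot> c = k" if k: "k \<in> hom C S Y" "k \<cdot> a = k \<cdot> b" for k
    proof -
      obtain u where u: "u \<in> hom C I Y" "u \<cdot> e = k" using un[OF k] by blast
      have "(u \<cdot> n) \<cdot> c = k" using Comp_assoc[OF assms(1) n(1) u(1)] nc u(2) by simp
      then show ?thesis using comp_in_hom[OF n(1) u(1)] by blast
    qed
    show "u = v" if u: "u \<in> hom C T Y" and v: "v \<in> hom C T Y" and eq: "u \<cdot> c = v \<cdot> c" for u v
    proof -
      have "(u \<cdot> m) \<cdot> e = (v \<cdot> m) \<cdot> e" using Comp_assoc[OF eh m(1) u] Comp_assoc[OF eh m(1) v] eq m(2) by simp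
      then have "u \<cdot> m = v \<cdot> m" using cover_epi[OF e comp_in_hom[OF m(1) u] comp_in_hom[OF m(1) v]] by simp
      then have "(u \<cdot> m) \<cdot> n = (v \<cdot> m) \<cdot> n" by simp
      then show "u = v" using Comp_assoc[OF n(1) m(1) u] Comp_assoc[OF n(1) m(1) v] n(2) Comp_Ide[OF u]
          Comp_Ide[OF v] by simp
    qed
  qed
  then show ?thesis using assms(1) by (auto simp: regular_epi_def)
qed

lemma cover_if_factors:
  assumes "cover d S' T" "c \<in> hom C S T" "s \<in> hom C S' S" "c \<cdot> s = d"
  shows "cover c S T"
proof (rule extremal_cover[OF assms(2)])
  fix I m k
  assume m: "m \<in> hom C I T" and k: "k \<in> hom C S I" and mk: "m \<cdot> k = c"
    and mono: "\<And>t u v. u \<in> hom C t I \<Longrightarrow> v \<in> hom C t I \<Longrightarrow> m \<cdot> u = m \<cdot> v \<Longrightarrow> u = v"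
  have "m \<cdot> (k \<cdot> s) = d" using comp_eq_comp[OF mk assms(3) k m] assms(4) by simp
  then obtain n where "n \<in> hom C T I" "m \<cdot> n = Ide C T"
    using cover_extremal[OF assms(1) m comp_in_hom[OF assms(3) k]] mono by metis
  then show "\<exists>n \<in> hom C T I. m \<cdot> n = Ide C T" by blast
qed

lemma cover_comp:
  assumes "cover c S T" "cover d S' S"
  shows "cover (c \<cdot> d) S' T"
proof (rule extremal_cover)
  have c: "c \<in> hom C S T" and d: "d \<in> hom C S' S" using assms by auto
  show "c \<cdot> d \<in> hom C S' T" using d c by (rule comp_in_hom)
  fix I m k
  assume m: "m \<in> hom C I T" and k: "k \<in> hom C S' I" and mk: "m \<cdot> k = c \<cdot> d"
    and mono: "\<And>t u v. u \<in> hom C t I \<Longrightarrow> v \<in> hom C t I \<Longrightarrow> m \<cdot> u = m \<cdot> v \<Longrightarrow> u = v"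
  obtain l where l: "l \<in> hom C S I" "l \<cdot> d = k"
  proof (rule cover_factor[OF assms(2) k])
    fix t a b assume a: "a \<in> hom C t S'" and b: "b \<in> hom C t S'" and eq: "d \<cdot> a = d \<cdot> b"
    have "m \<cdot> (k \<cdot> a) = m \<cdot> (k \<cdot> b)"
      using square_comp[OF mk a k m d c] square_comp[OF mk b k m d c] eq by simp
    then show "k \<cdot> a = k \<cdot> b" by (rule mono[OF comp_in_hom[OF a k] comp_in_hom[OF b k]])
  qed
  have "(m \<cdot> l) \<cdot> d = c \<cdot> d" using Comp_assoc[OF d l(1) m] l(2) mk by simp
  then have "m \<cdot> l = c" by (rule cover_epi[OF assms(2) comp_in_hom[OF l(1) m] c])
  then obtain n where "n \<in> hom C T I" "m \<cdot> n = Ide C T"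
    using cover_extremal[OF assms(1) m l(1)] mono by metis
  then show "\<exists>n \<in> hom C T I. m \<cdot> n = Ide C T" by blast
qed

lemma pullback_cover_snd:
  assumes "is_pullback C f g p q" "cover f A Z" "g \<in> hom C B Z" "p \<in> hom C P A"
  shows "cover q P B"
proof -
  have f: "f \<in> hom C A Z" using assms(2) by simp
  have q: "q \<in> hom C P B" using is_pullback_hom(1,2)[OF assms(1) f assms(3)] assms(4) by (simp add: hom_iff)
  obtain t d b where d: "cover d t B" "b \<in> hom C t A" "f \<cdot> b = g \<cdot> d"
    by (rule cover_lift[OF assms(2,3)])
  have "d \<in> hom C t B" using d(1) by simp
  then obtain s where "s \<in> hom C t P" "q \<cdot> s = d"
    using is_pullback_ex[OF assms(1) f assms(3,4) d(2) _ d(3)] by metis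
  then show ?thesis using cover_if_factors[OF d(1) q] by blast
qed

end

section \<open>Difunctionality in a Mal'tsev category\<close>

locale maltsev_cat = lex_category C for C :: "('o, 'm) cat" (structure) +
  assumes maltsev: "maltsev_category C"
begin

lemma reflexive_equiv_rel: "reflexive_rel C X R \<Longrightarrow> equiv_rel C X R"
  using maltsev hom_Obj(2)[OF is_rel_fst[OF reflexive_rel_is_rel]]
  unfolding maltsev_category_def by metis

text \<open>The classical argument: relate \<open>n1\<close> to \<open>n2\<close> when some element combines the \<open>\<alpha>\<close>-coordinate of
  \<open>n1\<close> with the \<open>\<beta>\<close>-coordinate of \<open>n2\<close>. This relation on \<open>W\<close> is reflexive, hence transitive, and
  the hypotheses put the pairs \<open>(w1, w2)\<close> and \<open>(w2, w3)\<close> into it.\<close>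

lemma difunctional:
  assumes \<alpha>: "\<alpha> \<in> hom C W A" and \<beta>: "\<beta> \<in> hom C W B"
    and jm: "\<And>t u v. u \<in> hom C t W \<Longrightarrow> v \<in> hom C t W \<Longrightarrow> \<alpha> \<cdot> u = \<alpha> \<cdot> v \<Longrightarrow> \<beta> \<cdot> u = \<beta> \<cdot> v \<Longrightarrow> u = v"
    and w: "w1 \<in> hom C t W" "w2 \<in> hom C t W" "w3 \<in> hom C t W"
    and eq: "\<beta> \<cdot> w1 = \<beta> \<cdot> w2" "\<alpha> \<cdot> w2 = \<alpha> \<cdot> w3"
  obtains w where "w \<in> hom C t W" "\<alpha> \<cdot> w = \<alpha> \<cdot> w1" "\<beta> \<cdot> w = \<beta> \<cdot> w3"
proof -
  have W: "W \<in> Obj C" using \<alpha> hom_Obj by auto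
  \<comment> \<open>\<open>M\<close> consists of the triples of \<open>n1\<close>, a witness and \<open>n2\<close>; since \<open>\<alpha>\<close> and \<open>\<beta>\<close> are jointly monic,
    the witness is determined by \<open>n1\<close> and \<open>n2\<close>\<close>
  obtain N p1 p2 where pb1: "is_pullback C \<alpha> \<alpha> p1 p2"
    and p: "p1 \<in> hom C N W" "p2 \<in> hom C N W" "\<alpha> \<cdot> p1 = \<alpha> \<cdot> p2"
    by (rule pullbackE[OF \<alpha> \<alpha>])
  have \<beta>p: "\<beta> \<cdot> p2 \<in> hom C N B" using p(2) \<beta> by (rule comp_in_hom)
  obtain M r s where pb2: "is_pullback C (\<beta> \<cdot> p2) \<beta> r s"
    and r: "r \<in> hom C M N" "s \<in> hom C M W" "(\<beta> \<cdot> p2) \<cdot> r = \<beta> \<cdot> s"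
    by (rule pullbackE[OF \<beta>p \<beta>])
  let ?U = "(p1 \<cdot> r, s)"
  have p1r: "p1 \<cdot> r \<in> hom C M W" using r(1) p(1) by (rule comp_in_hom)
  have dom: "Dom C (p1 \<cdot> r) = M" using p1r by (simp add: hom_iff)
  have \<alpha>eq: "\<alpha> \<cdot> (p2 \<cdot> (r \<cdot> u)) = \<alpha> \<cdot> ((p1 \<cdot> r) \<cdot> u)" and \<beta>eq: "\<beta> \<cdot> (p2 \<cdot> (r \<cdot> u)) = \<beta> \<cdot> (s \<cdot> u)"
    if u: "u \<in> hom C x M" for x u
  proof -
    have "\<alpha> \<cdot> (p1 \<cdot> (r \<cdot> u)) = \<alpha> \<cdot> (p2 \<cdot> (r \<cdot> u))"
      by (rule square_comp[OF p(3) comp_in_hom[OF u r(1)] p(1) \<alpha> p(2) \<alpha>])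
    then show "\<alpha> \<cdot> (p2 \<cdot> (r \<cdot> u)) = \<alpha> \<cdot> ((p1 \<cdot> r) \<cdot> u)" using Comp_assoc[OF u r(1) p(1)] by simp
    have "(\<beta> \<cdot> p2) \<cdot> (r \<cdot> u) = \<beta> \<cdot> (s \<cdot> u)" by (rule square_comp[OF r(3) u r(1) \<beta>p r(2) \<beta>])
    then show "\<beta> \<cdot> (p2 \<cdot> (r \<cdot> u)) = \<beta> \<cdot> (s \<cdot> u)"
      using Comp_assoc[OF comp_in_hom[OF u r(1)] p(2) \<beta>] by simp
  qed
  have rel: "is_rel C W ?U"
    unfolding is_rel_def fst_conv snd_conv dom
  proof (intro conjI ballI impI p1r r(2))
    fix x u v assume u: "u \<in> hom C x M" and v: "v \<in> hom C x M"
      and e: "(p1 \<cdot> r) \<cdot> u = (p1 \<cdot> r) \<cdot> v \<and> s \<cdot> u = s \<cdot> v"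
    have ru: "r \<cdot> u \<in> hom C x N" "r \<cdot> v \<in> hom C x N" using u v r(1) by (auto simp: hom_iff)
    have "p2 \<cdot> (r \<cdot> u) = p2 \<cdot> (r \<cdot> v)"
      using \<alpha>eq[OF u] \<alpha>eq[OF v] \<beta>eq[OF u] \<beta>eq[OF v] e
      by (intro jm[OF comp_in_hom[OF ru(1) p(2)] comp_in_hom[OF ru(2) p(2)]]) auto
    moreover have "p1 \<cdot> (r \<cdot> u) = p1 \<cdot> (r \<cdot> v)"
      using Comp_assoc[OF u r(1) p(1)] Comp_assoc[OF v r(1) p(1)] e by simp
    ultimately have "r \<cdot> u = r \<cdot> v" using is_pullback_eqD[OF pb1 \<alpha> \<alpha> p(1) ru] by simp
    then show "u = v" using is_pullback_eqD[OF pb2 \<beta>p \<beta> r(1) u v] e by simp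
  qed
  have memI: "rel_mem C ?U n1 n2"
    if n: "n1 \<in> hom C x W" "n2 \<in> hom C x W" "n \<in> hom C x W" and e: "\<alpha> \<cdot> n1 = \<alpha> \<cdot> n" "\<beta> \<cdot> n = \<beta> \<cdot> n2"
    for x n1 n2 n
  proof -
    obtain l where l: "l \<in> hom C x N" "p1 \<cdot> l = n1" "p2 \<cdot> l = n"
      by (rule is_pullback_ex[OF pb1 \<alpha> \<alpha> p(1) n(1,3) e(1)])
    have "(\<beta> \<cdot> p2) \<cdot> l = \<beta> \<cdot> n2" using Comp_assoc[OF l(1) p(2) \<beta>] l(3) e(2) by simp
    then obtain m where m: "m \<in> hom C x M" "r \<cdot> m = l" "s \<cdot> m = n2"
      by (rule is_pullback_ex[OF pb2 \<beta>p \<beta> r(1) l(1) n(2)])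
    show ?thesis
      by (rule rel_memI[OF _ n(1), of m]) (use m dom l Comp_assoc[OF m(1) r(1) p(1)] in auto)
  qed
  have "reflexive_rel C W ?U"
    unfolding reflexive_rel_def using rel memI[OF Ide_hom[OF W] Ide_hom[OF W] Ide_hom[OF W]] by simp
  then have U: "equiv_rel C W ?U" by (rule reflexive_equiv_rel)
  have "rel_mem C ?U w1 w2" using memI[OF w(1,2) w(1)] eq by simp
  moreover have "rel_mem C ?U w2 w3" using memI[OF w(2,3) w(3)] eq by simp
  ultimately have "rel_mem C ?U w1 w3" using equiv_rel_trans[OF U _ _ w(1)] by blast
  then obtain u where u: "u \<in> hom C t M" "(p1 \<cdot> r) \<cdot> u = w1" "s \<cdot> u = w3"
    using rel_memE[OF _ w(1)] dom by (metis fst_conv snd_conv)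
  show ?thesis
    using that[OF comp_in_hom[OF comp_in_hom[OF u(1) r(1)] p(2)]] \<alpha>eq[OF u(1)] \<beta>eq[OF u(1)] u(2,3) by simp
qed

text \<open>The pairs \<open>(u, u')\<close> with \<open>\<phi> u = \<psi> u'\<close> form the pullback of \<open>\<phi>\<close> and \<open>\<psi>\<close>, which is a relation
  between the \<open>\<alpha>\<close>-coordinates and the \<open>\<beta>\<close>-coordinates of such pairs. It is difunctional, so that
  membership of the corners \<open>1\<close>, \<open>2\<close>, \<open>3\<close> of a rectangle forces membership of the fourth. Taking
  \<open>\<phi> = \<psi>\<close> compares two elements, taking \<open>u = u'\<close> compares two arrows.\<close>

lemma maltsev_square:
  assumes \<alpha>: "\<alpha> \<in> hom C P A" and \<beta>: "\<beta> \<in> hom C P B"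
    and jm: "\<And>t u v. u \<in> hom C t P \<Longrightarrow> v \<in> hom C t P \<Longrightarrow> \<alpha> \<cdot> u = \<alpha> \<cdot> v \<Longrightarrow> \<beta> \<cdot> u = \<beta> \<cdot> v \<Longrightarrow> u = v"
    and \<alpha>': "\<alpha>' \<in> hom C P' A'" and \<beta>': "\<beta>' \<in> hom C P' B'"
    and jm': "\<And>t u v. u \<in> hom C t P' \<Longrightarrow> v \<in> hom C t P' \<Longrightarrow> \<alpha>' \<cdot> u = \<alpha>' \<cdot> v \<Longrightarrow> \<beta>' \<cdot> u = \<beta>' \<cdot> v \<Longrightarrow> u = v"
    and \<phi>: "\<phi> \<in> hom C P Y" and \<psi>: "\<psi> \<in> hom C P' Y"
    and u: "u \<in> hom C t P" "u1 \<in> hom C t P" "u2 \<in> hom C t P" "u3 \<in> hom C t P"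
    and u': "u' \<in> hom C t P'" "u1' \<in> hom C t P'" "u2' \<in> hom C t P'" "u3' \<in> hom C t P'"
    and e: "\<alpha> \<cdot> u = \<alpha> \<cdot> u1" "\<beta> \<cdot> u1 = \<beta> \<cdot> u2" "\<alpha> \<cdot> u2 = \<alpha> \<cdot> u3" "\<beta> \<cdot> u = \<beta> \<cdot> u3"
    and e': "\<alpha>' \<cdot> u' = \<alpha>' \<cdot> u1'" "\<beta>' \<cdot> u1' = \<beta>' \<cdot> u2'" "\<alpha>' \<cdot> u2' = \<alpha>' \<cdot> u3'" "\<beta>' \<cdot> u' = \<beta>' \<cdot> u3'"
    and agree: "\<phi> \<cdot> u1 = \<psi> \<cdot> u1'" "\<phi> \<cdot> u2 = \<psi> \<cdot> u2'" "\<phi> \<cdot> u3 = \<psi> \<cdot> u3'"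
  shows "\<phi> \<cdot> u = \<psi> \<cdot> u'"
proof -
  obtain N k k' where pb: "is_pullback C \<phi> \<psi> k k'" and k: "k \<in> hom C N P" "k' \<in> hom C N P'"
    and sq: "\<phi> \<cdot> k = \<psi> \<cdot> k'"
    by (rule pullbackE[OF \<phi> \<psi>])
  obtain n1 where n1: "n1 \<in> hom C t N" "k \<cdot> n1 = u1" "k' \<cdot> n1 = u1'"
    by (rule is_pullback_ex[OF pb \<phi> \<psi> k(1) u(2) u'(2) agree(1)])
  obtain n2 where n2: "n2 \<in> hom C t N" "k \<cdot> n2 = u2" "k' \<cdot> n2 = u2'"
    by (rule is_pullback_ex[OF pb \<phi> \<psi> k(1) u(3) u'(3) agree(2)])
  obtain n3 where n3: "n3 \<in> hom C t N" "k \<cdot> n3 = u3" "k' \<cdot> n3 = u3'"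
    by (rule is_pullback_ex[OF pb \<phi> \<psi> k(1) u(4) u'(4) agree(3)])
  have ak: "\<alpha> \<cdot> k \<in> hom C N A" "\<alpha>' \<cdot> k' \<in> hom C N A'" "\<beta> \<cdot> k \<in> hom C N B" "\<beta>' \<cdot> k' \<in> hom C N B'"
    using k \<alpha> \<alpha>' \<beta> \<beta>' by (auto simp: hom_iff)
  obtain Za a where a: "a \<in> hom C N Za"
    "\<And>t u v. u \<in> hom C t N \<Longrightarrow> v \<in> hom C t N \<Longrightarrow>
      a \<cdot> u = a \<cdot> v \<longleftrightarrow> (\<alpha> \<cdot> k) \<cdot> u = (\<alpha> \<cdot> k) \<cdot> v \<and> (\<alpha>' \<cdot> k') \<cdot> u = (\<alpha>' \<cdot> k') \<cdot> v"
    by (rule pairing_ex[OF ak(1,2)]) blast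
  obtain Zb b where b: "b \<in> hom C N Zb"
    "\<And>t u v. u \<in> hom C t N \<Longrightarrow> v \<in> hom C t N \<Longrightarrow>
      b \<cdot> u = b \<cdot> v \<longleftrightarrow> (\<beta> \<cdot> k) \<cdot> u = (\<beta> \<cdot> k) \<cdot> v \<and> (\<beta>' \<cdot> k') \<cdot> u = (\<beta>' \<cdot> k') \<cdot> v"
    by (rule pairing_ex[OF ak(3,4)]) blast
  have a': "a \<cdot> u = a \<cdot> v \<longleftrightarrow> \<alpha> \<cdot> (k \<cdot> u) = \<alpha> \<cdot> (k \<cdot> v) \<and> \<alpha>' \<cdot> (k' \<cdot> u) = \<alpha>' \<cdot> (k' \<cdot> v)"
    and b': "b \<cdot> u = b \<cdot> v \<longleftrightarrow> \<beta> \<cdot> (k \<cdot> u) = \<beta> \<cdot> (k \<cdot> v) \<and> \<beta>' \<cdot> (k' \<cdot> u) = \<beta>' \<cdot> (k' \<cdot> v)"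
    if "u \<in> hom C t N" "v \<in> hom C t N" for t u v
    using a(2)[OF that] b(2)[OF that] Comp_assoc[OF _ k(1) \<alpha>] Comp_assoc[OF _ k(2) \<alpha>']
      Comp_assoc[OF _ k(1) \<beta>] Comp_assoc[OF _ k(2) \<beta>'] that by auto
  obtain n where n: "n \<in> hom C t N" "a \<cdot> n = a \<cdot> n1" "b \<cdot> n = b \<cdot> n3"
  proof (rule difunctional[OF a(1) b(1) _ n1(1) n2(1) n3(1)])
    fix t u v assume u: "u \<in> hom C t N" and v: "v \<in> hom C t N" and "a \<cdot> u = a \<cdot> v" "b \<cdot> u = b \<cdot> v"
    then have *: "\<alpha> \<cdot> (k \<cdot> u) = \<alpha> \<cdot> (k \<cdot> v)" "\<alpha>' \<cdot> (k' \<cdot> u) = \<alpha>' \<cdot> (k' \<cdot> v)"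
      "\<beta> \<cdot> (k \<cdot> u) = \<beta> \<cdot> (k \<cdot> v)" "\<beta>' \<cdot> (k' \<cdot> u) = \<beta>' \<cdot> (k' \<cdot> v)"
      using a'[OF u v] b'[OF u v] by auto
    have "k \<cdot> u = k \<cdot> v" using jm[OF comp_in_hom[OF u k(1)] comp_in_hom[OF v k(1)]] * by simp
    moreover have "k' \<cdot> u = k' \<cdot> v" using jm'[OF comp_in_hom[OF u k(2)] comp_in_hom[OF v k(2)]] * by simp
    ultimately show "u = v" by (rule is_pullback_eqD[OF pb \<phi> \<psi> k(1) u v])
  next
    show "b \<cdot> n1 = b \<cdot> n2" using b'[OF n1(1) n2(1)] n1 n2 e e' by simp
    show "a \<cdot> n2 = a \<cdot> n3" using a'[OF n2(1) n3(1)] n2 n3 e e' by simp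
  qed
  have "k \<cdot> n = u"
    using a'[OF n(1) n1(1)] b'[OF n(1) n3(1)] n n1 n3 e by (intro jm[OF comp_in_hom[OF n(1) k(1)] u(1)]) auto
  moreover have "k' \<cdot> n = u'"
    using a'[OF n(1) n1(1)] b'[OF n(1) n3(1)] n n1 n3 e' by (intro jm'[OF comp_in_hom[OF n(1) k(2)] u'(1)]) auto
  ultimately show ?thesis using square_comp[OF sq n(1) k(1) \<phi> k(2) \<psi>] by simp
qed

end

text \<open>By the Yoneda lemma these are the arrows \<open>K \<times>\<^sub>X V \<rightarrow> Y\<close>, where \<open>V\<close> lies over \<open>X\<close> by \<open>b\<close>.
  Writing out \<open>y = b v\<close> as an argument keeps the notation close to that of connectors.\<close>

definition natural_op :: "('o, 'm) cat \<Rightarrow> 'o \<Rightarrow> 'm rl \<Rightarrow> 'o \<Rightarrow> 'm \<Rightarrow> 'o \<Rightarrow> ('m \<Rightarrow> 'm \<Rightarrow> 'm \<Rightarrow> 'm) \<Rightarrow> bool" where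
  "natural_op C X K V b Y F \<longleftrightarrow>
    (\<forall>t x y v. x \<in> hom C t X \<and> y \<in> hom C t X \<and> v \<in> hom C t V \<and> rel_mem C K x y \<and> Comp C b v = y \<longrightarrow>
      F x y v \<in> hom C t Y \<and> (\<forall>t' s. s \<in> hom C t' t \<longrightarrow> F (Comp C x s) (Comp C y s) (Comp C v s) = Comp C (F x y v)
          s))"

context maltsev_cat
begin

text \<open>A rectangle in \<open>K \<times>\<^sub>X V\<close> has corners \<open>(x, y, v)\<close>, \<open>(x, y, v0)\<close>, \<open>(y, y, v0)\<close> and \<open>(y, y,
  v)\<close>. For the operations that occur, the values at the last three corners are given by unit laws.\<close>

lemma natural_op_agree:
  assumes K: "reflexive_rel C X K" and b: "b \<in> hom C V X" and F: "natural_op C X K V b Y F"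
    and K': "reflexive_rel C X' K'" and b': "b' \<in> hom C V' X'" and G: "natural_op C X' K' V' b' Y G"
    and v: "x \<in> hom C t X" "v \<in> hom C t V" "v0 \<in> hom C t V" "b \<cdot> v = y" "b \<cdot> v0 = y" "rel_mem C K x y"
    and v': "x' \<in> hom C t X'" "v' \<in> hom C t V'" "v0' \<in> hom C t V'" "b' \<cdot> v' = y'" "b' \<cdot> v0' = y'"
        "rel_mem C K' x' y'"
    and agree: "F x y v0 = G x' y' v0'" "F y y v0 = G y' y' v0'" "F y y v = G y' y' v'"
  shows "F x y v = G x' y' v'"
proof -
  \<comment> \<open>the generic element of \<open>K \<times>\<^sub>X V\<close> turns a natural operation into an arrow\<close>
  have *: "\<exists>P \<alpha> \<beta> A \<phi>. \<alpha> \<in> hom C P A \<and> \<beta> \<in> hom C P V \<and> \<phi> \<in> hom C P Y \<and>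
      (\<forall>t u v. u \<in> hom C t P \<longrightarrow> v \<in> hom C t P \<longrightarrow> \<alpha> \<cdot> u = \<alpha> \<cdot> v \<longrightarrow> \<beta> \<cdot> u = \<beta> \<cdot> v \<longrightarrow> u = v) \<and>
      (\<forall>t x v. x \<in> hom C t X \<and> v \<in> hom C t V \<and> rel_mem C K x (b \<cdot> v) \<longrightarrow> (\<exists>k. \<forall>v'. v' \<in> hom C t V \<and>
          b \<cdot> v' = b \<cdot> v \<longrightarrow>
        (\<exists>u \<in> hom C t P. \<alpha> \<cdot> u = k \<and> \<beta> \<cdot> u = v' \<and> \<phi> \<cdot> u = F x (b \<cdot> v) v')))"
    if K: "reflexive_rel C X K" and b: "b \<in> hom C V X" and F: "natural_op C X K V b Y F"
    for K X b V F
  proof -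
    have Kr: "is_rel C X K" using K by (rule reflexive_rel_is_rel)
    note k = is_rel_fst[OF Kr] is_rel_snd[OF Kr]
    let ?A = "Dom C (fst K)"
    obtain P \<alpha> \<beta> where pb: "is_pullback C (snd K) b \<alpha> \<beta>"
      and p: "\<alpha> \<in> hom C P ?A" "\<beta> \<in> hom C P V" "snd K \<cdot> \<alpha> = b \<cdot> \<beta>"
      by (rule pullbackE[OF k(2) b])
    let ?x = "fst K \<cdot> \<alpha>" and ?y = "snd K \<cdot> \<alpha>"
    have xy: "?x \<in> hom C P X" "?y \<in> hom C P X" using comp_in_hom[OF p(1) k(1)] comp_in_hom[OF p(1) k(2)] by auto
    have mem: "rel_mem C K ?x ?y" by (rule rel_memI[OF p(1) xy(1)]) auto
    let ?\<phi> = "F ?x ?y \<beta>"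
    have F1: "?\<phi> \<in> hom C P Y" and F2: "s \<in> hom C t' P \<Longrightarrow> F (?x \<cdot> s) (?y \<cdot> s) (\<beta> \<cdot> s) = ?\<phi> \<cdot> s" for t' s
      using F xy p(2,3) mem unfolding natural_op_def by auto
    have jm: "u = v" if "u \<in> hom C t P" "v \<in> hom C t P" "\<alpha> \<cdot> u = \<alpha> \<cdot> v" "\<beta> \<cdot> u = \<beta> \<cdot> v" for t u v
      by (rule is_pullback_eqD[OF pb k(2) b p(1) that])
    have "\<exists>k. \<forall>v'. v' \<in> hom C t V \<and> b \<cdot> v' = b \<cdot> v \<longrightarrow>
        (\<exists>u \<in> hom C t P. \<alpha> \<cdot> u = k \<and> \<beta> \<cdot> u = v' \<and> ?\<phi> \<cdot> u = F x (b \<cdot> v) v')"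
      if x: "x \<in> hom C t X" and v: "v \<in> hom C t V" and m: "rel_mem C K x (b \<cdot> v)" for t x v
    proof -
      obtain l where l: "l \<in> hom C t ?A" "fst K \<cdot> l = x" "snd K \<cdot> l = b \<cdot> v" using m x by (rule rel_memE)
      have "\<exists>u \<in> hom C t P. \<alpha> \<cdot> u = l \<and> \<beta> \<cdot> u = v' \<and> ?\<phi> \<cdot> u = F x (b \<cdot> v) v'"
        if v': "v' \<in> hom C t V" "b \<cdot> v' = b \<cdot> v" for v'
      proof -
        have "snd K \<cdot> l = b \<cdot> v'" using l(3) v'(2) by simp
        then obtain u where u: "u \<in> hom C t P" "\<alpha> \<cdot> u = l" "\<beta> \<cdot> u = v'"
          by (rule is_pullback_ex[OF pb k(2) b p(1) l(1) v'(1)])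
        have "?x \<cdot> u = x" "?y \<cdot> u = b \<cdot> v"
          using Comp_assoc[OF u(1) p(1) k(1)] Comp_assoc[OF u(1) p(1) k(2)] u(2) l by auto
        then show ?thesis using F2[OF u(1)] u by (intro bexI[OF _ u(1)]) simp
      qed
      then show ?thesis by blast
    qed
    then show ?thesis using p F1 jm
      by (intro exI[of _ P] exI[of _ \<alpha>] exI[of _ \<beta>] exI[of _ ?A] exI[of _ ?\<phi>]) blast
  qed
  obtain P \<alpha> \<beta> A \<phi> where P: "\<alpha> \<in> hom C P A" "\<beta> \<in> hom C P V" "\<phi> \<in> hom C P Y"
    and jm: "\<forall>t u v. u \<in> hom C t P \<longrightarrow> v \<in> hom C t P \<longrightarrow> \<alpha> \<cdot> u = \<alpha> \<cdot> v \<longrightarrow> \<beta> \<cdot> u = \<beta> \<cdot> v \<longrightarrow> u = v"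
    and ex: "\<forall>t x v. x \<in> hom C t X \<and> v \<in> hom C t V \<and> rel_mem C K x (b \<cdot> v) \<longrightarrow> (\<exists>k. \<forall>v'. v' \<in> hom C t V \<and>
        b \<cdot> v' = b \<cdot> v \<longrightarrow>
        (\<exists>u \<in> hom C t P. \<alpha> \<cdot> u = k \<and> \<beta> \<cdot> u = v' \<and> \<phi> \<cdot> u = F x (b \<cdot> v) v'))"
    using *[OF K b F] by (elim exE conjE)
  obtain P' \<alpha>' \<beta>' A' \<psi> where P': "\<alpha>' \<in> hom C P' A'" "\<beta>' \<in> hom C P' V'" "\<psi> \<in> hom C P' Y"
    and jm': "\<forall>t u v. u \<in> hom C t P' \<longrightarrow> v \<in> hom C t P' \<longrightarrow> \<alpha>' \<cdot> u = \<alpha>' \<cdot> v \<longrightarrow> \<beta>' \<cdot> u = \<beta>' \<cdot> v \<longrightarrow> u = v"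
    and ex': "\<forall>t x v. x \<in> hom C t X' \<and> v \<in> hom C t V' \<and> rel_mem C K' x (b' \<cdot> v) \<longrightarrow> (\<exists>k. \<forall>v'. v' \<in> hom C t V' \<and>
        b' \<cdot> v' = b' \<cdot> v \<longrightarrow>
        (\<exists>u \<in> hom C t P'. \<alpha>' \<cdot> u = k \<and> \<beta>' \<cdot> u = v' \<and> \<psi> \<cdot> u = G x (b' \<cdot> v) v'))"
    using *[OF K' b' G] by (elim exE conjE)
  have y: "y \<in> hom C t X" "y' \<in> hom C t X'" using comp_in_hom[OF v(2) b] comp_in_hom[OF v'(2) b'] v(4) v'(4)
      by auto
  have yy: "rel_mem C K y y" "rel_mem C K' y' y'" using reflexive_rel_mem[OF K y(1)]
      reflexive_rel_mem[OF K' y(2)] by auto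
  obtain k where k: "\<forall>w. w \<in> hom C t V \<and> b \<cdot> w = y \<longrightarrow> (\<exists>u \<in> hom C t P. \<alpha> \<cdot> u = k \<and> \<beta> \<cdot> u = w \<and> \<phi> \<cdot> u = F x y w)"
    using ex[rule_format, of x t v] v(1,2,4,6) by auto
  obtain k0 where k0: "\<forall>w. w \<in> hom C t V \<and> b \<cdot> w = y \<longrightarrow> (\<exists>u \<in> hom C t P. \<alpha> \<cdot> u = k0 \<and> \<beta> \<cdot> u = w \<and>
      \<phi> \<cdot> u = F y y w)"
    using ex[rule_format, of y t v] v(2,4) y yy by auto
  obtain k' where k': "\<forall>w. w \<in> hom C t V' \<and> b' \<cdot> w = y' \<longrightarrow> (\<exists>u \<in> hom C t P'. \<alpha>' \<cdot> u = k' \<and> \<beta>' \<cdot> u = w \<and>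
      \<psi> \<cdot> u = G x' y' w)"
    using ex'[rule_format, of x' t v'] v'(1,2,4,6) by auto
  obtain k0' where k0': "\<forall>w. w \<in> hom C t V' \<and> b' \<cdot> w = y' \<longrightarrow> (\<exists>u \<in> hom C t P'. \<alpha>' \<cdot> u = k0' \<and> \<beta>' \<cdot> u = w \<and>
      \<psi> \<cdot> u = G y' y' w)"
    using ex'[rule_format, of y' t v'] v'(2,4) y yy by auto
  obtain u where u: "u \<in> hom C t P" "\<alpha> \<cdot> u = k" "\<beta> \<cdot> u = v" "\<phi> \<cdot> u = F x y v"
    using k v(2-5) by blast
  obtain u1 where u1: "u1 \<in> hom C t P" "\<alpha> \<cdot> u1 = k" "\<beta> \<cdot> u1 = v0" "\<phi> \<cdot> u1 = F x y v0"
    using k v(2-5) by blast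
  obtain u2 where u2: "u2 \<in> hom C t P" "\<alpha> \<cdot> u2 = k0" "\<beta> \<cdot> u2 = v0" "\<phi> \<cdot> u2 = F y y v0"
    using k0 v(2-5) by blast
  obtain u3 where u3: "u3 \<in> hom C t P" "\<alpha> \<cdot> u3 = k0" "\<beta> \<cdot> u3 = v" "\<phi> \<cdot> u3 = F y y v"
    using k0 v(2-5) by blast
  obtain u' where u': "u' \<in> hom C t P'" "\<alpha>' \<cdot> u' = k'" "\<beta>' \<cdot> u' = v'" "\<psi> \<cdot> u' = G x' y' v'"
    using k' v'(2-5) by blast
  obtain u1' where u1': "u1' \<in> hom C t P'" "\<alpha>' \<cdot> u1' = k'" "\<beta>' \<cdot> u1' = v0'" "\<psi> \<cdot> u1' = G x' y' v0'"
    using k' v'(2-5) by blast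
  obtain u2' where u2': "u2' \<in> hom C t P'" "\<alpha>' \<cdot> u2' = k0'" "\<beta>' \<cdot> u2' = v0'" "\<psi> \<cdot> u2' = G y' y' v0'"
    using k0' v'(2-5) by blast
  obtain u3' where u3': "u3' \<in> hom C t P'" "\<alpha>' \<cdot> u3' = k0'" "\<beta>' \<cdot> u3' = v'" "\<psi> \<cdot> u3' = G y' y' v'"
    using k0' v'(2-5) by blast
  have "\<phi> \<cdot> u = \<psi> \<cdot> u'"
    by (rule maltsev_square[OF P(1,2) jm[rule_format] P'(1,2) jm'[rule_format] P(3) P'(3)
          u(1) u1(1) u2(1) u3(1) u'(1) u1'(1) u2'(1) u3'(1)])
      (use u u1 u2 u3 u' u1' u2' u3' agree in auto)
  then show ?thesis using u u' by simp
qed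

end

section \<open>Connectors\<close>

text \<open>The arrows \<open>K \<times>\<^sub>X R \<rightarrow> Y\<close>, described on generalized elements.\<close>

definition natural_op3 :: "('o, 'm) cat \<Rightarrow> 'o \<Rightarrow> 'm rl \<Rightarrow> 'm rl \<Rightarrow> 'o \<Rightarrow> ('m \<Rightarrow> 'm \<Rightarrow> 'm \<Rightarrow> 'm) \<Rightarrow> bool" where
  "natural_op3 C X K R Y F \<longleftrightarrow>
    (\<forall>t x y z. x \<in> hom C t X \<and> y \<in> hom C t X \<and> z \<in> hom C t X \<and> rel_mem C K x y \<and> rel_mem C R y z \<longrightarrow>
      F x y z \<in> hom C t Y \<and> (\<forall>t' s. s \<in> hom C t' t \<longrightarrow> F (Comp C x s) (Comp C y s) (Comp C z s) = Comp C (F x y z)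
          s))"

definition connector :: "('o, 'm) cat \<Rightarrow> 'o \<Rightarrow> 'm rl \<Rightarrow> 'm rl \<Rightarrow> ('m \<Rightarrow> 'm \<Rightarrow> 'm \<Rightarrow> 'm) \<Rightarrow> bool" where
  "connector C X K R c \<longleftrightarrow> natural_op3 C X K R X c \<and>
    (\<forall>t x y. x \<in> hom C t X \<and> y \<in> hom C t X \<and> rel_mem C K x y \<longrightarrow> c x y y = x) \<and>
    (\<forall>t y z. y \<in> hom C t X \<and> z \<in> hom C t X \<and> rel_mem C R y z \<longrightarrow> c y y z = z)"

lemma natural_op3_hom:
  "natural_op3 C X K R Y F \<Longrightarrow> x \<in> hom C t X \<Longrightarrow> y \<in> hom C t X \<Longrightarrow> z \<in> hom C t X \<Longrightarrow>
    rel_mem C K x y \<Longrightarrow> rel_mem C R y z \<Longrightarrow> F x y z \<in> hom C t Y"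
  and natural_op3_comp:
  "natural_op3 C X K R Y F \<Longrightarrow> x \<in> hom C t X \<Longrightarrow> y \<in> hom C t X \<Longrightarrow> z \<in> hom C t X \<Longrightarrow>
    rel_mem C K x y \<Longrightarrow> rel_mem C R y z \<Longrightarrow> s \<in> hom C t' t \<Longrightarrow>
    F (Comp C x s) (Comp C y s) (Comp C z s) = Comp C (F x y z) s"
  unfolding natural_op3_def by blast+

lemma connector_natural: "connector C X K R c \<Longrightarrow> natural_op3 C X K R X c"
  and connector_left: "connector C X K R c \<Longrightarrow> x \<in> hom C t X \<Longrightarrow> y \<in> hom C t X \<Longrightarrow> rel_mem C K x y \<Longrightarrow> c x y y = x"
  and connector_right: "connector C X K R c \<Longrightarrow> y \<in> hom C t X \<Longrightarrow> z \<in> hom C t X \<Longrightarrow> rel_mem C R y z \<Longrightarrow> c y y z = z"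
  unfolding connector_def by blast+

context category
begin

text \<open>The value of the operation is obtained by composing the structure arrow \<open>p\<close> with the unique
  element of the pullback that represents the triple \<open>(x, y, z)\<close>.\<close>

lemma centralize_connector:
  assumes K: "reflexive_rel C X K" and R: "reflexive_rel C X R" and cen: "centralize C X K R"
  obtains c where "connector C X K R c"
proof -
  have Kr: "is_rel C X K" and Rr: "is_rel C X R" using K R by (auto intro: reflexive_rel_is_rel)
  note k = is_rel_fst[OF Kr] is_rel_snd[OF Kr] and r = is_rel_fst[OF Rr] is_rel_snd[OF Rr]
  obtain \<pi>1 \<pi>2 p where pb: "is_pullback C (snd K) (fst R) \<pi>1 \<pi>2" and p: "p \<in> hom C (Dom C \<pi>1) X"
    and pw: "\<forall>t \<in> Obj C. \<forall>w \<in> hom C t (Dom C \<pi>1).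
           let x = fst K \<cdot> (\<pi>1 \<cdot> w); y = snd K \<cdot> (\<pi>1 \<cdot> w); z = snd R \<cdot> (\<pi>2 \<cdot> w)
           in (y = z \<longrightarrow> p \<cdot> w = x) \<and> (x = y \<longrightarrow> p \<cdot> w = z)"
    using cen unfolding centralize_def by blast
  let ?P = "Dom C \<pi>1"
  note \<pi> = is_pullback_hom[OF pb k(2) r(1)]
  define is_el where "is_el = (\<lambda>x y z u. u \<in> hom C (Dom C x) ?P \<and> fst K \<cdot> (\<pi>1 \<cdot> u) = x \<and>
      snd K \<cdot> (\<pi>1 \<cdot> u) = y \<and> snd R \<cdot> (\<pi>2 \<cdot> u) = z)"
  define c where "c = (\<lambda>x y z. p \<cdot> (SOME u. is_el x y z u))"
  have uniq: "u = v" if "is_el x y z u" "is_el x y z v" for x y z u v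
  proof -
    have u: "u \<in> hom C (Dom C x) ?P" and v: "v \<in> hom C (Dom C x) ?P" using that by (auto simp: is_el_def)
    have "\<pi>1 \<cdot> u = \<pi>1 \<cdot> v"
      by (rule is_rel_eqD[OF Kr comp_in_hom[OF u \<pi>(1)] comp_in_hom[OF v \<pi>(1)]])
          (use that in \<open>auto simp: is_el_def\<close>)
    moreover have "\<pi>2 \<cdot> u = \<pi>2 \<cdot> v"
    proof (rule is_rel_eqD[OF Rr comp_in_hom[OF u \<pi>(2)] comp_in_hom[OF v \<pi>(2)]])
      show "fst R \<cdot> (\<pi>2 \<cdot> u) = fst R \<cdot> (\<pi>2 \<cdot> v)"
        using square_comp[OF \<pi>(3) u \<pi>(1) k(2) \<pi>(2) r(1)] square_comp[OF \<pi>(3) v \<pi>(1) k(2) \<pi>(2) r(1)] that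
        by (simp add: is_el_def)
    qed (use that in \<open>auto simp: is_el_def\<close>)
    ultimately show "u = v" by (rule is_pullback_eqD[OF pb k(2) r(1) \<pi>(1) u v])
  qed
  have ex: "\<exists>u. is_el x y z u"
    if h: "x \<in> hom C t X" "y \<in> hom C t X" "z \<in> hom C t X" "rel_mem C K x y" "rel_mem C R y z" for t x y z
  proof -
    obtain l where l: "l \<in> hom C t (Dom C (fst K))" "fst K \<cdot> l = x" "snd K \<cdot> l = y" using h(4,1)
        by (rule rel_memE)
    obtain m where m: "m \<in> hom C t (Dom C (fst R))" "fst R \<cdot> m = y" "snd R \<cdot> m = z" using h(5,2)
        by (rule rel_memE)
    have lm: "snd K \<cdot> l = fst R \<cdot> m" using l m by simp
    obtain u where "u \<in> hom C t ?P" "\<pi>1 \<cdot> u = l" "\<pi>2 \<cdot> u = m"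
      by (rule is_pullback_ex[OF pb k(2) r(1) \<pi>(1) l(1) m(1) lm])
    then show ?thesis using l m h(1) by (auto simp: is_el_def hom_iff)
  qed
  have c_eq: "c x y z = p \<cdot> u" if "is_el x y z u" for x y z u
    unfolding c_def using uniq[OF that someI[of "is_el x y z", OF that]] by simp
  have pw': "snd K \<cdot> (\<pi>1 \<cdot> w) = snd R \<cdot> (\<pi>2 \<cdot> w) \<Longrightarrow> p \<cdot> w = fst K \<cdot> (\<pi>1 \<cdot> w)"
      "fst K \<cdot> (\<pi>1 \<cdot> w) = snd K \<cdot> (\<pi>1 \<cdot> w) \<Longrightarrow> p \<cdot> w = snd R \<cdot> (\<pi>2 \<cdot> w)"
    if w: "w \<in> hom C t ?P" for t w
    using bspec[OF bspec[OF pw hom_Obj(1)[OF w]] w] by (auto simp: Let_def)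
  have el: "p \<cdot> u = x" if "is_el x y y u" for x y u
    using that pw' by (auto simp: is_el_def)
  have er: "p \<cdot> u = z" if "is_el x x z u" for x z u
    using that pw' by (auto simp: is_el_def)
  have "connector C X K R c"
    unfolding connector_def natural_op3_def
  proof (intro conjI allI impI; elim conjE)
    fix t x y z
    assume h: "x \<in> hom C t X" "y \<in> hom C t X" "z \<in> hom C t X" "rel_mem C K x y" "rel_mem C R y z"
    obtain u where u: "is_el x y z u" using ex[OF h] by blast
    have ut: "u \<in> hom C t ?P" using u h(1) by (auto simp: is_el_def hom_iff)
    show "c x y z \<in> hom C t X" using comp_in_hom[OF ut p] c_eq[OF u] by simp
    fix t' s assume s: "s \<in> hom C t' t"
    have "is_el (x \<cdot> s) (y \<cdot> s) (z \<cdot> s) (u \<cdot> s)"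
    proof -
      have 1: "\<pi>1 \<cdot> (u \<cdot> s) = (\<pi>1 \<cdot> u) \<cdot> s" "\<pi>2 \<cdot> (u \<cdot> s) = (\<pi>2 \<cdot> u) \<cdot> s"
        by (rule comp_assoc_hom[OF \<pi>(1) ut s], rule comp_assoc_hom[OF \<pi>(2) ut s])
      note pu = comp_in_hom[OF ut \<pi>(1)] comp_in_hom[OF ut \<pi>(2)]
      have e: "fst K \<cdot> (\<pi>1 \<cdot> u) = x" "snd K \<cdot> (\<pi>1 \<cdot> u) = y" "snd R \<cdot> (\<pi>2 \<cdot> u) = z"
        using u by (auto simp: is_el_def)
      have "x \<cdot> s \<in> hom C t' X" using s h(1) by (rule comp_in_hom)
      then have "Dom C (x \<cdot> s) = t'" unfolding hom_iff by blast
      then show ?thesis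
        unfolding is_el_def 1
        using comp_in_hom[OF s ut] comp_eq_comp[OF e(1) s pu(1) k(1)] comp_eq_comp[OF e(2) s pu(1) k(2)]
          comp_eq_comp[OF e(3) s pu(2) r(2)] by simp
    qed
    then show "c (x \<cdot> s) (y \<cdot> s) (z \<cdot> s) = c x y z \<cdot> s"
      using c_eq c_eq[OF u] Comp_assoc[OF s ut p] by simp
  next
    fix t x y assume h: "x \<in> hom C t X" "y \<in> hom C t X" "rel_mem C K x y"
    obtain u where u: "is_el x y y u" using ex[OF h(1,2,2,3) reflexive_rel_mem[OF R h(2)]] by blast
    show "c x y y = x" using c_eq[OF u] el[OF u] by simp
  next
    fix t y z assume h: "y \<in> hom C t X" "z \<in> hom C t X" "rel_mem C R y z"
    obtain u where u: "is_el y y z u" using ex[OF h(1,1,2) reflexive_rel_mem[OF K h(1)] h(3)] by blast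
    show "c y y z = z" using c_eq[OF u] er[OF u] by simp
  qed
  then show ?thesis by (rule that)
qed

end

context regular_cat
begin

text \<open>To define a connector it suffices to give values locally, by a relation \<open>\<Phi>\<close> between triples
  and values that is single-valued and natural. Such local values of the generic triple agree
  wherever they overlap and therefore descend to an arrow on the pullback.\<close>

lemma centralizeI:
  assumes K: "is_rel C X K" and R: "is_rel C X R"
    and ex: "\<And>t x y z. x \<in> hom C t X \<Longrightarrow> y \<in> hom C t X \<Longrightarrow> z \<in> hom C t X \<Longrightarrow> rel_mem C K x y \<Longrightarrow> rel_mem C R y z \<Longrightarrow>
      \<exists>t' c v. cover c t' t \<and> v \<in> hom C t' X \<and> \<Phi> (x \<cdot> c) (y \<cdot> c) (z \<cdot> c) v"
    and nat: "\<And>t t' s x y z v. x \<in> hom C t X \<Longrightarrow> y \<in> hom C t X \<Longrightarrow> z \<in> hom C t X \<Longrightarrow> v \<in> hom C t X \<Longrightarrow>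
      s \<in> hom C t' t \<Longrightarrow> \<Phi> x y z v \<Longrightarrow> \<Phi> (x \<cdot> s) (y \<cdot> s) (z \<cdot> s) (v \<cdot> s)"
    and uniq: "\<And>t x y z v v'. x \<in> hom C t X \<Longrightarrow> y \<in> hom C t X \<Longrightarrow> z \<in> hom C t X \<Longrightarrow> v \<in> hom C t X \<Longrightarrow>
      v' \<in> hom C t X \<Longrightarrow> \<Phi> x y z v \<Longrightarrow> \<Phi> x y z v' \<Longrightarrow> v = v'"
    and left: "\<And>t x y v. x \<in> hom C t X \<Longrightarrow> y \<in> hom C t X \<Longrightarrow> v \<in> hom C t X \<Longrightarrow> \<Phi> x y y v \<Longrightarrow> v = x"
    and right: "\<And>t y z v. y \<in> hom C t X \<Longrightarrow> z \<in> hom C t X \<Longrightarrow> v \<in> hom C t X \<Longrightarrow> \<Phi> y y z v \<Longrightarrow> v = z"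
  shows "centralize C X K R"
proof -
  note k = is_rel_fst[OF K] is_rel_snd[OF K] and r = is_rel_fst[OF R] is_rel_snd[OF R]
  obtain P \<pi>1 \<pi>2 where pb: "is_pullback C (snd K) (fst R) \<pi>1 \<pi>2"
    and \<pi>: "\<pi>1 \<in> hom C P (Dom C (fst K))" "\<pi>2 \<in> hom C P (Dom C (fst R))" "snd K \<cdot> \<pi>1 = fst R \<cdot> \<pi>2"
    by (rule pullbackE[OF k(2) r(1)])
  let ?x = "fst K \<cdot> \<pi>1" and ?y = "snd K \<cdot> \<pi>1" and ?z = "snd R \<cdot> \<pi>2"
  have xyz: "?x \<in> hom C P X" "?y \<in> hom C P X" "?z \<in> hom C P X"
    using comp_in_hom[OF \<pi>(1) k(1)] comp_in_hom[OF \<pi>(1) k(2)] comp_in_hom[OF \<pi>(2) r(2)] by auto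
  have "rel_mem C K ?x ?y" by (rule rel_memI[OF \<pi>(1) xyz(1)]) auto
  moreover have "rel_mem C R ?y ?z" by (rule rel_memI[OF \<pi>(2) xyz(2)]) (simp_all add: \<pi>(3))
  ultimately obtain T d v where d: "cover d T P" and v: "v \<in> hom C T X" and \<Phi>: "\<Phi> (?x \<cdot> d) (?y \<cdot> d) (?z \<cdot> d) v"
    using ex[OF xyz] by blast
  have dh: "d \<in> hom C T P" using d by simp
  note xd = comp_in_hom[OF dh xyz(1)] comp_in_hom[OF dh xyz(2)] comp_in_hom[OF dh xyz(3)]
  have \<Phi>': "\<Phi> (?x \<cdot> (d \<cdot> a)) (?y \<cdot> (d \<cdot> a)) (?z \<cdot> (d \<cdot> a)) (v \<cdot> a)" if a: "a \<in> hom C t T" for t a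
    using nat[OF xd v a \<Phi>] Comp_assoc[OF a dh xyz(1)] Comp_assoc[OF a dh xyz(2)] Comp_assoc[OF a dh xyz(3)]
        by simp
  obtain p where p: "p \<in> hom C P X" "p \<cdot> d = v"
  proof (rule cover_factor[OF d v])
    fix t a b assume a: "a \<in> hom C t T" and b: "b \<in> hom C t T" and eq: "d \<cdot> a = d \<cdot> b"
    note da = comp_in_hom[OF a dh]
    show "v \<cdot> a = v \<cdot> b"
      by (rule uniq[OF comp_in_hom[OF da xyz(1)] comp_in_hom[OF da xyz(2)] comp_in_hom[OF da xyz(3)]
            comp_in_hom[OF a v] comp_in_hom[OF b v] \<Phi>'[OF a]]) (simp add: eq \<Phi>'[OF b])
  qed
  have P: "Dom C \<pi>1 = P" using \<pi>(1) by (simp add: hom_iff)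
  have main: "(?y \<cdot> w = ?z \<cdot> w \<longrightarrow> p \<cdot> w = ?x \<cdot> w) \<and> (?x \<cdot> w = ?y \<cdot> w \<longrightarrow> p \<cdot> w = ?z \<cdot> w)"
    if w: "w \<in> hom C t P" for t w
  proof -
    obtain t' e a where e: "cover e t' t" and a: "a \<in> hom C t' T" "d \<cdot> a = w \<cdot> e" by (rule cover_lift[OF d w])
    have eh: "e \<in> hom C t' t" using e by simp
    have we: "w \<cdot> e \<in> hom C t' P" using eh w by (rule comp_in_hom)
    note xw = comp_in_hom[OF w xyz(1)] comp_in_hom[OF w xyz(2)] comp_in_hom[OF w xyz(3)]
    have as: "?x \<cdot> (w \<cdot> e) = (?x \<cdot> w) \<cdot> e" "?y \<cdot> (w \<cdot> e) = (?y \<cdot> w) \<cdot> e" "?z \<cdot> (w \<cdot> e) = (?z \<cdot> w) \<cdot> e"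
      by (rule comp_assoc_hom[OF xyz(1) w eh], rule comp_assoc_hom[OF xyz(2) w eh], rule comp_assoc_hom[OF
          xyz(3) w eh])
    have pw: "(p \<cdot> w) \<cdot> e = v \<cdot> a"
      using comp_assoc_hom[OF p(1) w eh] comp_eq_comp[OF p(2) a(1) dh p(1)] a(2) by simp
    have \<Phi>w: "\<Phi> ((?x \<cdot> w) \<cdot> e) ((?y \<cdot> w) \<cdot> e) ((?z \<cdot> w) \<cdot> e) (v \<cdot> a)" using \<Phi>'[OF a(1)] unfolding a(2) as .
    have va: "v \<cdot> a \<in> hom C t' X" using a(1) v by (rule comp_in_hom)
    note xwe = comp_in_hom[OF eh xw(1)] comp_in_hom[OF eh xw(2)] comp_in_hom[OF eh xw(3)]
    have "(p \<cdot> w) \<cdot> e = (?x \<cdot> w) \<cdot> e" if "?y \<cdot> w = ?z \<cdot> w"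
      unfolding pw by (rule left[OF xwe(1,2) va]) (use \<Phi>w that in simp)
    moreover have "(p \<cdot> w) \<cdot> e = (?z \<cdot> w) \<cdot> e" if "?x \<cdot> w = ?y \<cdot> w"
      unfolding pw by (rule right[OF xwe(2,3) va]) (use \<Phi>w that in simp)
    ultimately show ?thesis using cover_epi[OF e comp_in_hom[OF w p(1)] xw(1)]
        cover_epi[OF e comp_in_hom[OF w p(1)] xw(3)]
      by blast
  qed
  show ?thesis
    unfolding centralize_def
  proof (intro exI conjI ballI)
    show "is_pullback C (snd K) (fst R) \<pi>1 \<pi>2" by (rule pb)
    show "p \<in> hom C (Dom C \<pi>1) X" using p P by simp
    fix t w assume "w \<in> hom C t (Dom C \<pi>1)"
    then have w: "w \<in> hom C t P" using P by simp
    show "let x = fst K \<cdot> (\<pi>1 \<cdot> w); y = snd K \<cdot> (\<pi>1 \<cdot> w); z = snd R \<cdot> (\<pi>2 \<cdot> w)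
           in (y = z \<longrightarrow> p \<cdot> w = x) \<and> (x = y \<longrightarrow> p \<cdot> w = z)"
      using main[OF w] Comp_assoc[OF w \<pi>(1) k(1)] Comp_assoc[OF w \<pi>(1) k(2)] Comp_assoc[OF w \<pi>(2) r(2)]
      by (simp add: Let_def)
  qed
qed

end

locale regular_maltsev_cat = regular_cat C + maltsev_cat C for C :: "('o, 'm) cat" (structure)
begin

lemma natural_op3_post:
  assumes F: "natural_op3 C X K R Y F" and k: "k \<in> hom C Y Z"
  shows "natural_op3 C X K R Z (\<lambda>x y z. k \<cdot> F x y z)"
  unfolding natural_op3_def
proof (intro conjI allI impI; elim conjE)
  fix t x y z
  assume h: "x \<in> hom C t X" "y \<in> hom C t X" "z \<in> hom C t X" "rel_mem C K x y" "rel_mem C R y z"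
  show "k \<cdot> F x y z \<in> hom C t Z" using natural_op3_hom[OF F h] k by (rule comp_in_hom)
  fix t' s assume s: "s \<in> hom C t' t"
  show "k \<cdot> F (x \<cdot> s) (y \<cdot> s) (z \<cdot> s) = (k \<cdot> F x y z) \<cdot> s"
    using natural_op3_comp[OF F h s] comp_assoc_hom[OF k natural_op3_hom[OF F h] s] by simp
qed

text \<open>The corner \<open>v0\<close> of \<open>natural_op_agree\<close> is here the pair \<open>(y, y)\<close>. Consequently a natural
  operation on triples is determined by its restrictions to the triples \<open>(x, y, y)\<close> and \<open>(y, y,
  z)\<close>.\<close>

lemma natural_op3_agree:
  assumes K: "reflexive_rel C X K" and R: "reflexive_rel C X R" and F: "natural_op3 C X K R Y F"
    and K': "reflexive_rel C X' K'" and R': "reflexive_rel C X' R'" and G: "natural_op3 C X' K' R' Y G"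
    and x: "x \<in> hom C t X" "y \<in> hom C t X" "z \<in> hom C t X" "rel_mem C K x y" "rel_mem C R y z"
    and x': "x' \<in> hom C t X'" "y' \<in> hom C t X'" "z' \<in> hom C t X'" "rel_mem C K' x' y'" "rel_mem C R' y' z'"
    and agree: "F x y y = G x' y' y'" "F y y y = G y' y' y'" "F y y z = G y' y' z'"
  shows "F x y z = G x' y' z'"
proof -
  have *: "natural_op C X K (Dom C (fst R)) (fst R) Y (\<lambda>x y v. F x y (snd R \<cdot> v))"
    if R: "reflexive_rel C X R" and F: "natural_op3 C X K R Y F" for X K R F
  proof -
    have Rr: "is_rel C X R" using R by (rule reflexive_rel_is_rel)
    note r = is_rel_fst[OF Rr] is_rel_snd[OF Rr]
    show ?thesis unfolding natural_op_def
    proof (intro conjI allI impI; elim conjE)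
      fix t x y v assume h: "x \<in> hom C t X" "y \<in> hom C t X" "v \<in> hom C t (Dom C (fst R))" "rel_mem C K x y"
          "fst R \<cdot> v = y"
      have z: "snd R \<cdot> v \<in> hom C t X" using h(3) r(2) by (rule comp_in_hom)
      have m: "rel_mem C R y (snd R \<cdot> v)" by (rule rel_memI[OF h(3,2,5)]) simp
      show "F x y (snd R \<cdot> v) \<in> hom C t Y" by (rule natural_op3_hom[OF F h(1,2) z h(4) m])
      fix t' s assume s: "s \<in> hom C t' t"
      show "F (x \<cdot> s) (y \<cdot> s) (snd R \<cdot> (v \<cdot> s)) = F x y (snd R \<cdot> v) \<cdot> s"
        using natural_op3_comp[OF F h(1,2) z h(4) m s] Comp_assoc[OF s h(3) r(2)] by simp
    qed
  qed
  obtain v where v: "v \<in> hom C t (Dom C (fst R))" "fst R \<cdot> v = y" "snd R \<cdot> v = z" using x(5,2)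
      by (rule rel_memE)
  obtain v0 where v0: "v0 \<in> hom C t (Dom C (fst R))" "fst R \<cdot> v0 = y" "snd R \<cdot> v0 = y"
    using reflexive_rel_mem[OF R x(2)] x(2) by (rule rel_memE)
  obtain v' where v': "v' \<in> hom C t (Dom C (fst R'))" "fst R' \<cdot> v' = y'" "snd R' \<cdot> v' = z'" using x'(5,2)
      by (rule rel_memE)
  obtain v0' where v0': "v0' \<in> hom C t (Dom C (fst R'))" "fst R' \<cdot> v0' = y'" "snd R' \<cdot> v0' = y'"
    using reflexive_rel_mem[OF R' x'(2)] x'(2) by (rule rel_memE)
  have "F x y (snd R \<cdot> v) = G x' y' (snd R' \<cdot> v')"
    by (rule natural_op_agree[OF K is_rel_fst[OF reflexive_rel_is_rel[OF R]] *[OF R F]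
          K' is_rel_fst[OF reflexive_rel_is_rel[OF R']] *[OF R' G]
          x(1) v(1) v0(1) v(2) v0(2) x(4) x'(1) v'(1) v0'(1) v'(2) v0'(2) x'(4)])
      (use agree v v0 v' v0' in auto)
  then show ?thesis using v v' by simp
qed

lemma centralize_sym:
  assumes K: "equiv_rel C X K" and R: "equiv_rel C X R" and "centralize C X K R"
  shows "centralize C X R K"
proof -
  obtain c where c: "connector C X K R c"
    using assms by (meson centralize_connector equiv_rel_reflexive)
  note n = connector_natural[OF c]
  have sym: "rel_mem C K z y" "rel_mem C R y x"
    if "x \<in> hom C t X" "y \<in> hom C t X" "rel_mem C R x y" "rel_mem C K y z" for t x y z
    using that equiv_rel_sym[OF K] equiv_rel_sym[OF R] by auto
  show ?thesis
  proof (rule centralizeI[where \<Phi> = "\<lambda>x y z v. rel_mem C R x y \<and> rel_mem C K y z \<and> v = c z y x"])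
    fix t x y z assume h: "x \<in> hom C t X" "y \<in> hom C t X" "z \<in> hom C t X" "rel_mem C R x y" "rel_mem C K y z"
    have "c z y x \<in> hom C t X" by (rule natural_op3_hom[OF n h(3,2,1) sym[OF h(1,2,4,5)]])
    then show "\<exists>t' d v. cover d t' t \<and> v \<in> hom C t' X \<and> rel_mem C R (x \<cdot> d) (y \<cdot> d) \<and>
        rel_mem C K (y \<cdot> d) (z \<cdot> d) \<and> v = c (z \<cdot> d) (y \<cdot> d) (x \<cdot> d)"
      using h cover_Ide[OF hom_Obj(1)[OF h(1)]]
      by (intro exI[of _ t] exI[of _ "Ide C t"] exI[of _ "c z y x"]) (simp add: Comp_Ide)
  next
    fix t t' s x y z v assume h: "x \<in> hom C t X" "y \<in> hom C t X" "z \<in> hom C t X" and s: "s \<in> hom C t' t"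
      and m: "rel_mem C R x y \<and> rel_mem C K y z \<and> v = c z y x"
    have m': "rel_mem C R x y" "rel_mem C K y z" using m by auto
    show "rel_mem C R (x \<cdot> s) (y \<cdot> s) \<and> rel_mem C K (y \<cdot> s) (z \<cdot> s) \<and> v \<cdot> s = c (z \<cdot> s) (y \<cdot> s) (x \<cdot> s)"
      using m rel_mem_comp[OF equiv_rel_is_rel[OF R] m'(1) h(1) s] rel_mem_comp[OF equiv_rel_is_rel[OF K]
          m'(2) h(2) s]
        natural_op3_comp[OF n h(3,2,1) sym[OF h(1,2) m'] s] by simp
  next
    show "is_rel C X R" "is_rel C X K" using K R by (auto intro: equiv_rel_is_rel)
    show "v = x" if "x \<in> hom C t X" "y \<in> hom C t X" "rel_mem C R x y \<and> rel_mem C K y y \<and> v = c y y x"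
        for t x y v
      using connector_right[OF c that(2,1)] equiv_rel_sym[OF R _ that(1)] that(3) by simp
    show "v = z" if "y \<in> hom C t X" "z \<in> hom C t X" "rel_mem C R y y \<and> rel_mem C K y z \<and> v = c z y y"
        for t y z v
      using connector_left[OF c that(2,1)] equiv_rel_sym[OF K _ that(1)] that(3) by simp
  qed simp
qed

text \<open>An object \<open>X'\<close> that is a pullback of \<open>X\<close> and \<open>Z\<close> inherits a connector: take the connector of
  \<open>X\<close> in the first coordinate and the coordinate of \<open>x\<close> in \<open>Z\<close>, which is legitimate since \<open>y\<close> and
  \<open>z\<close> have the same coordinate in \<open>Z\<close>. That this lands in the pullback, i.e. that \<open>v\<close> maps \<open>c x y
  z\<close> and \<open>x\<close> to the same element, is an instance of \<open>natural_op3_agree\<close>.\<close>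

lemma centralize_pullback:
  assumes K: "reflexive_rel C X K" and R: "reflexive_rel C X R" and cen: "centralize C X K R"
    and v: "v \<in> hom C X E" and e: "e \<in> hom C Z E" and \<eta>: "\<eta> \<in> hom C X' X" and g: "g \<in> hom C X' Z"
    and pb: "is_pullback C v e \<eta> g"
    and K': "reflexive_rel C X' K'" and R': "reflexive_rel C X' R'"
    and \<eta>K: "\<And>t a b. a \<in> hom C t X' \<Longrightarrow> b \<in> hom C t X' \<Longrightarrow> rel_mem C K' a b \<Longrightarrow> rel_mem C K (\<eta> \<cdot> a) (\<eta> \<cdot> b)"
    and \<eta>R: "\<And>t a b. a \<in> hom C t X' \<Longrightarrow> b \<in> hom C t X' \<Longrightarrow> rel_mem C R' a b \<Longrightarrow> rel_mem C R (\<eta> \<cdot> a) (\<eta> \<cdot> b)"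
    and gR: "\<And>t a b. a \<in> hom C t X' \<Longrightarrow> b \<in> hom C t X' \<Longrightarrow> rel_mem C R' a b \<Longrightarrow> g \<cdot> a = g \<cdot> b"
  shows "centralize C X' K' R'"
proof -
  obtain c where c: "connector C X K R c" using K R cen by (rule centralize_connector)
  note n = connector_natural[OF c]
  have sq: "v \<cdot> \<eta> = e \<cdot> g" using is_pullback_hom(3)[OF pb v e] .
  have ve: "v \<cdot> (\<eta> \<cdot> a) = e \<cdot> (g \<cdot> a)" if "a \<in> hom C t X'" for t a by (rule square_comp[OF sq that \<eta> v g e])
  have \<eta>h: "\<eta> \<cdot> a \<in> hom C t X" if "a \<in> hom C t X'" for t a using that \<eta> by (rule comp_in_hom)
  have K'r: "is_rel C X' K'" and R'r: "is_rel C X' R'" using K' R' by (auto intro: reflexive_rel_is_rel)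
  define F where "F = (\<lambda>x y z. c (\<eta> \<cdot> x) (\<eta> \<cdot> y) (\<eta> \<cdot> z))"
  have Fh: "F x y z \<in> hom C t X"
    if "x \<in> hom C t X'" "y \<in> hom C t X'" "z \<in> hom C t X'" "rel_mem C K' x y" "rel_mem C R' y z" for t x y z
    unfolding F_def using that \<eta>h \<eta>K \<eta>R by (intro natural_op3_hom[OF n]) auto
  have Fc: "F (x \<cdot> s) (y \<cdot> s) (z \<cdot> s) = F x y z \<cdot> s"
    if "x \<in> hom C t X'" "y \<in> hom C t X'" "z \<in> hom C t X'" "rel_mem C K' x y" "rel_mem C R' y z" "s \<in> hom C t' t"
        for t t' s x y z
    unfolding F_def using that natural_op3_comp[OF n \<eta>h[OF that(1)] \<eta>h[OF that(2)] \<eta>h[OF that(3)] \<eta>K \<eta>R that(6)]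
      comp_assoc_hom[OF \<eta> that(1,6)] comp_assoc_hom[OF \<eta> that(2,6)] comp_assoc_hom[OF \<eta> that(3,6)] by simp
  have Fl: "F x y y = \<eta> \<cdot> x" if "x \<in> hom C t X'" "y \<in> hom C t X'" "rel_mem C K' x y" for t x y
    unfolding F_def using that by (intro connector_left[OF c \<eta>h \<eta>h \<eta>K])
  have Fr: "F y y z = \<eta> \<cdot> z" if "y \<in> hom C t X'" "z \<in> hom C t X'" "rel_mem C R' y z" for t y z
    unfolding F_def using that by (intro connector_right[OF c \<eta>h \<eta>h \<eta>R])
  have nF: "natural_op3 C X' K' R' E (\<lambda>x y z. v \<cdot> F x y z)"
    by (rule natural_op3_post[OF _ v]) (use Fh Fc in \<open>auto simp: natural_op3_def\<close>)
  have nG: "natural_op3 C X' K' R' E (\<lambda>x y z. v \<cdot> (\<eta> \<cdot> x))"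
    unfolding natural_op3_def using v \<eta> by (auto simp: hom_iff)
  \<comment> \<open>applying \<open>v\<close> to the connector gives the first coordinate, as the last two agree in \<open>Z\<close>\<close>
  have vF: "v \<cdot> F x y z = e \<cdot> (g \<cdot> x)"
    if h: "x \<in> hom C t X'" "y \<in> hom C t X'" "z \<in> hom C t X'" "rel_mem C K' x y" "rel_mem C R' y z" for t x y z
  proof -
    have "v \<cdot> F x y z = v \<cdot> (\<eta> \<cdot> x)"
    proof (rule natural_op3_agree[OF K' R' nF K' R' nG h h])
      show "v \<cdot> F x y y = v \<cdot> (\<eta> \<cdot> x)" using Fl[OF h(1,2,4)] by simp
      show "v \<cdot> F y y y = v \<cdot> (\<eta> \<cdot> y)" using Fl[OF h(2,2) reflexive_rel_mem[OF K' h(2)]] by simp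
      show "v \<cdot> F y y z = v \<cdot> (\<eta> \<cdot> y)" using Fr[OF h(2,3,5)] ve[OF h(2)] ve[OF h(3)] gR[OF h(2,3,5)] by simp
    qed
    then show ?thesis using ve[OF h(1)] by simp
  qed
  show ?thesis
  proof (rule centralizeI[OF K'r R'r, where \<Phi> = "\<lambda>x y z q. rel_mem C K' x y \<and> rel_mem C R' y z \<and>
      \<eta> \<cdot> q = F x y z \<and> g \<cdot> q = g \<cdot> x"])
    fix t x y z assume h: "x \<in> hom C t X'" "y \<in> hom C t X'" "z \<in> hom C t X'" "rel_mem C K' x y"
        "rel_mem C R' y z"
    have gx: "g \<cdot> x \<in> hom C t Z" using h(1) g by (rule comp_in_hom)
    obtain q where "q \<in> hom C t X'" "\<eta> \<cdot> q = F x y z" "g \<cdot> q = g \<cdot> x"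
      by (rule is_pullback_ex[OF pb v e \<eta> Fh[OF h] gx vF[OF h]])
    then show "\<exists>t' d q. cover d t' t \<and> q \<in> hom C t' X' \<and> rel_mem C K' (x \<cdot> d) (y \<cdot> d) \<and>
        rel_mem C R' (y \<cdot> d) (z \<cdot> d) \<and>
        \<eta> \<cdot> q = F (x \<cdot> d) (y \<cdot> d) (z \<cdot> d) \<and> g \<cdot> q = g \<cdot> (x \<cdot> d)"
      using h cover_Ide[OF hom_Obj(1)[OF h(1)]]
      by (intro exI[of _ t] exI[of _ "Ide C t"] exI[of _ q]) (simp add: Comp_Ide)
  next
    fix t t' s x y z q assume h: "x \<in> hom C t X'" "y \<in> hom C t X'" "z \<in> hom C t X'" "q \<in> hom C t X'"
        and s: "s \<in> hom C t' t"
      and m: "rel_mem C K' x y \<and> rel_mem C R' y z \<and> \<eta> \<cdot> q = F x y z \<and> g \<cdot> q = g \<cdot> x"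
    show "rel_mem C K' (x \<cdot> s) (y \<cdot> s) \<and> rel_mem C R' (y \<cdot> s) (z \<cdot> s) \<and>
        \<eta> \<cdot> (q \<cdot> s) = F (x \<cdot> s) (y \<cdot> s) (z \<cdot> s) \<and> g \<cdot> (q \<cdot> s) = g \<cdot> (x \<cdot> s)"
      using m h s rel_mem_comp[OF K'r _ h(1) s] rel_mem_comp[OF R'r _ h(2) s] Fc[OF h(1-3) _ _ s]
        comp_assoc_hom[OF \<eta> h(4) s] comp_assoc_hom[OF g h(4) s] comp_assoc_hom[OF g h(1) s] by simp
  next
    fix t x y z q q' assume "q \<in> hom C t X'" "q' \<in> hom C t X'"
      "rel_mem C K' x y \<and> rel_mem C R' y z \<and> \<eta> \<cdot> q = F x y z \<and> g \<cdot> q = g \<cdot> x"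
      "rel_mem C K' x y \<and> rel_mem C R' y z \<and> \<eta> \<cdot> q' = F x y z \<and> g \<cdot> q' = g \<cdot> x"
    then show "q = q'" using is_pullback_eqD[OF pb v e \<eta>] by simp
  next
    fix t x y q assume h: "x \<in> hom C t X'" "y \<in> hom C t X'" "q \<in> hom C t X'"
      "rel_mem C K' x y \<and> rel_mem C R' y y \<and> \<eta> \<cdot> q = F x y y \<and> g \<cdot> q = g \<cdot> x"
    then show "q = x" using is_pullback_eqD[OF pb v e \<eta> h(3,1)] Fl[OF h(1,2)] by simp
  next
    fix t y z q assume h: "y \<in> hom C t X'" "z \<in> hom C t X'" "q \<in> hom C t X'"
      "rel_mem C K' y y \<and> rel_mem C R' y z \<and> \<eta> \<cdot> q = F y y z \<and> g \<cdot> q = g \<cdot> y"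
    then show "q = z" using is_pullback_eqD[OF pb v e \<eta> h(3,2)] Fr[OF h(1,2)] gR[OF h(1,2)] by simp
  qed
qed

text \<open>This supplies a lifting hypothesis of \<open>centralize_descent\<close> for relations that contain a
  whole inverse image.\<close>

lemma inverse_image_lift:
  assumes q: "cover q X' X" and W: "is_rel C X W"
    and inv: "\<And>t a b. a \<in> hom C t X' \<Longrightarrow> b \<in> hom C t X' \<Longrightarrow> rel_mem C W (q \<cdot> a) (q \<cdot> b) \<Longrightarrow> rel_mem C W' a b"
    and y: "y \<in> hom C t X'" and z: "z \<in> hom C t X" and m: "rel_mem C W (q \<cdot> y) z"
  shows "\<exists>t' c z'. cover c t' t \<and> z' \<in> hom C t' X' \<and> q \<cdot> z' = z \<cdot> c \<and> rel_mem C W' (y \<cdot> c) z'"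
proof -
  have qh: "q \<in> hom C X' X" using q by simp
  obtain t' d z' where d: "cover d t' t" "z' \<in> hom C t' X'" "q \<cdot> z' = z \<cdot> d" by (rule cover_lift[OF q z])
  have dh: "d \<in> hom C t' t" using d by simp
  have "rel_mem C W ((q \<cdot> y) \<cdot> d) (z \<cdot> d)" by (rule rel_mem_comp[OF W m comp_in_hom[OF y qh] dh])
  then have "rel_mem C W (q \<cdot> (y \<cdot> d)) (q \<cdot> z')" using Comp_assoc[OF dh y qh] d(3) by simp
  then have "rel_mem C W' (y \<cdot> d) z'" by (rule inv[OF comp_in_hom[OF dh y] d(2)])
  then show ?thesis using d by blast
qed

text \<open>The value at \<open>(x, y, z)\<close> is the image of the value at any triple of \<open>X'\<close> above it, which
  exists locally. Independence of the chosen triple is \<open>natural_op3_agree\<close>, applied to two triples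
  with the same image. The lifting hypotheses ask that related elements lift once one of the two
  has been lifted, and not that \<open>K'\<close> and \<open>R'\<close> be inverse images: the kernel pairs to which this is
  applied are smaller than inverse images.\<close>

lemma centralize_descent:
  assumes q: "cover q X' X"
    and K': "reflexive_rel C X' K'" and R': "reflexive_rel C X' R'" and cen: "centralize C X' K' R'"
    and K: "is_rel C X K" and R: "is_rel C X R"
    and liftK: "\<And>t y x. y \<in> hom C t X' \<Longrightarrow> x \<in> hom C t X \<Longrightarrow> rel_mem C K x (q \<cdot> y) \<Longrightarrow>
      \<exists>t' c x'. cover c t' t \<and> x' \<in> hom C t' X' \<and> q \<cdot> x' = x \<cdot> c \<and> rel_mem C K' x' (y \<cdot> c)"
    and liftR: "\<And>t y z. y \<in> hom C t X' \<Longrightarrow> z \<in> hom C t X \<Longrightarrow> rel_mem C R (q \<cdot> y) z \<Longrightarrow>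
      \<exists>t' c z'. cover c t' t \<and> z' \<in> hom C t' X' \<and> q \<cdot> z' = z \<cdot> c \<and> rel_mem C R' (y \<cdot> c) z'"
  shows "centralize C X K R"
proof -
  obtain c where c: "connector C X' K' R' c" using K' R' cen by (rule centralize_connector)
  note n = connector_natural[OF c]
  have qh: "q \<in> hom C X' X" using q by simp
  have K'r: "is_rel C X' K'" and R'r: "is_rel C X' R'" using K' R' by (auto intro: reflexive_rel_is_rel)
  note nF = natural_op3_post[OF n qh]
  have U: "q \<cdot> c x y z = q \<cdot> c x' y' z'"
    if h: "x \<in> hom C t X'" "y \<in> hom C t X'" "z \<in> hom C t X'" "rel_mem C K' x y" "rel_mem C R' y z"
    and h': "x' \<in> hom C t X'" "y' \<in> hom C t X'" "z' \<in> hom C t X'" "rel_mem C K' x' y'" "rel_mem C R' y' z'"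
    and e: "q \<cdot> x = q \<cdot> x'" "q \<cdot> y = q \<cdot> y'" "q \<cdot> z = q \<cdot> z'" for t x y z x' y' z'
    by (rule natural_op3_agree[OF K' R' nF K' R' nF h h'])
      (use e connector_left[OF c h(1,2,4)] connector_left[OF c h'(1,2,4)]
        connector_left[OF c h(2,2) reflexive_rel_mem[OF K' h(2)]]
            connector_left[OF c h'(2,2) reflexive_rel_mem[OF K' h'(2)]]
        connector_right[OF c h(2,3,5)] connector_right[OF c h'(2,3,5)] in auto)
  let ?\<Phi> = "\<lambda>x y z v. \<exists>t x' y' z'. x' \<in> hom C t X' \<and> y' \<in> hom C t X' \<and> z' \<in> hom C t X' \<and> rel_mem C K' x' y' \<and>
    rel_mem C R' y' z' \<and> q \<cdot> x' = x \<and> q \<cdot> y' = y \<and> q \<cdot> z' = z \<and> v = q \<cdot> c x' y' z'"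
  show ?thesis
  proof (rule centralizeI[OF K R, where \<Phi> = ?\<Phi>])
    fix t x y z assume h: "x \<in> hom C t X" "y \<in> hom C t X" "z \<in> hom C t X" "rel_mem C K x y" "rel_mem C R y z"
    obtain t1 d1 y1 where 1: "cover d1 t1 t" "y1 \<in> hom C t1 X'" "q \<cdot> y1 = y \<cdot> d1"
        by (rule cover_lift[OF q h(2)])
    have d1: "d1 \<in> hom C t1 t" using 1 by simp
    have "rel_mem C K (x \<cdot> d1) (q \<cdot> y1)" using rel_mem_comp[OF K h(4,1) d1] 1 by simp
    then obtain t2 d2 x2 where 2: "cover d2 t2 t1" "x2 \<in> hom C t2 X'" "q \<cdot> x2 = (x \<cdot> d1) \<cdot> d2"
        "rel_mem C K' x2 (y1 \<cdot> d2)"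
      using liftK[OF 1(2) comp_in_hom[OF d1 h(1)]] by blast
    have d2: "d2 \<in> hom C t2 t1" using 2 by simp
    have d12: "d1 \<cdot> d2 \<in> hom C t2 t" using d2 d1 by (rule comp_in_hom)
    have y2: "y1 \<cdot> d2 \<in> hom C t2 X'" using d2 1(2) by (rule comp_in_hom)
    have qy2: "q \<cdot> (y1 \<cdot> d2) = y \<cdot> (d1 \<cdot> d2)"
      using comp_eq_comp[OF 1(3) d2 1(2) qh] Comp_assoc[OF d2 d1 h(2)] by simp
    have "rel_mem C R (q \<cdot> (y1 \<cdot> d2)) (z \<cdot> (d1 \<cdot> d2))" using rel_mem_comp[OF R h(5,2) d12] qy2 by simp
    then obtain t3 d3 z3 where 3: "cover d3 t3 t2" "z3 \<in> hom C t3 X'" "q \<cdot> z3 = (z \<cdot> (d1 \<cdot> d2)) \<cdot> d3"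
        "rel_mem C R' ((y1 \<cdot> d2) \<cdot> d3) z3"
      using liftR[OF y2 comp_in_hom[OF d12 h(3)]] by blast
    have d3: "d3 \<in> hom C t3 t2" using 3 by simp
    let ?d = "d1 \<cdot> (d2 \<cdot> d3)" and ?x = "x2 \<cdot> d3" and ?y = "(y1 \<cdot> d2) \<cdot> d3"
    have d: "cover ?d t3 t" using cover_comp[OF 1(1) cover_comp[OF 2(1) 3(1)]] .
    have x3: "?x \<in> hom C t3 X'" and y3: "?y \<in> hom C t3 X'" using comp_in_hom[OF d3 2(2)] comp_in_hom[OF d3 y2]
        by auto
    have m: "rel_mem C K' ?x ?y" using rel_mem_comp[OF K'r 2(4,2) d3] .
    have ass: "(w \<cdot> (d1 \<cdot> d2)) \<cdot> d3 = w \<cdot> ?d" if "w \<in> hom C t X" for w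
      using that d1 d2 d3 by (simp add: hom_iff)
    have qx: "q \<cdot> ?x = x \<cdot> ?d"
      using comp_eq_comp[OF 2(3) d3 2(2) qh] h(1) d1 d2 d3 by (simp add: hom_iff)
    have qy: "q \<cdot> ?y = y \<cdot> ?d" using comp_eq_comp[OF qy2 d3 y2 qh] ass[OF h(2)] by simp
    have qz: "q \<cdot> z3 = z \<cdot> ?d" using 3(3) ass[OF h(3)] by simp
    have "q \<cdot> c ?x ?y z3 \<in> hom C t3 X" using natural_op3_hom[OF nF x3 y3 3(2) m 3(4)] .
    then show "\<exists>t' d v. cover d t' t \<and> v \<in> hom C t' X \<and> ?\<Phi> (x \<cdot> d) (y \<cdot> d) (z \<cdot> d) v"
      using d x3 y3 3(2,4) m qx qy qz by blast
  next
    fix t t' s x y z v assume h: "x \<in> hom C t X" "y \<in> hom C t X" "z \<in> hom C t X" "v \<in> hom C t X"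
        and s: "s \<in> hom C t' t"
      and "?\<Phi> x y z v"
    then obtain t0 x' y' z' where h': "x' \<in> hom C t0 X'" "y' \<in> hom C t0 X'" "z' \<in> hom C t0 X'"
        "rel_mem C K' x' y'"
      "rel_mem C R' y' z'" and e: "q \<cdot> x' = x" "q \<cdot> y' = y" "q \<cdot> z' = z" "v = q \<cdot> c x' y' z'" by blast
    have "x \<in> hom C t0 X" using comp_in_hom[OF h'(1) qh] e(1) by simp
    then have "t0 = t" using h(1) unfolding hom_iff by blast
    then have s0: "s \<in> hom C t' t0" using s by simp
    have "q \<cdot> (x' \<cdot> s) = x \<cdot> s" "q \<cdot> (y' \<cdot> s) = y \<cdot> s" "q \<cdot> (z' \<cdot> s) = z \<cdot> s"
      by (rule comp_eq_comp[OF e(1) s0 h'(1) qh], rule comp_eq_comp[OF e(2) s0 h'(2) qh], rule comp_eq_comp[OF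
          e(3) s0 h'(3) qh])
    moreover have "v \<cdot> s = q \<cdot> c (x' \<cdot> s) (y' \<cdot> s) (z' \<cdot> s)" using natural_op3_comp[OF nF h' s0] e(4) by simp
    moreover have "rel_mem C K' (x' \<cdot> s) (y' \<cdot> s)" "rel_mem C R' (y' \<cdot> s) (z' \<cdot> s)"
      using rel_mem_comp[OF K'r h'(4,1) s0] rel_mem_comp[OF R'r h'(5,2) s0] by auto
    ultimately show "?\<Phi> (x \<cdot> s) (y \<cdot> s) (z \<cdot> s) (v \<cdot> s)"
      using comp_in_hom[OF s0 h'(1)] comp_in_hom[OF s0 h'(2)] comp_in_hom[OF s0 h'(3)] by blast
  next
    fix t x y z v v' assume h: "x \<in> hom C t X" and \<Phi>: "?\<Phi> x y z v" "?\<Phi> x y z v'"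
    obtain t1 x1 y1 z1 where 1: "x1 \<in> hom C t1 X'" "y1 \<in> hom C t1 X'" "z1 \<in> hom C t1 X'" "rel_mem C K' x1 y1"
      "rel_mem C R' y1 z1" "q \<cdot> x1 = x" "q \<cdot> y1 = y" "q \<cdot> z1 = z" "v = q \<cdot> c x1 y1 z1" using \<Phi>(1) by blast
    obtain t2 x2 y2 z2 where 2: "x2 \<in> hom C t2 X'" "y2 \<in> hom C t2 X'" "z2 \<in> hom C t2 X'" "rel_mem C K' x2 y2"
      "rel_mem C R' y2 z2" "q \<cdot> x2 = x" "q \<cdot> y2 = y" "q \<cdot> z2 = z" "v' = q \<cdot> c x2 y2 z2" using \<Phi>(2) by blast
    have "x \<in> hom C t1 X" "x \<in> hom C t2 X"
      using comp_in_hom[OF 1(1) qh] comp_in_hom[OF 2(1) qh] 1(6) 2(6) by auto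
    then have "t1 = t" "t2 = t" using h unfolding hom_iff by blast+
    then show "v = v'" using U[of x1 t y1 z1 x2 y2 z2] 1 2 by simp
  next
    fix t x y v assume "?\<Phi> x y y v"
    then obtain t1 x1 y1 z1 where 1: "x1 \<in> hom C t1 X'" "y1 \<in> hom C t1 X'" "z1 \<in> hom C t1 X'"
        "rel_mem C K' x1 y1"
      "rel_mem C R' y1 z1" "q \<cdot> x1 = x" "q \<cdot> y1 = y" "q \<cdot> z1 = y" "v = q \<cdot> c x1 y1 z1" by blast
    show "v = x" using U[OF 1(1-5) 1(1,2,2,4) reflexive_rel_mem[OF R' 1(2)]] 1 connector_left[OF c 1(1,2,4)]
        by simp
  next
    fix t y z v assume "?\<Phi> y y z v"
    then obtain t1 x1 y1 z1 where 1: "x1 \<in> hom C t1 X'" "y1 \<in> hom C t1 X'" "z1 \<in> hom C t1 X'"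
        "rel_mem C K' x1 y1"
      "rel_mem C R' y1 z1" "q \<cdot> x1 = y" "q \<cdot> y1 = y" "q \<cdot> z1 = z" "v = q \<cdot> c x1 y1 z1" by blast
    show "v = z" using U[OF 1(1-5) 1(2,2,3) reflexive_rel_mem[OF K' 1(2)] 1(5)] 1 connector_right[OF c 1(2,3,5)]
        by simp
  qed
qed

end

section \<open>Joins, meets and trivial commutators\<close>

context regular_maltsev_cat
begin

text \<open>The composite \<open>R \<circ> S\<close> is the image of \<open>R \<times>\<^sub>X S \<rightarrow> X \<times> X\<close>, so the middle element \<open>w\<close> exists
  only over a cover. Being reflexive, the composite is an equivalence relation.\<close>

lemma composite_ex:
  assumes R: "equiv_rel C X R" and S: "equiv_rel C X S"
  obtains J where "equiv_rel C X J"
    "\<And>t y w z. y \<in> hom C t X \<Longrightarrow> w \<in> hom C t X \<Longrightarrow> z \<in> hom C t X \<Longrightarrow> rel_mem C R y w \<Longrightarrow> rel_mem C S w z \<Longrightarrow>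
        rel_mem C J y z"
    "\<And>t y z. y \<in> hom C t X \<Longrightarrow> z \<in> hom C t X \<Longrightarrow> rel_mem C J y z \<Longrightarrow>
      \<exists>t' c w. cover c t' t \<and> w \<in> hom C t' X \<and> rel_mem C R (y \<cdot> c) w \<and> rel_mem C S w (z \<cdot> c)"
proof -
  have Rr: "is_rel C X R" and Sr: "is_rel C X S" using R S by (auto intro: equiv_rel_is_rel)
  note r = is_rel_fst[OF Rr] is_rel_snd[OF Rr] and s = is_rel_fst[OF Sr] is_rel_snd[OF Sr]
  have X: "X \<in> Obj C" using r(1) by (rule hom_Obj)
  obtain V \<rho> \<sigma> where pb: "is_pullback C (snd R) (fst S) \<rho> \<sigma>"
    and \<rho>: "\<rho> \<in> hom C V (Dom C (fst R))" and \<sigma>: "\<sigma> \<in> hom C V (Dom C (fst S))" and sq: "snd R \<cdot> \<rho> = fst S \<cdot> \<sigma>"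
    by (rule pullbackE[OF r(2) s(1)])
  obtain P p q where P: "p \<in> hom C P X" "q \<in> hom C P X"
    and Pex: "\<forall>t. \<forall>a \<in> hom C t X. \<forall>b \<in> hom C t X. \<exists>u \<in> hom C t P. p \<cdot> u = a \<and> q \<cdot> u = b"
    and Pun: "\<forall>t. \<forall>u \<in> hom C t P. \<forall>v \<in> hom C t P. p \<cdot> u = p \<cdot> v \<and> q \<cdot> u = q \<cdot> v \<longrightarrow> u = v"
    using product_ex[OF X X] by blast
  have yz: "fst R \<cdot> \<rho> \<in> hom C V X" "snd S \<cdot> \<sigma> \<in> hom C V X"
    using comp_in_hom[OF \<rho> r(1)] comp_in_hom[OF \<sigma> s(2)] by auto
  obtain f where f: "f \<in> hom C V P" "p \<cdot> f = fst R \<cdot> \<rho>" "q \<cdot> f = snd S \<cdot> \<sigma>"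
    using Pex yz by blast
  obtain I e m where e: "cover e V I" and m: "m \<in> hom C I P" "m \<cdot> e = f"
    and mono: "\<And>t u v. u \<in> hom C t I \<Longrightarrow> v \<in> hom C t I \<Longrightarrow> m \<cdot> u = m \<cdot> v \<Longrightarrow> u = v"
    by (rule image_factorization[OF f(1)]) blast
  have eh: "e \<in> hom C V I" using e by simp
  let ?J = "(p \<cdot> m, q \<cdot> m)"
  have pm: "p \<cdot> m \<in> hom C I X" and qm: "q \<cdot> m \<in> hom C I X"
      using comp_in_hom[OF m(1) P(1)] comp_in_hom[OF m(1) P(2)] by auto
  have dom: "Dom C (p \<cdot> m) = I" using pm by (simp add: hom_iff)
  have Jr: "is_rel C X ?J"
    unfolding is_rel_def fst_conv snd_conv dom
  proof (intro conjI ballI impI pm qm)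
    fix t u v assume u: "u \<in> hom C t I" and v: "v \<in> hom C t I"
        and eq: "(p \<cdot> m) \<cdot> u = (p \<cdot> m) \<cdot> v \<and> (q \<cdot> m) \<cdot> u = (q \<cdot> m) \<cdot> v"
    have "m \<cdot> u = m \<cdot> v"
      using Pun comp_in_hom[OF u m(1)] comp_in_hom[OF v m(1)] eq
        Comp_assoc[OF u m(1) P(1)] Comp_assoc[OF u m(1) P(2)] Comp_assoc[OF v m(1) P(1)]
            Comp_assoc[OF v m(1) P(2)]
      by simp
    then show "u = v" by (rule mono[OF u v])
  qed
  have pme: "(p \<cdot> m) \<cdot> e = fst R \<cdot> \<rho>" "(q \<cdot> m) \<cdot> e = snd S \<cdot> \<sigma>"
    using Comp_assoc[OF eh m(1) P(1)] Comp_assoc[OF eh m(1) P(2)] m(2) f by auto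
  have JI: "rel_mem C ?J y z"
    if h: "y \<in> hom C t X" "w \<in> hom C t X" "z \<in> hom C t X" "rel_mem C R y w" "rel_mem C S w z" for t y w z
  proof -
    obtain l where l: "l \<in> hom C t (Dom C (fst R))" "fst R \<cdot> l = y" "snd R \<cdot> l = w" using h(4,1)
        by (rule rel_memE)
    obtain n where n: "n \<in> hom C t (Dom C (fst S))" "fst S \<cdot> n = w" "snd S \<cdot> n = z" using h(5,2)
        by (rule rel_memE)
    have ln: "snd R \<cdot> l = fst S \<cdot> n" using l n by simp
    obtain u where u: "u \<in> hom C t V" "\<rho> \<cdot> u = l" "\<sigma> \<cdot> u = n"
      by (rule is_pullback_ex[OF pb r(2) s(1) \<rho> l(1) n(1) ln])
    have "(p \<cdot> m) \<cdot> (e \<cdot> u) = y"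
      using comp_eq_comp[OF pme(1) u(1) eh pm] Comp_assoc[OF u(1) \<rho> r(1)] u l by simp
    moreover have "(q \<cdot> m) \<cdot> (e \<cdot> u) = z"
      using comp_eq_comp[OF pme(2) u(1) eh qm] Comp_assoc[OF u(1) \<sigma> s(2)] u n by simp
    ultimately show ?thesis
      by (intro rel_memI[OF _ h(1), of "e \<cdot> u"]) (use comp_in_hom[OF u(1) eh] dom in auto)
  qed
  have JE: "\<exists>t' c w. cover c t' t \<and> w \<in> hom C t' X \<and> rel_mem C R (y \<cdot> c) w \<and> rel_mem C S w (z \<cdot> c)"
    if h: "y \<in> hom C t X" "z \<in> hom C t X" "rel_mem C ?J y z" for t y z
  proof -
    obtain u where u: "u \<in> hom C t I" "(p \<cdot> m) \<cdot> u = y" "(q \<cdot> m) \<cdot> u = z"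
      using rel_memE[OF h(3,1)] dom by auto
    obtain t' c v where c: "cover c t' t" "v \<in> hom C t' V" "e \<cdot> v = u \<cdot> c" by (rule cover_lift[OF e u(1)])
    have ch: "c \<in> hom C t' t" using c by simp
    have \<rho>v: "\<rho> \<cdot> v \<in> hom C t' (Dom C (fst R))" and \<sigma>v: "\<sigma> \<cdot> v \<in> hom C t' (Dom C (fst S))"
      using comp_in_hom[OF c(2) \<rho>] comp_in_hom[OF c(2) \<sigma>] by auto
    let ?w = "snd R \<cdot> (\<rho> \<cdot> v)"
    have w: "?w \<in> hom C t' X" using \<rho>v r(2) by (rule comp_in_hom)
    have "fst R \<cdot> (\<rho> \<cdot> v) = y \<cdot> c"
      using comp_eq_comp[OF pme(1) c(2) eh pm] Comp_assoc[OF c(2) \<rho> r(1)] c(3) comp_eq_comp[OF u(2) ch u(1) pm]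
          by simp
    then have 1: "rel_mem C R (y \<cdot> c) ?w" by (intro rel_memI[OF \<rho>v comp_in_hom[OF ch h(1)]]) auto
    have "snd S \<cdot> (\<sigma> \<cdot> v) = z \<cdot> c"
      using comp_eq_comp[OF pme(2) c(2) eh qm] Comp_assoc[OF c(2) \<sigma> s(2)] c(3) comp_eq_comp[OF u(3) ch u(1) qm]
          by simp
    moreover have "?w = fst S \<cdot> (\<sigma> \<cdot> v)" by (rule square_comp[OF sq c(2) \<rho> r(2) \<sigma> s(1)])
    ultimately have "rel_mem C S ?w (z \<cdot> c)" by (intro rel_memI[OF \<sigma>v w]) auto
    then show ?thesis using c(1) w 1 by blast
  qed
  have i: "Ide C X \<in> hom C X X" using X by (rule Ide_hom)
  have "rel_mem C ?J (Ide C X) (Ide C X)"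
    by (rule JI[OF i i i reflexive_rel_mem[OF equiv_rel_reflexive[OF R] i]
        reflexive_rel_mem[OF equiv_rel_reflexive[OF S] i]])
  then have "equiv_rel C X ?J" using Jr by (intro reflexive_equiv_rel) (simp add: reflexive_rel_def)
  then show ?thesis using JI JE by (rule that)
qed

text \<open>With connectors \<open>c\<close> for \<open>(K, R)\<close> and \<open>d\<close> for \<open>(K, S)\<close>, the connector for \<open>K\<close> and the
  composite is \<open>d (c x y w) w z\<close>, where \<open>y R w S z\<close>. It makes sense because \<open>c x y w\<close> is
  \<open>K\<close>-related to \<open>w\<close>, and it does not depend on \<open>w\<close> by rigidity. For the rigidity arguments
  membership in \<open>K\<close> has to be an equation, whence the arrow \<open>k\<close> of which \<open>K\<close> is the kernel pair.\<close>

lemma centralize_composite: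
  assumes k: "k \<in> hom C X Z" and K: "is_rel C X K"
    and Kk: "\<And>t a b. a \<in> hom C t X \<Longrightarrow> b \<in> hom C t X \<Longrightarrow> rel_mem C K a b \<longleftrightarrow> k \<cdot> a = k \<cdot> b"
    and R: "reflexive_rel C X R" and S: "reflexive_rel C X S" and J: "is_rel C X J"
    and JE: "\<And>t y z. y \<in> hom C t X \<Longrightarrow> z \<in> hom C t X \<Longrightarrow> rel_mem C J y z \<Longrightarrow>
      \<exists>t' c w. cover c t' t \<and> w \<in> hom C t' X \<and> rel_mem C R (y \<cdot> c) w \<and> rel_mem C S w (z \<cdot> c)"
    and KR: "centralize C X K R" and KS: "centralize C X K S"
  shows "centralize C X K J"
proof -
  have X: "X \<in> Obj C" using k by (rule hom_Obj)
  have K': "reflexive_rel C X K" using K Kk[OF Ide_hom[OF X] Ide_hom[OF X]] by (simp add: reflexive_rel_def)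
  have Rr: "is_rel C X R" and Sr: "is_rel C X S" using R S by (auto intro: reflexive_rel_is_rel)
  note r = is_rel_fst[OF Rr] is_rel_snd[OF Rr] and s = is_rel_fst[OF Sr] is_rel_snd[OF Sr]
  obtain c where c: "connector C X K R c" using K' R KR by (rule centralize_connector)
  obtain d where d: "connector C X K S d" using K' S KS by (rule centralize_connector)
  note nc = connector_natural[OF c] and nd = connector_natural[OF d]
  note n1 = natural_op3_post[OF nc k]
  have n2: "natural_op3 C X K R Z (\<lambda>x y z. k \<cdot> z)"
    unfolding natural_op3_def using k by (auto simp: hom_iff)
  have cK: "rel_mem C K (c x y w) w"
    if h: "x \<in> hom C t X" "y \<in> hom C t X" "w \<in> hom C t X" "rel_mem C K x y" "rel_mem C R y w" for t x y w
  proof -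
    have "k \<cdot> c x y w = k \<cdot> w"
    proof (rule natural_op3_agree[OF K' R n1 K' R n2 h h])
      show "k \<cdot> c x y y = k \<cdot> y" using connector_left[OF c h(1,2,4)] Kk[OF h(1,2)] h(4) by simp
      show "k \<cdot> c y y y = k \<cdot> y" using connector_left[OF c h(2,2) reflexive_rel_mem[OF K' h(2)]] by simp
      show "k \<cdot> c y y w = k \<cdot> w" using connector_right[OF c h(2,3,5)] by simp
    qed
    then show ?thesis using Kk[OF natural_op3_hom[OF nc h] h(3)] by simp
  qed
  define D where "D = (\<lambda>x y w z. d (c x y w) w z)"
  have Dh: "D x y w z \<in> hom C t X"
    if h: "x \<in> hom C t X" "y \<in> hom C t X" "w \<in> hom C t X" "rel_mem C K x y" "rel_mem C R y w"
    and z: "z \<in> hom C t X" "rel_mem C S w z" for t x y w z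
    unfolding D_def by (rule natural_op3_hom[OF nd natural_op3_hom[OF nc h] h(3) z(1) cK[OF h] z(2)])
  have Dc: "D (x \<cdot> s) (y \<cdot> s) (w \<cdot> s) (z \<cdot> s) = D x y w z \<cdot> s"
    if h: "x \<in> hom C t X" "y \<in> hom C t X" "w \<in> hom C t X" "rel_mem C K x y" "rel_mem C R y w"
    and z: "z \<in> hom C t X" "rel_mem C S w z" and s: "s \<in> hom C t' t" for t t' s x y w z
    unfolding D_def
    using natural_op3_comp[OF nd natural_op3_hom[OF nc h] h(3) z(1) cK[OF h] z(2) s] natural_op3_comp[OF nc h s]
        by simp
  have Dl: "D x y y y = x" if h: "x \<in> hom C t X" "y \<in> hom C t X" "rel_mem C K x y" for t x y
    unfolding D_def using connector_left[OF c h] connector_left[OF d h] by simp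
  have Dr: "D y y w z = z"
    if h: "y \<in> hom C t X" "w \<in> hom C t X" "z \<in> hom C t X" "rel_mem C R y w" "rel_mem C S w z" for t y w z
    unfolding D_def using connector_right[OF c h(1,2,4)] connector_right[OF d h(2,3,5)] by simp
  \<comment> \<open>the elements of \<open>V\<close> are the triples \<open>(y, w, z)\<close>\<close>
  obtain V \<rho> \<sigma> where pb: "is_pullback C (snd R) (fst S) \<rho> \<sigma>"
    and \<rho>: "\<rho> \<in> hom C V (Dom C (fst R))" and \<sigma>: "\<sigma> \<in> hom C V (Dom C (fst S))" and sq: "snd R \<cdot> \<rho> = fst S \<cdot> \<sigma>"
    by (rule pullbackE[OF r(2) s(1)])
  let ?b = "fst R \<cdot> \<rho>" and ?w = "\<lambda>v. snd R \<cdot> (\<rho> \<cdot> v)" and ?z = "\<lambda>v. snd S \<cdot> (\<sigma> \<cdot> v)"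
  have b: "?b \<in> hom C V X" using \<rho> r(1) by (rule comp_in_hom)
  have wz: "?w v \<in> hom C t X" "?z v \<in> hom C t X" "rel_mem C R (?b \<cdot> v) (?w v)" "rel_mem C S (?w v) (?z v)"
    if v: "v \<in> hom C t V" for t v
  proof -
    note \<rho>v = comp_in_hom[OF v \<rho>] and \<sigma>v = comp_in_hom[OF v \<sigma>]
    show w: "?w v \<in> hom C t X" using \<rho>v r(2) by (rule comp_in_hom)
    show "?z v \<in> hom C t X" using \<sigma>v s(2) by (rule comp_in_hom)
    show "rel_mem C R (?b \<cdot> v) (?w v)"
      by (rule rel_memI[OF \<rho>v comp_in_hom[OF v b]]) (simp_all add: Comp_assoc[OF v \<rho> r(1)])
    show "rel_mem C S (?w v) (?z v)"
      by (rule rel_memI[OF \<sigma>v w]) (simp_all add: square_comp[OF sq v \<rho> r(2) \<sigma> s(1)])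
  qed
  have nD: "natural_op C X K V ?b X (\<lambda>x y v. D x y (?w v) (?z v))"
    unfolding natural_op_def
  proof (intro conjI allI impI; elim conjE)
    fix t x y v assume h: "x \<in> hom C t X" "y \<in> hom C t X" "v \<in> hom C t V" "rel_mem C K x y" "?b \<cdot> v = y"
    note w = wz[OF h(3), unfolded h(5)]
    show "D x y (?w v) (?z v) \<in> hom C t X" by (rule Dh[OF h(1,2) w(1) h(4) w(3) w(2,4)])
    fix t' s assume s': "s \<in> hom C t' t"
    have "?w (v \<cdot> s) = ?w v \<cdot> s" "?z (v \<cdot> s) = ?z v \<cdot> s"
      using comp_assoc_hom[OF \<rho> h(3) s'] comp_assoc_hom[OF r(2) comp_in_hom[OF h(3) \<rho>] s']
        comp_assoc_hom[OF \<sigma> h(3) s'] comp_assoc_hom[OF s(2) comp_in_hom[OF h(3) \<sigma>] s'] by auto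
    then show "D (x \<cdot> s) (y \<cdot> s) (?w (v \<cdot> s)) (?z (v \<cdot> s)) = D x y (?w v) (?z v) \<cdot> s"
      using Dc[OF h(1,2) w(1) h(4) w(3) w(2,4) s'] by simp
  qed
  have el: "\<exists>v \<in> hom C t V. ?b \<cdot> v = y \<and> ?w v = w \<and> ?z v = z"
    if h: "y \<in> hom C t X" "w \<in> hom C t X" "rel_mem C R y w" "rel_mem C S w z" for t y w z
  proof -
    obtain l where l: "l \<in> hom C t (Dom C (fst R))" "fst R \<cdot> l = y" "snd R \<cdot> l = w" using h(3,1)
        by (rule rel_memE)
    obtain n where n: "n \<in> hom C t (Dom C (fst S))" "fst S \<cdot> n = w" "snd S \<cdot> n = z" using h(4,2)
        by (rule rel_memE)
    have ln: "snd R \<cdot> l = fst S \<cdot> n" using l n by simp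
    obtain u where u: "u \<in> hom C t V" "\<rho> \<cdot> u = l" "\<sigma> \<cdot> u = n"
      by (rule is_pullback_ex[OF pb r(2) s(1) \<rho> l(1) n(1) ln])
    then show ?thesis using l n Comp_assoc[OF u(1) \<rho> r(1)] by (intro bexI[OF _ u(1)]) simp
  qed
  have U: "D x y w z = D x y w' z"
    if h: "x \<in> hom C t X" "y \<in> hom C t X" "z \<in> hom C t X" "rel_mem C K x y"
    and w: "w \<in> hom C t X" "rel_mem C R y w" "rel_mem C S w z"
    and w': "w' \<in> hom C t X" "rel_mem C R y w'" "rel_mem C S w' z" for t x y z w w'
  proof -
    obtain v where v: "v \<in> hom C t V" "?b \<cdot> v = y" "?w v = w" "?z v = z" using el[OF h(2) w] by blast
    obtain v' where v': "v' \<in> hom C t V" "?b \<cdot> v' = y" "?w v' = w'" "?z v' = z" using el[OF h(2) w'] by blast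
    \<comment> \<open>the corner \<open>(y, y, y)\<close> does not involve the middle element\<close>
    obtain v0 where v0: "v0 \<in> hom C t V" "?b \<cdot> v0 = y" "?w v0 = y" "?z v0 = y"
      using el[OF h(2,2) reflexive_rel_mem[OF R h(2)] reflexive_rel_mem[OF S h(2)]] by blast
    have "D x y (?w v) (?z v) = D x y (?w v') (?z v')"
    proof (rule natural_op_agree[OF K' b nD K' b nD h(1) v(1) v0(1) v(2) v0(2) h(4) h(1) v'(1) v0(1) v'(2) v0(2)
        h(4)])
      show "D y y (?w v) (?z v) = D y y (?w v') (?z v')"
        using Dr[OF h(2) w(1) h(3) w(2,3)] Dr[OF h(2) w'(1) h(3) w'(2,3)] v v' by simp
    qed auto
    then show ?thesis using v v' by simp
  qed
  let ?\<Phi> = "\<lambda>x y z v. \<exists>t w. x \<in> hom C t X \<and> w \<in> hom C t X \<and> rel_mem C K x y \<and> rel_mem C R y w \<and>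
      rel_mem C S w z \<and> v = D x y w z"
  show ?thesis
  proof (rule centralizeI[OF K J, where \<Phi> = ?\<Phi>])
    fix t x y z assume h: "x \<in> hom C t X" "y \<in> hom C t X" "z \<in> hom C t X" "rel_mem C K x y" "rel_mem C J y z"
    obtain t' a w where a: "cover a t' t" and w: "w \<in> hom C t' X" "rel_mem C R (y \<cdot> a) w"
        "rel_mem C S w (z \<cdot> a)"
      using JE[OF h(2,3,5)] by blast
    have ah: "a \<in> hom C t' t" using a by simp
    note xa = comp_in_hom[OF ah h(1)] comp_in_hom[OF ah h(2)] comp_in_hom[OF ah h(3)]
    have m: "rel_mem C K (x \<cdot> a) (y \<cdot> a)" by (rule rel_mem_comp[OF K h(4,1) ah])
    show "\<exists>t' c v. cover c t' t \<and> v \<in> hom C t' X \<and> ?\<Phi> (x \<cdot> c) (y \<cdot> c) (z \<cdot> c) v"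
      using a Dh[OF xa(1,2) w(1) m w(2) xa(3) w(3)] xa w m by blast
  next
    fix t t' s x y z v assume h: "x \<in> hom C t X" "y \<in> hom C t X" "z \<in> hom C t X" and s: "s \<in> hom C t' t"
        and "?\<Phi> x y z v"
    then obtain t0 w where w: "x \<in> hom C t0 X" "w \<in> hom C t0 X" "rel_mem C K x y" "rel_mem C R y w"
        "rel_mem C S w z" "v = D x y w z"
      by blast
    have [simp]: "t0 = t" using h(1) w(1) unfolding hom_iff by blast
    have w2: "w \<in> hom C t X" using w(2) by simp
    have "v \<cdot> s = D (x \<cdot> s) (y \<cdot> s) (w \<cdot> s) (z \<cdot> s)" using Dc[OF h(1,2) w2 w(3,4) h(3) w(5) s] w(6) by simp
    then show "?\<Phi> (x \<cdot> s) (y \<cdot> s) (z \<cdot> s) (v \<cdot> s)"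
      using comp_in_hom[OF s h(1)] comp_in_hom[OF s w2] rel_mem_comp[OF K w(3) h(1) s]
          rel_mem_comp[OF Rr w(4) h(2) s]
        rel_mem_comp[OF Sr w(5) w2 s] by blast
  next
    fix t x y z v v' assume h: "x \<in> hom C t X" "y \<in> hom C t X" "z \<in> hom C t X" and \<Phi>: "?\<Phi> x y z v" "?\<Phi> x y z v'"
    obtain t1 w where w: "x \<in> hom C t1 X" "w \<in> hom C t1 X" "rel_mem C K x y" "rel_mem C R y w" "rel_mem C S w z"
        "v = D x y w z"
      using \<Phi>(1) by blast
    obtain t2 w' where w': "x \<in> hom C t2 X" "w' \<in> hom C t2 X" "rel_mem C R y w'" "rel_mem C S w' z"
        "v' = D x y w' z"
      using \<Phi>(2) by blast
    have "t1 = t" "t2 = t" using h(1) w(1) w'(1) unfolding hom_iff by blast+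
    then show "v = v'" using U[OF h w(3) _ w(4,5) _ w'(3,4)] w w' by simp
  next
    fix t x y v assume h: "x \<in> hom C t X" "y \<in> hom C t X" and "?\<Phi> x y y v"
    then obtain t1 w where w: "x \<in> hom C t1 X" "w \<in> hom C t1 X" "rel_mem C K x y" "rel_mem C R y w"
        "rel_mem C S w y" "v = D x y w y"
      by blast
    have "t1 = t" using h(1) w(1) unfolding hom_iff by blast
    then show "v = x"
      using U[OF h(1,2,2) w(3) _ w(4,5) h(2) reflexive_rel_mem[OF R h(2)] reflexive_rel_mem[OF S h(2)]]
          w Dl[OF h w(3)] by simp
  next
    fix t y z v assume h: "y \<in> hom C t X" "z \<in> hom C t X" and "?\<Phi> y y z v"
    then obtain t1 w where w: "y \<in> hom C t1 X" "w \<in> hom C t1 X" "rel_mem C R y w" "rel_mem C S w z"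
        "v = D y y w z"
      by blast
    have "t1 = t" using h(1) w(1) unfolding hom_iff by blast
    then show "v = z" using Dr[OF h(1) _ h(2) w(3,4)] w by simp
  qed
qed

lemma is_join_join:
  assumes R: "equiv_rel C X R" and S: "equiv_rel C X S"
  shows "is_join C X R S (join C X R S)"
    and "\<And>t y z. y \<in> hom C t X \<Longrightarrow> z \<in> hom C t X \<Longrightarrow> rel_mem C (join C X R S) y z \<Longrightarrow>
      \<exists>t' c w. cover c t' t \<and> w \<in> hom C t' X \<and> rel_mem C R (y \<cdot> c) w \<and> rel_mem C S w (z \<cdot> c)"
proof -
  obtain J where J: "equiv_rel C X J"
    and JI: "\<And>t y w z. y \<in> hom C t X \<Longrightarrow> w \<in> hom C t X \<Longrightarrow> z \<in> hom C t X \<Longrightarrow> rel_mem C R y w \<Longrightarrow> rel_mem C S w z \<Longrightarrow>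
        rel_mem C J y z"
    and JE: "\<And>t y z. y \<in> hom C t X \<Longrightarrow> z \<in> hom C t X \<Longrightarrow> rel_mem C J y z \<Longrightarrow>
      \<exists>t' c w. cover c t' t \<and> w \<in> hom C t' X \<and> rel_mem C R (y \<cdot> c) w \<and> rel_mem C S w (z \<cdot> c)"
    by (rule composite_ex[OF R S]) blast
  have RJ: "rel_le C R J"
    by (rule rel_leI[OF equiv_rel_is_rel[OF R]]) (use JI reflexive_rel_mem[OF equiv_rel_reflexive[OF S]]
        in blast)
  have SJ: "rel_le C S J"
    by (rule rel_leI[OF equiv_rel_is_rel[OF S]]) (use JI reflexive_rel_mem[OF equiv_rel_reflexive[OF R]]
        in blast)
  have least: "rel_le C J T" if T: "equiv_rel C X T" "rel_le C R T" "rel_le C S T" for T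
  proof (rule rel_leI[OF equiv_rel_is_rel[OF J]])
    fix t a b assume a: "a \<in> hom C t X" and b: "b \<in> hom C t X" and m: "rel_mem C J a b"
    obtain t' c w where c: "cover c t' t" and w: "w \<in> hom C t' X" "rel_mem C R (a \<cdot> c) w"
        "rel_mem C S w (b \<cdot> c)"
      using JE[OF a b m] by blast
    have ch: "c \<in> hom C t' t" using c by simp
    note ac = comp_in_hom[OF ch a]
    have "rel_mem C T (a \<cdot> c) w" using rel_le_mem[OF equiv_rel_is_rel[OF R] equiv_rel_is_rel[OF T(1)]
        T(2) w(2) ac] .
    moreover have "rel_mem C T w (b \<cdot> c)" using rel_le_mem[OF equiv_rel_is_rel[OF S] equiv_rel_is_rel[OF T(1)]
        T(3) w(3,1)] .
    ultimately have "rel_mem C T (a \<cdot> c) (b \<cdot> c)" using equiv_rel_trans[OF T(1) _ _ ac] by blast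
    then show "rel_mem C T a b" by (rule cover_rel_mem[OF equiv_rel_is_rel[OF T(1)] c a b])
  qed
  have isJ: "is_join C X R S J" using J RJ SJ least by (simp add: is_join_def)
  then show join: "is_join C X R S (join C X R S)" unfolding join_def by (rule someI)
  have le: "rel_le C (join C X R S) J" using join J RJ SJ unfolding is_join_def by blast
  fix t y z assume y: "y \<in> hom C t X" and z: "z \<in> hom C t X" and m: "rel_mem C (join C X R S) y z"
  have "rel_mem C J y z"
    by (rule rel_le_mem[OF _ equiv_rel_is_rel[OF J] le m y])
        (use join in \<open>simp add: is_join_def equiv_rel_is_rel\<close>)
  then show "\<exists>t' c w. cover c t' t \<and> w \<in> hom C t' X \<and> rel_mem C R (y \<cdot> c) w \<and> rel_mem C S w (z \<cdot> c)"
    by (rule JE[OF y z])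
qed

end

context maltsev_cat
begin

text \<open>The kernel pair of \<open>\<langle>f, g\<rangle>\<close> is a meet, and any two meets have the same elements.\<close>

lemma meet_kernel_pair_mem:
  assumes f: "f \<in> hom C X Y" and g: "g \<in> hom C X Z"
  defines "M \<equiv> meet C X (kernel_pair C f) (kernel_pair C g)"
  shows "equiv_rel C X M"
    "\<And>t a b. a \<in> hom C t X \<Longrightarrow> b \<in> hom C t X \<Longrightarrow> rel_mem C M a b \<longleftrightarrow> f \<cdot> a = f \<cdot> b \<and> g \<cdot> a = g \<cdot> b"
proof -
  let ?K = "kernel_pair C f" and ?L = "kernel_pair C g"
  note K = is_kernel_pair_kernel_pair[OF f] and L = is_kernel_pair_kernel_pair[OF g]
  note Kr = kernel_pair_is_rel[OF K f] and Lr = kernel_pair_is_rel[OF L g]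
  obtain W m where m: "m \<in> hom C X W"
    and mm: "\<And>t u v. u \<in> hom C t X \<Longrightarrow> v \<in> hom C t X \<Longrightarrow> m \<cdot> u = m \<cdot> v \<longleftrightarrow> f \<cdot> u = f \<cdot> v \<and> g \<cdot> u = g \<cdot> v"
    by (rule pairing_ex[OF f g]) blast
  let ?T = "kernel_pair C m"
  note T = is_kernel_pair_kernel_pair[OF m]
  have Te: "equiv_rel C X ?T" by (rule reflexive_equiv_rel[OF kernel_pair_reflexive[OF T m]])
  have Tm: "rel_mem C ?T a b \<longleftrightarrow> f \<cdot> a = f \<cdot> b \<and> g \<cdot> a = g \<cdot> b" if "a \<in> hom C t X" "b \<in> hom C t X" for t a b
    using kernel_pair_mem[OF T m that] mm[OF that] by simp
  have TK: "rel_le C ?T ?K"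
    by (rule rel_leI[OF equiv_rel_is_rel[OF Te]]) (use Tm kernel_pair_mem[OF K f] in blast)
  have TL: "rel_le C ?T ?L"
    by (rule rel_leI[OF equiv_rel_is_rel[OF Te]]) (use Tm kernel_pair_mem[OF L g] in blast)
  have sub: "rel_mem C ?T a b"
    if "is_rel C X T'" "rel_le C T' ?K" "rel_le C T' ?L" "a \<in> hom C t X" "b \<in> hom C t X" "rel_mem C T' a b"
        for T' t a b
    using rel_le_mem[OF that(1) Kr that(2,6,4)] rel_le_mem[OF that(1) Lr that(3,6,4)] that(4,5)
      Tm kernel_pair_mem[OF K f] kernel_pair_mem[OF L g] by blast
  have "is_meet C X ?K ?L ?T"
    unfolding is_meet_def using Te TK TL rel_leI[OF equiv_rel_is_rel, of X _ ?T] sub[OF equiv_rel_is_rel]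
        by blast
  then have M: "is_meet C X ?K ?L M" unfolding M_def meet_def by (rule someI)
  then show Me: "equiv_rel C X M" by (simp add: is_meet_def)
  have MK: "rel_le C M ?K" "rel_le C M ?L" "rel_le C ?T M" using M Te TK TL unfolding is_meet_def by blast+
  fix t a b assume a: "a \<in> hom C t X" and b: "b \<in> hom C t X"
  show "rel_mem C M a b \<longleftrightarrow> f \<cdot> a = f \<cdot> b \<and> g \<cdot> a = g \<cdot> b"
    using sub[OF equiv_rel_is_rel[OF Me] MK(1,2) a b] Tm[OF a b]
      rel_le_mem[OF equiv_rel_is_rel[OF Te] equiv_rel_is_rel[OF Me] MK(3) _ a] by blast
qed

text \<open>The quotient by the diagonal is the identity, whose direct images change nothing; so \<open>diag C
  X\<close> is among the relations whose quotient makes \<open>K\<close> and \<open>L\<close> centralize each other, and it is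
  below every equivalence relation.\<close>

lemma commutator_eq_diag:
  assumes K: "is_rel C X K" and L: "is_rel C X L" and cen: "centralize C X K L"
  shows "rel_eq C (commutator C X K L) (diag C X)"
proof -
  have X: "X \<in> Obj C" using is_rel_fst[OF K] by (rule hom_Obj)
  have i: "Ide C X \<in> hom C X X" using X by (rule Ide_hom)
  have De: "equiv_rel C X (diag C X)"
    by (rule reflexive_equiv_rel) (use diag_is_rel[OF X] diag_mem[OF i i] in \<open>simp add: reflexive_rel_def\<close>)
  have Dle: "rel_le C (diag C X) T" if T: "equiv_rel C X T" for T
    by (rule rel_leI[OF diag_is_rel[OF X]]) (use diag_mem reflexive_rel_mem[OF equiv_rel_reflexive[OF T]]
        in auto)
  have coeq: "is_coequalizer C (Ide C A) (Ide C A) (Ide C A)" if "A \<in> Obj C" for A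
    by (rule coequalizerI[of _ A A _ _ A]) (use that in \<open>auto simp: hom_iff\<close>)
  have img: "is_image C (Ide C X) R R" if R: "is_rel C X R" for R
  proof -
    have A: "Dom C (fst R) \<in> Obj C" using is_rel_fst[OF R] by (rule hom_Obj)
    have "regular_epi C (Ide C (Dom C (fst R)))" using coeq[OF A] by (auto simp: regular_epi_def)
    then show ?thesis unfolding is_image_def
      using R A X is_rel_fst[OF R] is_rel_snd[OF R] Ide_hom[OF A] Comp_Ide Ide_Comp
      by (intro conjI bexI[of _ "Ide C (Dom C (fst R))"]) auto
  qed
  have cb: "centralized_by C X K L (diag C X)"
    unfolding centralized_by_def
    by (intro conjI De exI[of _ "Ide C X"] exI[of _ K] exI[of _ L])
      (use coeq[OF X] img[OF K] img[OF L] cen X in \<open>auto simp: diag_def\<close>)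
  have "is_commutator C X K L (diag C X)"
    unfolding is_commutator_def using cb Dle by (auto simp: centralized_by_def)
  then have com: "is_commutator C X K L (commutator C X K L)" unfolding commutator_def by (rule someI)
  then have "rel_le C (commutator C X K L) (diag C X)" using cb unfolding is_commutator_def by blast
  moreover have "rel_le C (diag C X) (commutator C X K L)"
    using com by (intro Dle) (simp add: is_commutator_def centralized_by_def)
  ultimately show ?thesis by (simp add: rel_eq_def)
qed

end

section \<open>Fibrations of pairs of equivalence relations\<close>

lemma two_Eq_simps [simp]:
  "Dom (two_Eq C) (x, f, y) = x" "Cod (two_Eq C) (x, f, y) = y"
  "Comp (two_Eq C) (y', g, z) (x, f, y) = (x, Comp C g f, z)"
  "Obj (two_Eq C) = two_Eq_obj C" "Ide (two_Eq C) x = (x, Ide C (fst x), x)"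
  by (simp_all add: two_Eq_def)

lemma Ext_simps [simp]:
  "Dom (Ext A G) (f, gj, h) = f" "Cod (Ext A G) (f, gj, h) = h"
  "Comp (Ext A G) (h', (k, l), m) (f, (g, j), h) = (f, (Comp A k g, Comp A l j), m)"
  "Obj (Ext A G) = G" "Ide (Ext A G) f = (f, (Ide A (Dom A f), Ide A (Cod A f)), f)"
  by (simp_all add: Ext_def)

lemma Ext_Arr_iff:
  "(f, (g, j), h) \<in> Arr (Ext A G) \<longleftrightarrow> f \<in> G \<and> h \<in> G \<and> g \<in> hom A (Dom A f) (Dom A h) \<and>
    j \<in> hom A (Cod A f) (Cod A h) \<and> Comp A h g = Comp A j f"
  by (auto simp: Ext_def)

lemma Ext_ArrE:
  assumes "F \<in> Arr (Ext A G)"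
  obtains f g j h where "F = (f, (g, j), h)" "f \<in> G" "h \<in> G" "g \<in> hom A (Dom A f) (Dom A h)"
    "j \<in> hom A (Cod A f) (Cod A h)" "Comp A h g = Comp A j f"
  using assms by (auto simp: Ext_def)

lemma Ext_hom_iff:
  "F \<in> hom (Ext A G) f h \<longleftrightarrow> (\<exists>g j. F = (f, (g, j), h) \<and> f \<in> G \<and> h \<in> G \<and> g \<in> hom A (Dom A f) (Dom A h) \<and>
    j \<in> hom A (Cod A f) (Cod A h) \<and> Comp A h g = Comp A j f)"
proof -
  have "F \<in> hom (Ext A G) f h \<longleftrightarrow> F \<in> Arr (Ext A G) \<and> Dom (Ext A G) F = f \<and> Cod (Ext A G) F = h"
    by (simp add: hom_def[of "Ext A G"])
  then show ?thesis by (cases F) (auto simp: Ext_Arr_iff)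
qed

lemma Ext_homI:
  "f \<in> G \<Longrightarrow> h \<in> G \<Longrightarrow> g \<in> hom A (Dom A f) (Dom A h) \<Longrightarrow> j \<in> hom A (Cod A f) (Cod A h) \<Longrightarrow>
    Comp A h g = Comp A j f \<Longrightarrow> (f, (g, j), h) \<in> hom (Ext A G) f h"
  unfolding Ext_hom_iff by simp

lemma Ext_homD:
  assumes "(f, (g, j), h) \<in> hom (Ext A G) f h"
  shows "f \<in> G" "h \<in> G" "g \<in> hom A (Dom A f) (Dom A h)" "j \<in> hom A (Cod A f) (Cod A h)"
    "Comp A h g = Comp A j f"
  using assms unfolding Ext_hom_iff by simp_all

lemma category_Ext:
  assumes "category A" "G \<subseteq> Arr A"
  shows "category (Ext A G)"
proof -
  interpret A: category A by (rule assms(1))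
  have GA: "f \<in> G \<Longrightarrow> f \<in> Arr A" for f using assms(2) by blast
  show ?thesis
  proof
    fix F assume "F \<in> Arr (Ext A G)"
    then show "Dom (Ext A G) F \<in> Obj (Ext A G)" "Cod (Ext A G) F \<in> Obj (Ext A G)"
      by (auto elim: Ext_ArrE)
  next
    fix x assume "x \<in> Obj (Ext A G)"
    then show "Ide (Ext A G) x \<in> hom (Ext A G) x x"
      by (auto simp: Ext_hom_iff A.hom_iff GA)
  next
    fix f x y g z assume "f \<in> hom (Ext A G) x y" "g \<in> hom (Ext A G) y z"
    then obtain f1 f0 g1 g0 where f: "f = (x, (f1, f0), y)" "x \<in> G" "y \<in> G" "f1 \<in> hom A (Dom A x) (Dom A y)"
        "f0 \<in> hom A (Cod A x) (Cod A y)" "Comp A y f1 = Comp A f0 x"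
      and g: "g = (y, (g1, g0), z)" "z \<in> G" "g1 \<in> hom A (Dom A y) (Dom A z)"
        "g0 \<in> hom A (Cod A y) (Cod A z)" "Comp A z g1 = Comp A g0 y"
      unfolding Ext_hom_iff by blast
    have x: "x \<in> hom A (Dom A x) (Cod A x)" "y \<in> hom A (Dom A y) (Cod A y)" "z \<in> hom A (Dom A z) (Cod A z)"
      using GA f g by (auto simp: hom_def)
    have "Comp A z (Comp A g1 f1) = Comp A g0 (Comp A y f1)"
      by (rule A.square_comp[OF g(5) f(4) g(3) x(3) x(2) g(4)])
    also have "\<dots> = Comp A (Comp A g0 f0) x"
      using f(6) A.Comp_assoc[OF x(1) f(5) g(4)] by simp
    finally show "Comp (Ext A G) g f \<in> hom (Ext A G) x z"
      using f g A.comp_in_hom[OF f(4) g(3)] A.comp_in_hom[OF f(5) g(4)] by (auto simp: Ext_hom_iff)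
  next
    fix f x y assume "f \<in> hom (Ext A G) x y"
    then show "Comp (Ext A G) f (Ide (Ext A G) x) = f" "Comp (Ext A G) (Ide (Ext A G) y) f = f"
      by (auto simp: Ext_hom_iff A.Comp_Ide A.Ide_Comp)
  next
    fix f w x g y h z assume "f \<in> hom (Ext A G) w x" "g \<in> hom (Ext A G) x y" "h \<in> hom (Ext A G) y z"
    then show "Comp (Ext A G) (Comp (Ext A G) h g) f = Comp (Ext A G) h (Comp (Ext A G) g f)"
      by (auto simp: Ext_hom_iff A.Comp_assoc)
  qed
qed

context category
begin

lemma restricts_mem:
  assumes "is_rel C X R" "is_rel C Y P" "f \<in> hom C X Y" "restricts C f R P" "a \<in> hom C t X" "rel_mem C R a b"
  shows "rel_mem C P (f \<cdot> a) (f \<cdot> b)"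
proof -
  note R = is_rel_fst[OF assms(1)] is_rel_snd[OF assms(1)]
  obtain u where u: "u \<in> hom C t (Dom C (fst R))" "fst R \<cdot> u = a" "snd R \<cdot> u = b"
    using assms(6,5) by (rule rel_memE)
  have "rel_mem C P ((f \<cdot> fst R) \<cdot> u) ((f \<cdot> snd R) \<cdot> u)"
    using assms(4) by (intro rel_mem_comp[OF assms(2) _ comp_in_hom[OF R(1) assms(3)] u(1)])
        (simp add: restricts_def)
  then show ?thesis using Comp_assoc[OF u(1) R(1) assms(3)] Comp_assoc[OF u(1) R(2) assms(3)] u by simp
qed

lemma restrictsI:
  assumes "is_rel C X R"
    and "\<And>t a b. a \<in> hom C t X \<Longrightarrow> b \<in> hom C t X \<Longrightarrow> rel_mem C R a b \<Longrightarrow> rel_mem C P (f \<cdot> a) (f \<cdot> b)"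
  shows "restricts C f R P"
  unfolding restricts_def
proof (rule assms(2)[OF is_rel_fst[OF assms(1)] is_rel_snd[OF assms(1)]])
  show "rel_mem C R (fst R) (snd R)"
    using is_rel_fst[OF assms(1)] is_rel_snd[OF assms(1)]
    by (intro rel_memI[of "Ide C (Dom C (fst R))"]) (auto simp: hom_def)
qed

lemma two_Eq_hom_iff:
  "F \<in> hom (two_Eq C) (X, R, S) (Y, P, Q) \<longleftrightarrow> (\<exists>f. F = ((X, R, S), f, (Y, P, Q)) \<and>
    equiv_rel C X R \<and> equiv_rel C X S \<and> equiv_rel C Y P \<and> equiv_rel C Y Q \<and> f \<in> hom C X Y \<and>
    restricts C f R P \<and> restricts C f S Q)"
proof -
  have "F \<in> hom (two_Eq C) (X, R, S) (Y, P, Q) \<longleftrightarrow> (\<exists>f. F = ((X, R, S), f, (Y, P, Q)) \<and>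
    X \<in> Obj C \<and> Y \<in> Obj C \<and> equiv_rel C X R \<and> equiv_rel C X S \<and> equiv_rel C Y P \<and> equiv_rel C Y Q \<and>
        f \<in> hom C X Y \<and>
    restricts C f R P \<and> restricts C f S Q)"
  proof -
    have "(x, f, y) \<in> Arr (two_Eq C) \<longleftrightarrow> (\<exists>X R S X' R' S'. x = (X, R, S) \<and> y = (X', R', S') \<and>
        x \<in> two_Eq_obj C \<and> y \<in> two_Eq_obj C \<and> f \<in> hom C X X' \<and> restricts C f R R' \<and>
            restricts C f S S')" for x f y
      unfolding two_Eq_def by auto
    moreover have "F \<in> hom (two_Eq C) (X, R, S) (Y, P, Q) \<longleftrightarrow>
        F \<in> Arr (two_Eq C) \<and> Dom (two_Eq C) F = (X, R, S) \<and> Cod (two_Eq C) F = (Y, P, Q)"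
      by (simp add: hom_def[of "two_Eq C"])
    moreover obtain x f y where "F = (x, f, y)" by (cases F)
    ultimately show ?thesis by (auto simp: two_Eq_obj_def simp del: split_paired_Ex split_paired_All)
  qed
  then show ?thesis using hom_Obj by blast
qed

lemma two_Eq_homE:
  assumes "((X, R, S), f, (Y, P, Q)) \<in> hom (two_Eq C) (X, R, S) (Y, P, Q)"
  shows "f \<in> hom C X Y" "equiv_rel C X R" "equiv_rel C X S" "equiv_rel C Y P" "equiv_rel C Y Q"
    "\<And>t a b. a \<in> hom C t X \<Longrightarrow> rel_mem C R a b \<Longrightarrow> rel_mem C P (f \<cdot> a) (f \<cdot> b)"
    "\<And>t a b. a \<in> hom C t X \<Longrightarrow> rel_mem C S a b \<Longrightarrow> rel_mem C Q (f \<cdot> a) (f \<cdot> b)"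
proof -
  have h: "f \<in> hom C X Y" "equiv_rel C X R" "equiv_rel C X S" "equiv_rel C Y P" "equiv_rel C Y Q"
    "restricts C f R P" "restricts C f S Q"
    using assms unfolding two_Eq_hom_iff by auto
  show "f \<in> hom C X Y" "equiv_rel C X R" "equiv_rel C X S" "equiv_rel C Y P" "equiv_rel C Y Q" by (fact h)+
  show "rel_mem C P (f \<cdot> a) (f \<cdot> b)" if "a \<in> hom C t X" "rel_mem C R a b" for t a b
    by (rule restricts_mem[OF equiv_rel_is_rel[OF h(2)] equiv_rel_is_rel[OF h(4)] h(1,6) that])
  show "rel_mem C Q (f \<cdot> a) (f \<cdot> b)" if "a \<in> hom C t X" "rel_mem C S a b" for t a b
    by (rule restricts_mem[OF equiv_rel_is_rel[OF h(3)] equiv_rel_is_rel[OF h(5)] h(1,7) that])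
qed

lemma two_Eq_homI:
  assumes "f \<in> hom C X Y" "equiv_rel C X R" "equiv_rel C X S" "equiv_rel C Y P" "equiv_rel C Y Q"
    "\<And>t a b. a \<in> hom C t X \<Longrightarrow> b \<in> hom C t X \<Longrightarrow> rel_mem C R a b \<Longrightarrow> rel_mem C P (f \<cdot> a) (f \<cdot> b)"
    "\<And>t a b. a \<in> hom C t X \<Longrightarrow> b \<in> hom C t X \<Longrightarrow> rel_mem C S a b \<Longrightarrow> rel_mem C Q (f \<cdot> a) (f \<cdot> b)"
  shows "((X, R, S), f, (Y, P, Q)) \<in> hom (two_Eq C) (X, R, S) (Y, P, Q)"
  unfolding two_Eq_hom_iff
  using assms(1-5) restrictsI[OF equiv_rel_is_rel[OF assms(2)] assms(6)]
      restrictsI[OF equiv_rel_is_rel[OF assms(3)] assms(7)]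
  by simp

lemma category_two_Eq: "category (two_Eq C)"
proof
  fix F assume "F \<in> Arr (two_Eq C)"
  then show "Dom (two_Eq C) F \<in> Obj (two_Eq C)" "Cod (two_Eq C) F \<in> Obj (two_Eq C)"
    by (auto simp: two_Eq_def)
next
  fix x assume x: "x \<in> Obj (two_Eq C)"
  obtain X R S where [simp]: "x = (X, R, S)" by (cases x)
  have e: "X \<in> Obj C" "equiv_rel C X R" "equiv_rel C X S" using x by (auto simp: two_Eq_obj_def)
  show "Ide (two_Eq C) x \<in> hom (two_Eq C) x x"
    using e by (auto intro!: two_Eq_homI Ide_hom simp: Ide_Comp)
next
  fix f x y g z assume f: "f \<in> hom (two_Eq C) x y" and g: "g \<in> hom (two_Eq C) y z"
  obtain X R S Y P Q Z M N where [simp]: "x = (X, R, S)" "y = (Y, P, Q)" "z = (Z, M, N)"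
      by (cases x, cases y, cases z)
  obtain f0 g0 where [simp]: "f = (x, f0, y)" "g = (y, g0, z)" using f g by (auto simp: two_Eq_hom_iff)
  note f' = two_Eq_homE[OF f[simplified]] and g' = two_Eq_homE[OF g[simplified]]
  have "((X, R, S), g0 \<cdot> f0, (Z, M, N)) \<in> hom (two_Eq C) (X, R, S) (Z, M, N)"
  proof (rule two_Eq_homI[OF comp_in_hom[OF f'(1) g'(1)] f'(2,3) g'(4,5)])
    fix t a b assume a: "a \<in> hom C t X" and b: "b \<in> hom C t X"
    have e: "(g0 \<cdot> f0) \<cdot> a = g0 \<cdot> (f0 \<cdot> a)" "(g0 \<cdot> f0) \<cdot> b = g0 \<cdot> (f0 \<cdot> b)"
      by (rule Comp_assoc[OF a f'(1) g'(1)], rule Comp_assoc[OF b f'(1) g'(1)])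
    show "rel_mem C R a b \<Longrightarrow> rel_mem C M ((g0 \<cdot> f0) \<cdot> a) ((g0 \<cdot> f0) \<cdot> b)"
      unfolding e by (rule g'(6)[OF comp_in_hom[OF a f'(1)] f'(6)[OF a]])
    show "rel_mem C S a b \<Longrightarrow> rel_mem C N ((g0 \<cdot> f0) \<cdot> a) ((g0 \<cdot> f0) \<cdot> b)"
      unfolding e by (rule g'(7)[OF comp_in_hom[OF a f'(1)] f'(7)[OF a]])
  qed
  then show "Comp (two_Eq C) g f \<in> hom (two_Eq C) x z" by simp
next
  fix f x y assume f: "f \<in> hom (two_Eq C) x y"
  obtain X R S Y P Q where [simp]: "x = (X, R, S)" "y = (Y, P, Q)" by (cases x, cases y)
  obtain f0 where [simp]: "f = (x, f0, y)" and f0: "f0 \<in> hom C X Y" using f by (auto simp: two_Eq_hom_iff)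
  show "Comp (two_Eq C) f (Ide (two_Eq C) x) = f" "Comp (two_Eq C) (Ide (two_Eq C) y) f = f"
    by (simp_all add: Comp_Ide[OF f0] Ide_Comp[OF f0])
next
  fix f w x g y h z assume f: "f \<in> hom (two_Eq C) w x" and g: "g \<in> hom (two_Eq C) x y"
      and h: "h \<in> hom (two_Eq C) y z"
  obtain W V U X R S Y P Q Z M N where [simp]: "w = (W, V, U)" "x = (X, R, S)" "y = (Y, P, Q)" "z = (Z, M, N)"
    by (cases w, cases x, cases y, cases z)
  obtain f0 g0 h0 where [simp]: "f = (w, f0, x)" "g = (x, g0, y)" "h = (y, h0, z)"
    and "f0 \<in> hom C W X" "g0 \<in> hom C X Y" "h0 \<in> hom C Y Z"
    using f g h by (auto simp: two_Eq_hom_iff)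
  then show "Comp (two_Eq C) (Comp (two_Eq C) h g) f = Comp (two_Eq C) h (Comp (two_Eq C) g f)"
    by (simp add: Comp_assoc)
qed

end

context regular_maltsev_cat
begin

lemma is_rel_reflexive_equivI: "is_rel C X P \<Longrightarrow> (\<And>t a. a \<in> hom C t X \<Longrightarrow> rel_mem C P a a) \<Longrightarrow> equiv_rel C X P"
  using reflexive_equiv_rel Ide_hom hom_Obj(2)[OF is_rel_fst] unfolding reflexive_rel_def by blast

lemma inverse_image_equiv_ex:
  assumes k: "k \<in> hom C A B" and V: "equiv_rel C B V"
  shows "\<exists>P. equiv_rel C A P \<and>
    (\<forall>t. \<forall>a \<in> hom C t A. \<forall>b \<in> hom C t A. rel_mem C P a b \<longleftrightarrow> rel_mem C V (k \<cdot> a) (k \<cdot> b))"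
proof -
  obtain P where P: "is_rel C A P"
    "\<forall>t. \<forall>a \<in> hom C t A. \<forall>b \<in> hom C t A. rel_mem C P a b \<longleftrightarrow> rel_mem C V (k \<cdot> a) (k \<cdot> b)"
    using inverse_image_ex[OF equiv_rel_is_rel[OF V] k] by blast
  have "equiv_rel C A P"
  proof (rule is_rel_reflexive_equivI[OF P(1)])
    fix t a assume a: "a \<in> hom C t A"
    show "rel_mem C P a a" using P(2) a reflexive_rel_mem[OF equiv_rel_reflexive[OF V] comp_in_hom[OF a k]]
        by simp
  qed
  then show ?thesis using P(2) by blast
qed

lemma equiv_rel_diag: "X \<in> Obj C \<Longrightarrow> equiv_rel C X (diag C X)"
  by (rule is_rel_reflexive_equivI[OF diag_is_rel]) (simp_all add: diag_mem)

text \<open>Since every arrow out of a discrete pair is compatible with relations, the generalized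
  elements of an object \<open>X\<close> of \<open>C\<close> can be detected by arrows of pairs.\<close>

lemma discrete_hom:
  assumes "a \<in> hom C t X" "equiv_rel C X R" "equiv_rel C X S"
  shows "((t, diag C t, diag C t), a, (X, R, S)) \<in> hom (two_Eq C) (t, diag C t, diag C t) (X, R, S)"
proof (rule two_Eq_homI[OF assms(1) _ _ assms(2,3)])
  have t: "t \<in> Obj C" using assms(1) by (rule hom_Obj)
  then show "equiv_rel C t (diag C t)" "equiv_rel C t (diag C t)" by (auto intro: equiv_rel_diag)
  fix s x y assume x: "x \<in> hom C s t" "y \<in> hom C s t"
  show "rel_mem C (diag C t) x y \<Longrightarrow> rel_mem C R (a \<cdot> x) (a \<cdot> y)"
    using diag_mem[OF x] reflexive_rel_mem[OF equiv_rel_reflexive[OF assms(2)] comp_in_hom[OF x(1) assms(1)]]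
        by simp
  show "rel_mem C (diag C t) x y \<Longrightarrow> rel_mem C S (a \<cdot> x) (a \<cdot> y)"
    using diag_mem[OF x] reflexive_rel_mem[OF equiv_rel_reflexive[OF assms(3)] comp_in_hom[OF x(1) assms(1)]]
        by simp
qed

text \<open>The regular epimorphism in \<open>two_Eq C\<close> is the coequalizer of some parallel pair there. Its
  underlying arrow has the same universal property in \<open>C\<close>, as one sees by testing against objects
  with the indiscrete relations.\<close>

lemma fibrationD:
  assumes "((X, R, S), f, (Y, P, Q)) \<in> fibrations C"
  shows "((X, R, S), f, (Y, P, Q)) \<in> hom (two_Eq C) (X, R, S) (Y, P, Q)" "cover f X Y"
    "\<And>t a b. a \<in> hom C t X \<Longrightarrow> b \<in> hom C t X \<Longrightarrow> rel_mem C R a b \<longleftrightarrow> rel_mem C P (f \<cdot> a) (f \<cdot> b)"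
    "\<And>t a b. a \<in> hom C t X \<Longrightarrow> b \<in> hom C t X \<Longrightarrow> rel_mem C S a b \<longleftrightarrow> rel_mem C Q (f \<cdot> a) (f \<cdot> b)"
proof -
  interpret T: category "two_Eq C" by (rule category_two_Eq)
  define F where F: "F = ((X, R, S), f, (Y, P, Q))"
  have re: "regular_epi (two_Eq C) F"
    and inv: "is_inverse_image C f P R" "is_inverse_image C f Q S"
    using assms by (auto simp: fibrations_def F)
  have "F \<in> Arr (two_Eq C)" using re by (auto simp: regular_epi_def is_coequalizer_def hom_def)
  then have Fh: "F \<in> hom (two_Eq C) (X, R, S) (Y, P, Q)" using F by (simp add: hom_def)
  note F' = two_Eq_homE[OF Fh[unfolded F]]
  have fX: "Dom C f = X" using F'(1) by (simp add: hom_iff)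
  obtain A a b where ab: "a \<in> hom (two_Eq C) A (X, R, S)" "b \<in> hom (two_Eq C) A (X, R, S)"
    "Comp (two_Eq C) F a = Comp (two_Eq C) F b"
    and un: "\<And>Y' k. k \<in> hom (two_Eq C) (X, R, S) Y' \<Longrightarrow> Comp (two_Eq C) k a = Comp (two_Eq C) k b \<Longrightarrow>
      \<exists>!u. u \<in> hom (two_Eq C) (Y, P, Q) Y' \<and> Comp (two_Eq C) u F = k"
    using conjI[OF re Fh] by (rule T.coverE) blast
  obtain A0 R0 S0 where A: "A = (A0, R0, S0)" by (cases A)
  obtain a0 b0 where a: "a = (A, a0, (X, R, S))" "b = (A, b0, (X, R, S))" "a0 \<in> hom C A0 X" "b0 \<in> hom C A0 X"
    using ab A by (auto simp: two_Eq_hom_iff)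
  \<comment> \<open>arrows of \<open>C\<close> out of \<open>X\<close> become arrows of pairs when the target carries the indiscrete relation\<close>
  have ind: "\<exists>V. \<forall>X R S. \<forall>k \<in> hom C X Z. equiv_rel C X R \<longrightarrow> equiv_rel C X S \<longrightarrow>
      ((X, R, S), k, (Z, V, V)) \<in> hom (two_Eq C) (X, R, S) (Z, V, V)" if Z: "Z \<in> Obj C" for Z
  proof -
    obtain V where V: "is_rel C Z V" "\<forall>t. \<forall>a \<in> hom C t Z. \<forall>b \<in> hom C t Z. rel_mem C V a b"
      using indiscrete_ex[OF Z] by blast
    have Ve: "equiv_rel C Z V" using V by (intro is_rel_reflexive_equivI) auto
    show ?thesis
    proof (intro exI[of _ V] allI ballI impI)
      fix X R S k assume k: "k \<in> hom C X Z" and e: "equiv_rel C X R" "equiv_rel C X S"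
      have "rel_mem C V (k \<cdot> a) (k \<cdot> b)" if "a \<in> hom C t X" "b \<in> hom C t X" for t a b
        using V(2) comp_in_hom[OF that(1) k] comp_in_hom[OF that(2) k] by blast
      then show "((X, R, S), k, (Z, V, V)) \<in> hom (two_Eq C) (X, R, S) (Z, V, V)"
        by (intro two_Eq_homI[OF k e Ve Ve]) auto
    qed
  qed
  have "is_coequalizer C a0 b0 f"
  proof (rule coequalizerI[OF a(3,4) F'(1)])
    show fa: "f \<cdot> a0 = f \<cdot> b0" using ab(3) a F by simp
    fix Z
    show "\<exists>u \<in> hom C Y Z. u \<cdot> f = k" if k: "k \<in> hom C X Z" "k \<cdot> a0 = k \<cdot> b0" for k
    proof -
      obtain V where V: "\<forall>X R S. \<forall>k \<in> hom C X Z. equiv_rel C X R \<longrightarrow> equiv_rel C X S \<longrightarrow>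
        ((X, R, S), k, (Z, V, V)) \<in> hom (two_Eq C) (X, R, S) (Z, V, V)"
        using ind[OF hom_Obj(2)[OF k(1)]] by blast
      have kh: "((X, R, S), k, (Z, V, V)) \<in> hom (two_Eq C) (X, R, S) (Z, V, V)" using V k F' by blast
      have "Comp (two_Eq C) ((X, R, S), k, (Z, V, V)) a = Comp (two_Eq C) ((X, R, S), k, (Z, V, V)) b"
        using a k(2) by simp
      then obtain u where "u \<in> hom (two_Eq C) (Y, P, Q) (Z, V, V)"
          "Comp (two_Eq C) u F = ((X, R, S), k, (Z, V, V))"
        using un[OF kh] by blast
      then show ?thesis using F by (auto simp: two_Eq_hom_iff)
    qed
    show "u = v" if u: "u \<in> hom C Y Z" and v: "v \<in> hom C Y Z" and eq: "u \<cdot> f = v \<cdot> f" for u v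
    proof -
      obtain V where V: "\<forall>X R S. \<forall>k \<in> hom C X Z. equiv_rel C X R \<longrightarrow> equiv_rel C X S \<longrightarrow>
        ((X, R, S), k, (Z, V, V)) \<in> hom (two_Eq C) (X, R, S) (Z, V, V)"
        using ind[OF hom_Obj(2)[OF u]] by blast
      let ?l = "\<lambda>w. ((Y, P, Q), w, (Z, V, V))" and ?k = "((X, R, S), u \<cdot> f, (Z, V, V))"
      have l: "?l u \<in> hom (two_Eq C) (Y, P, Q) (Z, V, V)" "?l v \<in> hom (two_Eq C) (Y, P, Q) (Z, V, V)"
        using V u v F' by blast+
      have k: "?k \<in> hom (two_Eq C) (X, R, S) (Z, V, V)" using V comp_in_hom[OF F'(1) u] F' by blast
      have "Comp (two_Eq C) ?k a = Comp (two_Eq C) ?k b"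
        using a Comp_assoc[OF a(3) F'(1) u] Comp_assoc[OF a(4) F'(1) u] fa by simp
      then have "\<exists>!w. w \<in> hom (two_Eq C) (Y, P, Q) (Z, V, V) \<and> Comp (two_Eq C) w F = ?k" by (rule un[OF k])
      moreover have "Comp (two_Eq C) (?l u) F = ?k" "Comp (two_Eq C) (?l v) F = ?k" using F eq by auto
      ultimately have "?l u = ?l v" using l by blast
      then show ?thesis by simp
    qed
  qed
  then show "cover f X Y" using F'(1) by (auto simp: regular_epi_def)
  show "((X, R, S), f, (Y, P, Q)) \<in> hom (two_Eq C) (X, R, S) (Y, P, Q)" using Fh F by simp
  fix t a b assume ab: "a \<in> hom C t X" "b \<in> hom C t X"
  have t: "t \<in> Obj C" using ab(1) by (rule hom_Obj)
  show "rel_mem C R a b \<longleftrightarrow> rel_mem C P (f \<cdot> a) (f \<cdot> b)"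
    using bspec[OF bspec[OF bspec[OF inv(1)[unfolded is_inverse_image_def fX] t] ab(1)] ab(2)] .
  show "rel_mem C S a b \<longleftrightarrow> rel_mem C Q (f \<cdot> a) (f \<cdot> b)"
    using bspec[OF bspec[OF bspec[OF inv(2)[unfolded is_inverse_image_def fX] t] ab(1)] ab(2)] .
qed

lemma fibrationE:
  assumes "F \<in> fibrations C"
  obtains X R S f Y P Q where "F = ((X, R, S), f, (Y, P, Q))"
  using assms by (auto simp: fibrations_def)

text \<open>If \<open>f\<close> is the coequalizer of two arrows of \<open>C\<close>, then in \<open>two_Eq C\<close> it is the coequalizer of
  the same arrows with discrete domain. The factorization of a compatible arrow is compatible,
  because related elements of \<open>Y\<close> lift locally to related elements of \<open>X\<close>.\<close>

lemma fibrationI: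
  assumes f: "cover f X Y" and eq: "equiv_rel C X R" "equiv_rel C X S" "equiv_rel C Y P" "equiv_rel C Y Q"
    and RP: "\<And>t a b. a \<in> hom C t X \<Longrightarrow> b \<in> hom C t X \<Longrightarrow> rel_mem C R a b \<longleftrightarrow> rel_mem C P (f \<cdot> a) (f \<cdot> b)"
    and SQ: "\<And>t a b. a \<in> hom C t X \<Longrightarrow> b \<in> hom C t X \<Longrightarrow> rel_mem C S a b \<longleftrightarrow> rel_mem C Q (f \<cdot> a) (f \<cdot> b)"
  shows "((X, R, S), f, (Y, P, Q)) \<in> fibrations C"
proof -
  interpret T: category "two_Eq C" by (rule category_two_Eq)
  have fh: "f \<in> hom C X Y" using f by simp
  let ?F = "((X, R, S), f, (Y, P, Q))"
  have F: "?F \<in> hom (two_Eq C) (X, R, S) (Y, P, Q)" by (rule two_Eq_homI[OF fh eq]) (use RP SQ in auto)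
  obtain A a b where ab: "a \<in> hom C A X" "b \<in> hom C A X" "f \<cdot> a = f \<cdot> b"
    and un: "\<And>Y' k. k \<in> hom C X Y' \<Longrightarrow> k \<cdot> a = k \<cdot> b \<Longrightarrow> \<exists>!u. u \<in> hom C Y Y' \<and> u \<cdot> f = k"
    using f by (rule coverE) blast
  let ?D = "(A, diag C A, diag C A)"
  have "is_coequalizer (two_Eq C) (?D, a, (X, R, S)) (?D, b, (X, R, S)) ?F"
  proof (rule T.coequalizerI[OF discrete_hom[OF ab(1) eq(1,2)] discrete_hom[OF ab(2) eq(1,2)] F])
    show "Comp (two_Eq C) ?F (?D, a, (X, R, S)) = Comp (two_Eq C) ?F (?D, b, (X, R, S))" using ab(3) by simp
    fix Z :: "('o, 'm) obj2"
    obtain Z0 M N where Z: "Z = (Z0, M, N)" by (cases Z)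
    show "\<exists>u \<in> hom (two_Eq C) (Y, P, Q) Z. Comp (two_Eq C) u ?F = k"
      if k: "k \<in> hom (two_Eq C) (X, R, S) Z" "Comp (two_Eq C) k (?D, a, (X, R, S)) = Comp (two_Eq C) k (?D, b,
          (X, R, S))" for k
    proof -
      obtain k0 where k0: "k = ((X, R, S), k0, (Z0, M, N))" using k(1) Z by (auto simp: two_Eq_hom_iff)
      note k' = two_Eq_homE[OF k(1)[unfolded k0 Z]]
      have "k0 \<cdot> a = k0 \<cdot> b" using k(2) k0 by simp
      then obtain u where u: "u \<in> hom C Y Z0" "u \<cdot> f = k0" using un[OF k'(1)] by blast
      \<comment> \<open>related elements of \<open>Y\<close> lift, over a cover, to related elements of \<open>X\<close>\<close>
      have mem: "rel_mem C M' (u \<cdot> x) (u \<cdot> y)"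
        if x: "x \<in> hom C t Y" "y \<in> hom C t Y" "rel_mem C P' x y" and M': "is_rel C Z0 M'"
            and P': "is_rel C Y P'"
          and R': "\<And>t a b. a \<in> hom C t X \<Longrightarrow> b \<in> hom C t X \<Longrightarrow> rel_mem C P' (f \<cdot> a) (f \<cdot> b) \<Longrightarrow>
              rel_mem C M' (k0 \<cdot> a) (k0 \<cdot> b)"
        for t x y P' M'
      proof -
        obtain t1 c1 x1 where 1: "cover c1 t1 t" "x1 \<in> hom C t1 X" "f \<cdot> x1 = x \<cdot> c1"
            by (rule cover_lift[OF f x(1)])
        have c1: "c1 \<in> hom C t1 t" using 1 by simp
        obtain t2 c2 y2 where 2: "cover c2 t2 t1" "y2 \<in> hom C t2 X" "f \<cdot> y2 = (y \<cdot> c1) \<cdot> c2"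
          by (rule cover_lift[OF f comp_in_hom[OF c1 x(2)]])
        have c2: "c2 \<in> hom C t2 t1" using 2 by simp
        have x2: "x1 \<cdot> c2 \<in> hom C t2 X" using c2 1(2) by (rule comp_in_hom)
        have fx2: "f \<cdot> (x1 \<cdot> c2) = (x \<cdot> c1) \<cdot> c2" by (rule comp_eq_comp[OF 1(3) c2 1(2) fh])
        have "rel_mem C P' ((x \<cdot> c1) \<cdot> c2) ((y \<cdot> c1) \<cdot> c2)"
          by (rule rel_mem_comp[OF P' rel_mem_comp[OF P' x(3,1) c1] comp_in_hom[OF c1 x(1)] c2])
        then have "rel_mem C M' (k0 \<cdot> (x1 \<cdot> c2)) (k0 \<cdot> y2)" using R'[OF x2 2(2)] fx2 2(3) by simp
        moreover have "k0 \<cdot> (x1 \<cdot> c2) = u \<cdot> ((x \<cdot> c1) \<cdot> c2)" "k0 \<cdot> y2 = u \<cdot> ((y \<cdot> c1) \<cdot> c2)"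
          using comp_eq_comp[OF u(2) x2 fh u(1)] comp_eq_comp[OF u(2) 2(2) fh u(1)] fx2 2(3) by auto
        moreover have "u \<cdot> ((w \<cdot> c1) \<cdot> c2) = ((u \<cdot> w) \<cdot> c1) \<cdot> c2" if "w \<in> hom C t Y" for w
          using comp_assoc_hom[OF u(1) comp_in_hom[OF c1 that] c2] comp_assoc_hom[OF u(1) that c1] by simp
        ultimately have m: "rel_mem C M' (((u \<cdot> x) \<cdot> c1) \<cdot> c2) (((u \<cdot> y) \<cdot> c1) \<cdot> c2)" using x by simp
        note ux = comp_in_hom[OF x(1) u(1)] and uy = comp_in_hom[OF x(2) u(1)]
        show ?thesis
          by (rule cover_rel_mem[OF M' 1(1) ux uy cover_rel_mem[OF M' 2(1) comp_in_hom[OF c1 ux]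
              comp_in_hom[OF c1 uy] m]])
      qed
      have "((Y, P, Q), u, (Z0, M, N)) \<in> hom (two_Eq C) (Y, P, Q) (Z0, M, N)"
      proof (rule two_Eq_homI[OF u(1) eq(3,4) k'(4,5)])
        fix t x y assume x: "x \<in> hom C t Y" "y \<in> hom C t Y"
        show "rel_mem C M (u \<cdot> x) (u \<cdot> y)" if "rel_mem C P x y"
          by (rule mem[OF x that equiv_rel_is_rel[OF k'(4)] equiv_rel_is_rel[OF eq(3)]]) (use RP k'(6) in blast)
        show "rel_mem C N (u \<cdot> x) (u \<cdot> y)" if "rel_mem C Q x y"
          by (rule mem[OF x that equiv_rel_is_rel[OF k'(5)] equiv_rel_is_rel[OF eq(4)]]) (use SQ k'(7) in blast)
      qed
      then show ?thesis using u(2) k0 Z by (intro bexI[of _ "((Y, P, Q), u, (Z0, M, N))"]) auto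
    qed
    show "u = v" if u: "u \<in> hom (two_Eq C) (Y, P, Q) Z" and v: "v \<in> hom (two_Eq C) (Y, P, Q) Z"
      and e: "Comp (two_Eq C) u ?F = Comp (two_Eq C) v ?F" for u v
    proof -
      obtain u0 v0 where uv: "u = ((Y, P, Q), u0, Z)" "v = ((Y, P, Q), v0, Z)" "u0 \<in> hom C Y Z0"
          "v0 \<in> hom C Y Z0"
        using u v Z by (auto simp: two_Eq_hom_iff)
      then have "u0 \<cdot> f = v0 \<cdot> f" using e Z by simp
      then show ?thesis using cover_epi[OF f uv(3,4)] uv by simp
    qed
  qed
  then have "regular_epi (two_Eq C) ?F" unfolding regular_epi_def by blast
  moreover have "is_inverse_image C f P R" "is_inverse_image C f Q S"
    using RP SQ fh by (auto simp: is_inverse_image_def hom_iff)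
  ultimately show ?thesis unfolding fibrations_def by blast
qed

lemma two_Eq_pullback_base:
  assumes pb: "is_pullback (two_Eq C) F G P Q"
    and F: "F = ((E, RE, SE), p, (B, RB, SB))" and G: "G = ((A, RA, SA), u, (B, RB, SB))"
    and P: "P = ((A', R', S'), u', (E, RE, SE))" and Q: "Q = ((A', R', S'), q, (A, RA, SA))"
  shows "is_pullback C p u u' q"
proof -
  interpret T: category "two_Eq C" by (rule category_two_Eq)
  have h: "F \<in> hom (two_Eq C) (E, RE, SE) (B, RB, SB)" "G \<in> hom (two_Eq C) (A, RA, SA) (B, RB, SB)"
    "P \<in> hom (two_Eq C) (A', R', S') (E, RE, SE)" "Q \<in> hom (two_Eq C) (A', R', S') (A, RA, SA)"
    "Comp (two_Eq C) F P = Comp (two_Eq C) G Q"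
    using pb F G P Q by (auto simp: is_pullback_def hom_def)
  note f = two_Eq_homE[OF h(1)[unfolded F]] and g = two_Eq_homE[OF h(2)[unfolded G]]
    and p = two_Eq_homE[OF h(3)[unfolded P]] and q = two_Eq_homE[OF h(4)[unfolded Q]]
  show ?thesis
  proof (rule is_pullbackI[OF f(1) g(1) p(1) q(1)])
    show "p \<cdot> u' = u \<cdot> q" using h(5) F G P Q by simp
    fix t a b assume a: "a \<in> hom C t E" and b: "b \<in> hom C t A" and eq: "p \<cdot> a = u \<cdot> b"
    let ?D = "(t, diag C t, diag C t)"
    note ah = discrete_hom[OF a f(2,3)] and bh = discrete_hom[OF b g(2,3)]
    have "Comp (two_Eq C) F (?D, a, (E, RE, SE)) = Comp (two_Eq C) G (?D, b, (A, RA, SA))" using eq F G by simp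
    then obtain w where w: "w \<in> hom (two_Eq C) ?D (A', R', S')" "Comp (two_Eq C) P w = (?D, a, (E, RE, SE))"
      "Comp (two_Eq C) Q w = (?D, b, (A, RA, SA))"
      by (rule T.is_pullback_ex[OF pb h(1,2,3) ah bh])
    obtain w0 where w0: "w = (?D, w0, (A', R', S'))" "w0 \<in> hom C t A'" using w(1) by (auto simp: two_Eq_hom_iff)
    have "w1 = w0" if w1: "w1 \<in> hom C t A'" "u' \<cdot> w1 = a" "q \<cdot> w1 = b" for w1
    proof -
      have "(?D, w1, (A', R', S')) = w"
        by (rule T.is_pullback_eqD[OF pb h(1,2,3) discrete_hom[OF w1(1) p(2,3)] w(1)])
            (use w(2,3) w1(2,3) P Q in simp_all)
      then show ?thesis using w0 by simp
    qed
    moreover have "u' \<cdot> w0 = a" "q \<cdot> w0 = b" using w(2,3) unfolding w0(1) P Q by simp_all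
    ultimately show "\<exists>!w. w \<in> hom C t A' \<and> u' \<cdot> w = a \<and> q \<cdot> w = b"
      using w0(2) by blast
  qed
qed

text \<open>The inverse images of \<open>RA\<close> and \<open>SA\<close> along \<open>q\<close> make \<open>A'\<close> into another object over the cospan:
  compatibility of \<open>u'\<close> with them uses that \<open>RE\<close> and \<open>SE\<close> are inverse images along the fibration.
  The induced arrow into the pullback is the identity of \<open>A'\<close>, so the relations of the pullback
  contain these inverse images.\<close>

lemma two_Eq_pullback_fibration_rel:
  assumes pb: "is_pullback (two_Eq C) F G P Q" and fib: "F \<in> fibrations C"
    and F: "F = ((E, RE, SE), p, (B, RB, SB))" and G: "G = ((A, RA, SA), u, (B, RB, SB))"
    and P: "P = ((A', R', S'), u', (E, RE, SE))" and Q: "Q = ((A', R', S'), q, (A, RA, SA))"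
    and ab: "a \<in> hom C t A'" "b \<in> hom C t A'"
  shows "rel_mem C RA (q \<cdot> a) (q \<cdot> b) \<Longrightarrow> rel_mem C R' a b" "rel_mem C SA (q \<cdot> a) (q \<cdot> b) \<Longrightarrow> rel_mem C S' a b"
proof -
  interpret T: category "two_Eq C" by (rule category_two_Eq)
  have h: "F \<in> hom (two_Eq C) (E, RE, SE) (B, RB, SB)" "G \<in> hom (two_Eq C) (A, RA, SA) (B, RB, SB)"
    "P \<in> hom (two_Eq C) (A', R', S') (E, RE, SE)" "Q \<in> hom (two_Eq C) (A', R', S') (A, RA, SA)"
    "Comp (two_Eq C) F P = Comp (two_Eq C) G Q"
    using pb F G P Q by (auto simp: is_pullback_def hom_def)
  note f = two_Eq_homE[OF h(1)[unfolded F]] and g = two_Eq_homE[OF h(2)[unfolded G]]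
    and p = two_Eq_homE[OF h(3)[unfolded P]] and q = two_Eq_homE[OF h(4)[unfolded Q]]
  have pbC: "is_pullback C p u u' q" by (rule two_Eq_pullback_base[OF pb F G P Q])
  have sq: "p \<cdot> u' = u \<cdot> q" using h(5) F G P Q by simp
  have finv: "rel_mem C RE a b \<longleftrightarrow> rel_mem C RB (p \<cdot> a) (p \<cdot> b)" "rel_mem C SE a b \<longleftrightarrow> rel_mem C SB (p \<cdot> a) (p \<cdot> b)"
    if "a \<in> hom C t E" "b \<in> hom C t E" for t a b
    using fibrationD(3,4)[OF fib[unfolded F] that] by auto
  obtain R1 where R1e: "equiv_rel C A' R1"
    and R1: "\<forall>t. \<forall>a \<in> hom C t A'. \<forall>b \<in> hom C t A'. rel_mem C R1 a b \<longleftrightarrow> rel_mem C RA (q \<cdot> a) (q \<cdot> b)"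
    using inverse_image_equiv_ex[OF q(1) g(2)] by blast
  obtain S1 where S1e: "equiv_rel C A' S1"
    and S1: "\<forall>t. \<forall>a \<in> hom C t A'. \<forall>b \<in> hom C t A'. rel_mem C S1 a b \<longleftrightarrow> rel_mem C SA (q \<cdot> a) (q \<cdot> b)"
    using inverse_image_equiv_ex[OF q(1) g(3)] by blast
  let ?N = "(A', R1, S1)"
  have q1: "(?N, q, (A, RA, SA)) \<in> hom (two_Eq C) ?N (A, RA, SA)"
    by (rule two_Eq_homI[OF q(1) R1e S1e g(2,3)]) (use R1 S1 in blast)+
  have u1: "(?N, u', (E, RE, SE)) \<in> hom (two_Eq C) ?N (E, RE, SE)"
  proof (rule two_Eq_homI[OF p(1) R1e S1e f(2,3)])
    fix t a b assume a: "a \<in> hom C t A'" and b: "b \<in> hom C t A'"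
    note ua = comp_in_hom[OF a p(1)] comp_in_hom[OF b p(1)]
        and qa = comp_in_hom[OF a q(1)] comp_in_hom[OF b q(1)]
    have e: "p \<cdot> (u' \<cdot> a) = u \<cdot> (q \<cdot> a)" "p \<cdot> (u' \<cdot> b) = u \<cdot> (q \<cdot> b)"
      using square_comp[OF sq _ p(1) f(1) q(1) g(1)] a b by auto
    show "rel_mem C RE (u' \<cdot> a) (u' \<cdot> b)" if "rel_mem C R1 a b"
      using that R1 a b finv(1)[OF ua] e g(6)[OF qa(1)] by auto
    show "rel_mem C SE (u' \<cdot> a) (u' \<cdot> b)" if "rel_mem C S1 a b"
      using that S1 a b finv(2)[OF ua] e g(7)[OF qa(1)] by auto
  qed
  have "Comp (two_Eq C) F (?N, u', (E, RE, SE)) = Comp (two_Eq C) G (?N, q, (A, RA, SA))" using sq F G by simp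
  then obtain w where w: "w \<in> hom (two_Eq C) ?N (A', R', S')" "Comp (two_Eq C) P w = (?N, u', (E, RE, SE))"
    "Comp (two_Eq C) Q w = (?N, q, (A, RA, SA))"
    by (rule T.is_pullback_ex[OF pb h(1,2,3) u1 q1])
  obtain w0 where w0: "w = (?N, w0, (A', R', S'))" using w(1) by (auto simp: two_Eq_hom_iff)
  note w' = two_Eq_homE[OF w(1)[unfolded w0]]
  have A': "A' \<in> Obj C" using p(1) by (rule hom_Obj)
  have "w0 = Ide C A'"
    by (rule is_pullback_eqD[OF pbC f(1) g(1) p(1) w'(1) Ide_hom[OF A']])
      (use w w0 P Q Comp_Ide[OF p(1)] Comp_Ide[OF q(1)] in auto)
  then have id: "w0 \<cdot> a = a" "w0 \<cdot> b = b" using ab by (auto simp: Ide_Comp)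
  show "rel_mem C R' a b" if "rel_mem C RA (q \<cdot> a) (q \<cdot> b)" using w'(6)[OF ab(1), of b] R1 ab that id by auto
  show "rel_mem C S' a b" if "rel_mem C SA (q \<cdot> a) (q \<cdot> b)" using w'(7)[OF ab(1), of b] S1 ab that id by auto
qed

end

section \<open>Central extensions\<close>

context regular_maltsev_cat
begin

lemma fibrations_Arr: "fibrations C \<subseteq> Arr (two_Eq C)"
proof
  fix F assume F: "F \<in> fibrations C"
  then obtain X R S f Y P Q where e: "F = ((X, R, S), f, (Y, P, Q))" by (rule fibrationE)
  show "F \<in> Arr (two_Eq C)" using fibrationD(1)[OF F[unfolded e]] e by (simp add: hom_def)
qed

lemma kernel_pair_facts:
  assumes "f \<in> hom C X Y"
  shows "equiv_rel C X (kernel_pair C f)"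
    "\<And>t a b. a \<in> hom C t X \<Longrightarrow> b \<in> hom C t X \<Longrightarrow> rel_mem C (kernel_pair C f) a b \<longleftrightarrow> f \<cdot> a = f \<cdot> b"
  using is_kernel_pair_kernel_pair[OF assms] kernel_pair_reflexive[OF _ assms] kernel_pair_mem[OF _ assms]
    reflexive_equiv_rel by blast+

lemma fibration_kernel_le:
  assumes "((X, R, S), f, (Y, P, Q)) \<in> fibrations C" "a \<in> hom C t X" "b \<in> hom C t X" "f \<cdot> a = f \<cdot> b"
  shows "rel_mem C R a b" "rel_mem C S a b"
proof -
  note F = fibrationD[OF assms(1)] and F' = two_Eq_homE[OF fibrationD(1)[OF assms(1)]]
  have fb: "f \<cdot> b \<in> hom C t Y" using assms(3) F'(1) by (rule comp_in_hom)
  show "rel_mem C R a b" "rel_mem C S a b"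
    using F(3)[OF assms(2,3)] F(4)[OF assms(2,3)] assms(4)
      reflexive_rel_mem[OF equiv_rel_reflexive[OF F'(4)] fb] reflexive_rel_mem[OF equiv_rel_reflexive[OF F'(5)]
          fb] by simp_all
qed

text \<open>After pulling back along \<open>p\<close>, the extension becomes a trivial extension, so that its domain
  \<open>A\<close> is a pullback of its reflection \<open>I\<close>. The relations of \<open>I\<close> centralize each other, and the
  kernel pair of the trivial extension is contained in both relations of \<open>A\<close> and collapsed by the
  trivial extension. Hence it centralizes each of them, by \<open>centralize_pullback\<close>, and this
  descends along \<open>A \<rightarrow> X\<close>.\<close>

lemma central_extension_centralizes:
  assumes "((X, R, S), f, (Y, P, Q)) \<in> CExt C"
  shows "centralize C X (kernel_pair C f) R" "centralize C X (kernel_pair C f) S"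
proof -
  let ?F = "((X, R, S), f, (Y, P, Q))"
  obtain p u q where cen: "?F \<in> fibrations C" "p \<in> fibrations C" "is_pullback (two_Eq C) p ?F u q"
    "trivial_extension (two_Eq C) (Conn C) (fibrations C) u"
    using assms unfolding CExt_def central_extension_def monadic_extension_def by blast
  obtain e e' v where triv: "u \<in> fibrations C" "is_reflection_unit (two_Eq C) (Conn C) (Dom (two_Eq C) u) e"
    "is_reflection_unit (two_Eq C) (Conn C) (Cod (two_Eq C) u) e'"
    "v \<in> hom (two_Eq C) (Cod (two_Eq C) e) (Cod (two_Eq C) e')" "is_pullback (two_Eq C) v e' e u"
    using cen(4) unfolding trivial_extension_def by blast
  obtain E RE SE p0 B RB SB where p0: "p = ((E, RE, SE), p0, (B, RB, SB))" using cen(2) by (rule fibrationE)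
  obtain A R' S' u0 E' RE' SE' where u0: "u = ((A, R', S'), u0, (E', RE', SE'))" using triv(1)
      by (rule fibrationE)
  have "Cod (two_Eq C) p = Cod (two_Eq C) ?F" "Cod (two_Eq C) u = Dom (two_Eq C) p"
    "q \<in> hom (two_Eq C) (Dom (two_Eq C) u) (X, R, S)"
    using cen(3) unfolding is_pullback_def hom_def[of "two_Eq C"] by auto
  then have eqs: "(B, RB, SB) = (Y, P, Q)" "(E', RE', SE') = (E, RE, SE)"
    and q: "q \<in> hom (two_Eq C) (A, R', S') (X, R, S)" using p0 u0 by auto
  note p1 = p0[unfolded eqs(1)] and u1 = u0[unfolded eqs(2)]
  obtain q0 where q0: "q = ((A, R', S'), q0, (X, R, S))" using q by (auto simp: two_Eq_hom_iff)
  obtain I RI SI where I: "Cod (two_Eq C) e = (I, RI, SI)" by (cases "Cod (two_Eq C) e")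
  obtain I' RI' SI' where I': "Cod (two_Eq C) e' = (I', RI', SI')" by (cases "Cod (two_Eq C) e'")
  have eh: "e \<in> hom (two_Eq C) (A, R', S') (I, RI, SI)"
      and eh': "e' \<in> hom (two_Eq C) (E, RE, SE) (I', RI', SI')"
    and cI: "(I, RI, SI) \<in> Conn C"
    using triv(2,3) I I' u1 unfolding is_reflection_unit_def by auto
  obtain e0 where e0: "e = ((A, R', S'), e0, (I, RI, SI))" using eh by (auto simp: two_Eq_hom_iff)
  obtain e0' where e0': "e' = ((E, RE, SE), e0', (I', RI', SI'))" using eh' by (auto simp: two_Eq_hom_iff)
  obtain v0 where v0: "v = ((I, RI, SI), v0, (I', RI', SI'))" using triv(4) I I' by (auto simp: two_Eq_hom_iff)
  note eC = two_Eq_homE[OF eh[unfolded e0]] and eC' = two_Eq_homE[OF eh'[unfolded e0']]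
    and vC = two_Eq_homE[OF triv(4)[unfolded I I' v0]] and qC = two_Eq_homE[OF q[unfolded q0]]
    and uC = two_Eq_homE[OF fibrationD(1)[OF triv(1)[unfolded u1]]]
    and FC = two_Eq_homE[OF fibrationD(1)[OF cen(1)]]
    and pC = two_Eq_homE[OF fibrationD(1)[OF cen(2)[unfolded p1]]]
  have cIr: "centralize C I RI SI" using cI by (simp add: Conn_def)
  have pbv: "is_pullback C v0 e0' e0 u0" by (rule two_Eq_pullback_base[OF triv(5) v0 e0' e0 u1])
  have pbp: "is_pullback C p0 f u0 q0" by (rule two_Eq_pullback_base[OF cen(3) p1 refl u1 q0])
  have qc: "cover q0 A X" by (rule pullback_cover_snd[OF pbp fibrationD(2)[OF cen(2)[unfolded p1]] FC(1) uC(1)])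
  have sq: "p0 \<cdot> u0 = f \<cdot> q0" by (rule is_pullback_hom(3)[OF pbp pC(1) FC(1)])
  let ?K' = "kernel_pair C u0" and ?K = "kernel_pair C f"
  note K' = kernel_pair_facts[OF uC(1)] and K = kernel_pair_facts[OF FC(1)]
  have K'le: "rel_mem C R' a b" "rel_mem C S' a b"
    if "a \<in> hom C t A" "b \<in> hom C t A" "rel_mem C ?K' a b" for t a b
    using fibration_kernel_le[OF triv(1)[unfolded u1] that(1,2)] K'(2)[OF that(1,2)] that(3) by auto
  have S'K': "centralize C A S' ?K'"
    by (rule centralize_pullback[OF equiv_rel_reflexive[OF eC(5)] equiv_rel_reflexive[OF eC(4)]
          centralize_sym[OF eC(4,5) cIr] vC(1) eC'(1) eC(1) uC(1) pbv equiv_rel_reflexive[OF eC(3)]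
              equiv_rel_reflexive[OF K'(1)]])
      (use eC(6,7) K'le K'(2) in blast)+
  have R'K': "centralize C A R' ?K'"
    by (rule centralize_pullback[OF equiv_rel_reflexive[OF eC(4)] equiv_rel_reflexive[OF eC(5)]
          cIr vC(1) eC'(1) eC(1) uC(1) pbv equiv_rel_reflexive[OF eC(2)] equiv_rel_reflexive[OF K'(1)]])
      (use eC(6,7) K'le K'(2) in blast)+
  have liftK: "\<exists>t' c x'. cover c t' t \<and> x' \<in> hom C t' A \<and> q0 \<cdot> x' = x \<cdot> c \<and> rel_mem C ?K' x' (y \<cdot> c)"
    if y: "y \<in> hom C t A" and x: "x \<in> hom C t X" and m: "rel_mem C ?K x (q0 \<cdot> y)" for t y x
  proof -
    have "f \<cdot> x = f \<cdot> (q0 \<cdot> y)" using K(2)[OF x comp_in_hom[OF y qC(1)]] m by simp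
    then have e: "p0 \<cdot> (u0 \<cdot> y) = f \<cdot> x" using square_comp[OF sq y uC(1) pC(1) qC(1) FC(1)] by simp
    obtain x' where x': "x' \<in> hom C t A" "u0 \<cdot> x' = u0 \<cdot> y" "q0 \<cdot> x' = x"
      by (rule is_pullback_ex[OF pbp pC(1) FC(1) uC(1) comp_in_hom[OF y uC(1)] x e])
    then show ?thesis using cover_Ide[OF hom_Obj(1)[OF y]] Comp_Ide[OF x] Comp_Ide[OF y] K'(2)[OF x'(1) y]
      by (intro exI[of _ t] exI[of _ "Ide C t"] exI[of _ x']) simp
  qed
  have down: "centralize C X ?K W"
    if W: "is_rel C X W" and W': "equiv_rel C A W'" and c: "centralize C A W' ?K'"
    and inv: "\<And>t a b. a \<in> hom C t A \<Longrightarrow> b \<in> hom C t A \<Longrightarrow> rel_mem C W (q0 \<cdot> a) (q0 \<cdot> b) \<Longrightarrow> rel_mem C W' a b"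
    for W W'
    by (rule centralize_descent[OF qc equiv_rel_reflexive[OF K'(1)] equiv_rel_reflexive[OF W']
          centralize_sym[OF W' K'(1) c] equiv_rel_is_rel[OF K(1)] W liftK inverse_image_lift[OF qc W inv]])
  note inv = two_Eq_pullback_fibration_rel[OF cen(3,2) p1 refl u1 q0]
  show "centralize C X ?K R" by (rule down[OF equiv_rel_is_rel[OF FC(2)] uC(2) R'K' inv(1)])
  show "centralize C X ?K S" by (rule down[OF equiv_rel_is_rel[OF FC(3)] uC(3) S'K' inv(2)])
qed

text \<open>Probing with the identity of a discrete pair: its arrows into an extension correspond to the
  generalized elements of the domain of that extension.\<close>

lemma Ext_pullback_top:
  assumes pb: "is_pullback (Ext (two_Eq C) (fibrations C)) (e, (p1, p0), h) (f, (g, j), h) (f', (u1, u0), e)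
      (f', (q1, q0), f)"
    and p1: "p1 = ((E, RE, SE), p, (Z, RZ, SZ))" and g: "g = ((X, R, S), g1, (Z, RZ, SZ))"
    and u1: "u1 = ((X', R', S'), u, (E, RE, SE))" and q1: "q1 = ((X', R', S'), q, (X, R, S))"
  shows "is_pullback C p g1 u q"
proof -
  interpret T: category "two_Eq C" by (rule category_two_Eq)
  let ?E = "Ext (two_Eq C) (fibrations C)"
  interpret E: category ?E by (rule category_Ext[OF category_two_Eq fibrations_Arr])
  have h: "(e, (p1, p0), h) \<in> hom ?E e h" "(f, (g, j), h) \<in> hom ?E f h"
    "(f', (u1, u0), e) \<in> hom ?E f' e" "(f', (q1, q0), f) \<in> hom ?E f' f"
    "Comp ?E (e, (p1, p0), h) (f', (u1, u0), e) = Comp ?E (f, (g, j), h) (f', (q1, q0), f)"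
    using pb unfolding is_pullback_def hom_def[of ?E] by auto
  note he = Ext_homD[OF h(1)] and hf = Ext_homD[OF h(2)] and hu' = Ext_homD[OF h(3)] and hq' = Ext_homD[OF h(4)]
  have tops: "Comp (two_Eq C) p1 u1 = Comp (two_Eq C) g q1" using h(5) by simp
  note fib = he(1) hf(1) hu'(1) he(2) and hp = he(3) and hg = hf(3) and hu = hu'(3) and hq = hq'(3)
    and sq = he(5) hf(5) hu'(5) hq'(5) and p0h = he(4) and jh = hf(4) and u0h = hu'(4) and q0h = hq'(4)
  have dom: "Dom (two_Eq C) e = (E, RE, SE)" "Dom (two_Eq C) f = (X, R, S)" "Dom (two_Eq C) f' = (X', R', S')"
      "Dom (two_Eq C) h = (Z, RZ, SZ)"
    using hp hg hu hq p1 g u1 q1 unfolding hom_def[of "two_Eq C"] by auto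
  note pC = two_Eq_homE[OF hp[unfolded dom p1]] and gC = two_Eq_homE[OF hg[unfolded dom g]]
    and uC = two_Eq_homE[OF hu[unfolded dom u1]] and qC = two_Eq_homE[OF hq[unfolded dom q1]]
  have arr: "k \<in> hom (two_Eq C) (Dom (two_Eq C) k) (Cod (two_Eq C) k)" if "k \<in> fibrations C" for k
    using that fibrations_Arr by (auto simp: hom_def)
  \<comment> \<open>a generalized element \<open>a\<close> of the top object of \<open>k\<close> is an arrow to \<open>k\<close> from the identity of a discrete
      object\<close>
  define D where "D = (\<lambda>t. (t, diag C t, diag C t))"
  define i where "i = (\<lambda>t. (D t, Ide C t, D t))"
  have ifib: "i t \<in> fibrations C" if "t \<in> Obj C" for t
    unfolding i_def D_def
    by (rule fibrationI[OF cover_Ide[OF that]]) (use that in \<open>auto simp: equiv_rel_diag Ide_Comp\<close>)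
  have iD: "Dom (two_Eq C) (i t) = D t" "Cod (two_Eq C) (i t) = D t" for t by (simp_all add: i_def)
  have el: "(i t, (A, Comp (two_Eq C) k A), k) \<in> hom ?E (i t) k"
    if "k \<in> fibrations C" "A \<in> hom (two_Eq C) (D t) (Dom (two_Eq C) k)" "t \<in> Obj C" for k A t
  proof -
    have kA: "Comp (two_Eq C) k A \<in> hom (two_Eq C) (D t) (Cod (two_Eq C) k)" using that(2) arr[OF that(1)]
        by (rule T.comp_in_hom)
    have "i t = Ide (two_Eq C) (D t)" by (simp add: i_def D_def)
    then have "Comp (two_Eq C) (Comp (two_Eq C) k A) (i t) = Comp (two_Eq C) k A" using T.Comp_Ide[OF kA]
        by simp
    then show ?thesis by (intro Ext_homI) (simp_all only: iD that ifib kA)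
  qed
  show ?thesis
  proof (rule is_pullbackI[OF pC(1) gC(1) uC(1) qC(1)])
    show "p \<cdot> u = g1 \<cdot> q" using tops p1 g u1 q1 by simp
    fix t a b assume a: "a \<in> hom C t E" and b: "b \<in> hom C t X" and eq: "p \<cdot> a = g1 \<cdot> b"
    have t: "t \<in> Obj C" using a by (rule hom_Obj)
    define A where "A = (D t, a, (E, RE, SE))"
    define B where "B = (D t, b, (X, R, S))"
    have Ah: "A \<in> hom (two_Eq C) (D t) (Dom (two_Eq C) e)" unfolding A_def D_def dom
        by (rule discrete_hom[OF a pC(2,3)])
    have Bh: "B \<in> hom (two_Eq C) (D t) (Dom (two_Eq C) f)" unfolding B_def D_def dom
        by (rule discrete_hom[OF b gC(2,3)])
    let ?a = "(i t, (A, Comp (two_Eq C) e A), e)" and ?b = "(i t, (B, Comp (two_Eq C) f B), f)"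
    have pA: "Comp (two_Eq C) p1 A = Comp (two_Eq C) g B" using eq by (simp add: A_def B_def p1 g)
    have "Comp (two_Eq C) p0 (Comp (two_Eq C) e A) = Comp (two_Eq C) h (Comp (two_Eq C) p1 A)"
      by (rule T.square_comp[OF sq(1)[symmetric] Ah arr[OF fib(1)] p0h hp arr[OF fib(4)]])
    also have "\<dots> = Comp (two_Eq C) j (Comp (two_Eq C) f B)" unfolding pA
      by (rule T.square_comp[OF sq(2) Bh hg arr[OF fib(4)] arr[OF fib(2)] jh])
    finally have "Comp ?E (e, (p1, p0), h) ?a = Comp ?E (f, (g, j), h) ?b" using pA by simp
    then obtain w where w: "w \<in> hom ?E (i t) f'" "Comp ?E (f', (u1, u0), e) w = ?a"
        "Comp ?E (f', (q1, q0), f) w = ?b"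
      by (rule E.is_pullback_ex[OF pb h(1,2,3) el[OF fib(1) Ah t] el[OF fib(2) Bh t]])
    obtain W W0 where W: "w = (i t, (W, W0), f')" "W \<in> hom (two_Eq C) (D t) (X', R', S')"
      using w(1) unfolding Ext_hom_iff iD dom by blast
    obtain w0 where w0: "W = (D t, w0, (X', R', S'))" "w0 \<in> hom C t X'" using W(2)
        unfolding D_def two_Eq_hom_iff by auto
    have uq: "u \<cdot> w0 = a" "q \<cdot> w0 = b" using w(2,3) W w0 by (simp_all add: u1 q1 A_def B_def)
    have "w1 = w0" if w1: "w1 \<in> hom C t X'" "u \<cdot> w1 = a" "q \<cdot> w1 = b" for w1
    proof -
      define W1 where "W1 = (D t, w1, (X', R', S'))"
      have W1h: "W1 \<in> hom (two_Eq C) (D t) (Dom (two_Eq C) f')" unfolding W1_def D_def dom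
          by (rule discrete_hom[OF w1(1) uC(2,3)])
      let ?w = "(i t, (W1, Comp (two_Eq C) f' W1), f')"
      have t1: "Comp (two_Eq C) u1 W1 = A" "Comp (two_Eq C) q1 W1 = B" using w1
          by (simp_all add: u1 q1 W1_def A_def B_def)
      have "Comp (two_Eq C) u0 (Comp (two_Eq C) f' W1) = Comp (two_Eq C) e A"
        using T.square_comp[OF sq(3)[symmetric] W1h arr[OF fib(3)] u0h hu arr[OF fib(1)]] t1 by simp
      moreover have "Comp (two_Eq C) q0 (Comp (two_Eq C) f' W1) = Comp (two_Eq C) f B"
        using T.square_comp[OF sq(4)[symmetric] W1h arr[OF fib(3)] q0h hq arr[OF fib(2)]] t1 by simp
      ultimately have "?w = w"
        by (intro E.is_pullback_eqD[OF pb h(1,2,3) el[OF fib(3) W1h t] w(1)]) (use w(2,3) t1 in simp_all)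
      then show ?thesis using W w0 by (simp add: W1_def)
    qed
    then show "\<exists>!w. w \<in> hom C t X' \<and> u \<cdot> w = a \<and> q \<cdot> w = b" using uq w0(2) by blast
  qed
qed

end

section \<open>Double central extensions\<close>

context regular_maltsev_cat
begin

lemma double_fibrationD:
  assumes "(f, (g, j), h) \<in> double_fibrations C"
  shows "f \<in> fibrations C" "g \<in> fibrations C" "j \<in> fibrations C" "h \<in> fibrations C"
    "(f, (g, j), h) \<in> hom (Ext (two_Eq C) (fibrations C)) f h"
  using assms unfolding double_fibrations_def double_extensions_def hom_def[of "Ext _ _"]
      by (auto simp: Ext_Arr_iff)

text \<open>What the comparison condition on a double extension says on generalized elements: \<open>(f, g)\<close>
  is locally surjective onto the pullback of the codomains.\<close>

lemma double_fibration_lift: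
  assumes F: "(f, (g, j), h) \<in> double_fibrations C"
    and f: "f = ((X, R, S), f0, (Y, RY, SY))" and g: "g = ((X, R, S), g0, (Z, RZ, SZ))"
    and j: "j = ((Y, RY, SY), j0, (W, RW, SW))" and h: "h = ((Z, RZ, SZ), h0, (W, RW, SW))"
    and y: "y \<in> hom C t Y" and z: "z \<in> hom C t Z" and yz: "j0 \<cdot> y = h0 \<cdot> z"
  obtains t' c x where "cover c t' t" "x \<in> hom C t' X" "f0 \<cdot> x = y \<cdot> c" "g0 \<cdot> x = z \<cdot> c"
proof -
  note D = double_fibrationD[OF F]
  obtain p q c where pb: "is_pullback (two_Eq C) j h p q"
      and c: "c \<in> hom (two_Eq C) (Dom (two_Eq C) f) (Dom (two_Eq C) p)"
    "Comp (two_Eq C) p c = f" "Comp (two_Eq C) q c = g" "c \<in> fibrations C"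
    using F unfolding double_fibrations_def double_extensions_def by auto
  obtain V M N where V: "Dom (two_Eq C) p = (V, M, N)" by (cases "Dom (two_Eq C) p")
  have ph: "p \<in> hom (two_Eq C) (V, M, N) (Y, RY, SY)" "q \<in> hom (two_Eq C) (V, M, N) (Z, RZ, SZ)"
    using pb V j h unfolding is_pullback_def by auto
  obtain p0 where p0: "p = ((V, M, N), p0, (Y, RY, SY))" using ph(1) by (auto simp: two_Eq_hom_iff)
  obtain q0 where q0: "q = ((V, M, N), q0, (Z, RZ, SZ))" using ph(2) by (auto simp: two_Eq_hom_iff)
  have ch: "c \<in> hom (two_Eq C) (X, R, S) (V, M, N)" using c(1) V f by simp
  then obtain c0 where c0: "c = ((X, R, S), c0, (V, M, N))" by (auto simp: two_Eq_hom_iff)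
  note jC = two_Eq_homE[OF fibrationD(1)[OF D(3)[unfolded j]]]
      and hC = two_Eq_homE[OF fibrationD(1)[OF D(4)[unfolded h]]]
    and pC = two_Eq_homE[OF ph(1)[unfolded p0]] and qC = two_Eq_homE[OF ph(2)[unfolded q0]]
  have cc: "cover c0 X V" using fibrationD(2)[OF c(4)[unfolded c0]] .
  then have c0h: "c0 \<in> hom C X V" by simp
  have pc: "p0 \<cdot> c0 = f0" "q0 \<cdot> c0 = g0" using c(2,3) p0 q0 c0 f g by simp_all
  obtain v where v: "v \<in> hom C t V" "p0 \<cdot> v = y" "q0 \<cdot> v = z"
    by (rule is_pullback_ex[OF two_Eq_pullback_base[OF pb j h p0 q0] jC(1) hC(1) pC(1) y z yz])
  obtain t' d x where d: "cover d t' t" "x \<in> hom C t' X" "c0 \<cdot> x = v \<cdot> d" by (rule cover_lift[OF cc v(1)])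
  have dh: "d \<in> hom C t' t" using d by simp
  have "f0 \<cdot> x = y \<cdot> d" using comp_eq_comp[OF pc(1) d(2) c0h pC(1)] d(3) comp_eq_comp[OF v(2) dh v(1) pC(1)]
      by simp
  moreover have "g0 \<cdot> x = z \<cdot> d" using comp_eq_comp[OF pc(2) d(2) c0h qC(1)]
      d(3) comp_eq_comp[OF v(3) dh v(1) qC(1)] by simp
  ultimately show ?thesis using that d by blast
qed

text \<open>The expected pullback is the comparison \<open>r\<close> from the pullback \<open>X'\<close> of the domains to the
  pullback \<open>Q\<close> of the codomains, with inverse image relations on both. Because \<open>(p1, p0)\<close> is a
  double extension, \<open>r\<close> is a regular epimorphism and so a fibration. The arrow it induces into the
  given pullback is the identity on \<open>X'\<close>; this bounds the relations of \<open>X'\<close> from below and makes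
  \<open>fX'\<close> factor through \<open>r\<close>.\<close>

lemma Ext_pullback_domain:
  assumes pb: "is_pullback (Ext (two_Eq C) (fibrations C)) (e, (p1, p0), h) (f, (g, j), h) (f', (u1, u0), e)
      (f', (q1, q0), f)"
    and dp: "(e, (p1, p0), h) \<in> double_fibrations C" and du: "(f, (g, j), h) \<in> double_fibrations C"
    and e: "e = ((E, RE, SE), e', (D, RD, SD))" and h: "h = ((Z, RZ, SZ), h', (W, RW, SW))"
    and f: "f = ((X, R, S), fX, (Y, RY, SY))" and f': "f' = ((X', R', S'), fX', (Y', RY', SY'))"
    and p1: "p1 = ((E, RE, SE), p, (Z, RZ, SZ))" and p0: "p0 = ((D, RD, SD), pd, (W, RW, SW))"
    and g: "g = ((X, R, S), g', (Z, RZ, SZ))" and j: "j = ((Y, RY, SY), j', (W, RW, SW))"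
    and u1: "u1 = ((X', R', S'), u, (E, RE, SE))" and q1: "q1 = ((X', R', S'), q, (X, R, S))"
    and ab: "a \<in> hom C t X'" "b \<in> hom C t X'"
  shows "rel_mem C R (q \<cdot> a) (q \<cdot> b) \<Longrightarrow> rel_mem C R' a b"
    "rel_mem C S (q \<cdot> a) (q \<cdot> b) \<Longrightarrow> rel_mem C S' a b"
    "fX \<cdot> (q \<cdot> a) = fX \<cdot> (q \<cdot> b) \<Longrightarrow> e' \<cdot> (u \<cdot> a) = e' \<cdot> (u \<cdot> b) \<Longrightarrow> fX' \<cdot> a = fX' \<cdot> b"
proof -
  let ?E = "Ext (two_Eq C) (fibrations C)"
  interpret E: category ?E by (rule category_Ext[OF category_two_Eq fibrations_Arr])
  note dpD = double_fibrationD[OF dp] and duD = double_fibrationD[OF du]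
  have hh: "(f', (u1, u0), e) \<in> hom ?E f' e" "(f', (q1, q0), f) \<in> hom ?E f' f"
    using pb unfolding is_pullback_def hom_def[of ?E] by auto
  have f'fib: "f' \<in> fibrations C" using Ext_homD(1)[OF hh(1)] .
  have u1h: "u1 \<in> hom (two_Eq C) (X', R', S') (E, RE, SE)" and q1h: "q1 \<in> hom (two_Eq C) (X', R', S') (X, R, S)"
    using Ext_homD(3)[OF hh(1)] Ext_homD(3)[OF hh(2)] e f f' by simp_all
  note eF = fibrationD[OF dpD(1)[unfolded e]] and p1F = fibrationD[OF dpD(2)[unfolded p1]]
    and p0F = fibrationD[OF dpD(3)[unfolded p0]] and hF = fibrationD[OF dpD(4)[unfolded h]]
    and fF = fibrationD[OF duD(1)[unfolded f]] and gF = fibrationD[OF duD(2)[unfolded g]]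
        and jF = fibrationD[OF duD(3)[unfolded j]]
  note eC = two_Eq_homE[OF eF(1)] and p1C = two_Eq_homE[OF p1F(1)] and p0C = two_Eq_homE[OF p0F(1)]
      and hC = two_Eq_homE[OF hF(1)]
    and fC = two_Eq_homE[OF fF(1)] and gC = two_Eq_homE[OF gF(1)] and jC = two_Eq_homE[OF jF(1)]
    and uC = two_Eq_homE[OF u1h[unfolded u1]] and qC = two_Eq_homE[OF q1h[unfolded q1]]
  have top: "is_pullback C p g' u q" by (rule Ext_pullback_top[OF pb p1 g u1 q1])
  have sq_pe: "h' \<cdot> p = pd \<cdot> e'" using Ext_homD(5)[OF dpD(5)] by (simp add: h p1 p0 e)
  have sq_gf: "h' \<cdot> g' = j' \<cdot> fX" using Ext_homD(5)[OF duD(5)] by (simp add: h g j f)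
  have sq_top: "p \<cdot> u = g' \<cdot> q" by (rule is_pullback_hom(3)[OF top p1C(1) gC(1)])
  obtain Q \<rho> \<sigma> where pbQ: "is_pullback C pd j' \<rho> \<sigma>" and \<rho>: "\<rho> \<in> hom C Q D" and \<sigma>: "\<sigma> \<in> hom C Q Y"
      and sqQ: "pd \<cdot> \<rho> = j' \<cdot> \<sigma>"
    by (rule pullbackE[OF p0C(1) jC(1)])
  have eu: "e' \<cdot> u \<in> hom C X' D" and fq: "fX \<cdot> q \<in> hom C X' Y"
    using comp_in_hom[OF uC(1) eC(1)] comp_in_hom[OF qC(1) fC(1)] by auto
  have "pd \<cdot> (e' \<cdot> u) = h' \<cdot> (p \<cdot> u)" using square_comp[OF sq_pe uC(1) p1C(1) hC(1) eC(1) p0C(1)] by simp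
  also have "\<dots> = j' \<cdot> (fX \<cdot> q)" unfolding sq_top by (rule square_comp[OF sq_gf qC(1) gC(1) hC(1) fC(1) jC(1)])
  finally obtain r where r: "r \<in> hom C X' Q" "\<rho> \<cdot> r = e' \<cdot> u" "\<sigma> \<cdot> r = fX \<cdot> q"
    by (rule is_pullback_ex[OF pbQ p0C(1) jC(1) \<rho> eu fq])
  have \<rho>r: "\<rho> \<cdot> (r \<cdot> x) = e' \<cdot> (u \<cdot> x)" and \<sigma>r: "\<sigma> \<cdot> (r \<cdot> x) = fX \<cdot> (q \<cdot> x)" if "x \<in> hom C s X'" for s x
    using square_comp[OF r(2) that r(1) \<rho> uC(1) eC(1)] square_comp[OF r(3) that r(1) \<sigma> qC(1) fC(1)] by auto
  \<comment> \<open>lift first the coordinate in \<open>Y\<close> along \<open>fX\<close>, then the coordinate in \<open>D\<close> along the double extension\<close>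
  have rc: "cover r X' Q"
  proof -
    obtain t1 c1 x where 1: "cover c1 t1 Q" "x \<in> hom C t1 X" "fX \<cdot> x = \<sigma> \<cdot> c1" by (rule cover_lift[OF fF(2) \<sigma>])
    have c1: "c1 \<in> hom C t1 Q" using 1 by simp
    have d1: "\<rho> \<cdot> c1 \<in> hom C t1 D" and z1: "g' \<cdot> x \<in> hom C t1 Z"
        using comp_in_hom[OF c1 \<rho>] comp_in_hom[OF 1(2) gC(1)] by auto
    have "pd \<cdot> (\<rho> \<cdot> c1) = j' \<cdot> (fX \<cdot> x)" using square_comp[OF sqQ c1 \<rho> p0C(1) \<sigma> jC(1)] 1(3) by simp
    also have "\<dots> = h' \<cdot> (g' \<cdot> x)" using square_comp[OF sq_gf 1(2) gC(1) hC(1) fC(1) jC(1)] by simp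
    finally obtain t2 c2 \<epsilon> where 2: "cover c2 t2 t1" "\<epsilon> \<in> hom C t2 E" "e' \<cdot> \<epsilon> = (\<rho> \<cdot> c1) \<cdot> c2"
        "p \<cdot> \<epsilon> = (g' \<cdot> x) \<cdot> c2"
      by (rule double_fibration_lift[OF dp e p1 p0 h d1 z1])
    have c2: "c2 \<in> hom C t2 t1" using 2 by simp
    have x2: "x \<cdot> c2 \<in> hom C t2 X" using c2 1(2) by (rule comp_in_hom)
    have "p \<cdot> \<epsilon> = g' \<cdot> (x \<cdot> c2)" using 2(4) Comp_assoc[OF c2 1(2) gC(1)] by simp
    then obtain x' where x': "x' \<in> hom C t2 X'" "u \<cdot> x' = \<epsilon>" "q \<cdot> x' = x \<cdot> c2"
      by (rule is_pullback_ex[OF top p1C(1) gC(1) uC(1) 2(2) x2])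
    have c12: "c1 \<cdot> c2 \<in> hom C t2 Q" using c2 c1 by (rule comp_in_hom)
    have "r \<cdot> x' = c1 \<cdot> c2"
    proof (rule is_pullback_eqD[OF pbQ p0C(1) jC(1) \<rho> comp_in_hom[OF x'(1) r(1)] c12])
      show "\<rho> \<cdot> (r \<cdot> x') = \<rho> \<cdot> (c1 \<cdot> c2)" using \<rho>r[OF x'(1)] x'(2) 2(3) Comp_assoc[OF c2 c1 \<rho>] by simp
      show "\<sigma> \<cdot> (r \<cdot> x') = \<sigma> \<cdot> (c1 \<cdot> c2)"
        using \<sigma>r[OF x'(1)] x'(3) comp_eq_comp[OF 1(3) c2 1(2) fC(1)] Comp_assoc[OF c2 c1 \<sigma>] by simp
    qed
    then show ?thesis by (rule cover_if_factors[OF cover_comp[OF 1(1) 2(1)] r(1) x'(1)])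
  qed
  obtain RX where RX: "equiv_rel C X' RX" "\<forall>t. \<forall>a \<in> hom C t X'. \<forall>b \<in> hom C t X'. rel_mem C RX a b \<longleftrightarrow> rel_mem C R
      (q \<cdot> a) (q \<cdot> b)"
    using inverse_image_equiv_ex[OF qC(1) fC(2)] by blast
  obtain SX where SX: "equiv_rel C X' SX" "\<forall>t. \<forall>a \<in> hom C t X'. \<forall>b \<in> hom C t X'. rel_mem C SX a b \<longleftrightarrow> rel_mem C S
      (q \<cdot> a) (q \<cdot> b)"
    using inverse_image_equiv_ex[OF qC(1) fC(3)] by blast
  obtain RQ where RQ: "equiv_rel C Q RQ" "\<forall>t. \<forall>a \<in> hom C t Q. \<forall>b \<in> hom C t Q. rel_mem C RQ a b \<longleftrightarrow> rel_mem C RY (\<sigma>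
      \<cdot> a) (\<sigma> \<cdot> b)"
    using inverse_image_equiv_ex[OF \<sigma> fC(4)] by blast
  obtain SQ where SQ: "equiv_rel C Q SQ" "\<forall>t. \<forall>a \<in> hom C t Q. \<forall>b \<in> hom C t Q. rel_mem C SQ a b \<longleftrightarrow> rel_mem C SY (\<sigma>
      \<cdot> a) (\<sigma> \<cdot> b)"
    using inverse_image_equiv_ex[OF \<sigma> fC(5)] by blast
  let ?X = "(X', RX, SX)" and ?Q = "(Q, RQ, SQ)"
  define \<tau> where "\<tau> = (?X, r, ?Q)"
  have \<tau>: "\<tau> \<in> fibrations C"
    unfolding \<tau>_def
  proof (rule fibrationI[OF rc RX(1) SX(1) RQ(1) SQ(1)])
    fix t a b assume a: "a \<in> hom C t X'" and b: "b \<in> hom C t X'"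
    note ra = comp_in_hom[OF a r(1)] comp_in_hom[OF b r(1)]
        and qa = comp_in_hom[OF a qC(1)] comp_in_hom[OF b qC(1)]
    show "rel_mem C RX a b \<longleftrightarrow> rel_mem C RQ (r \<cdot> a) (r \<cdot> b)"
      using RX(2) RQ(2) a b ra \<sigma>r[OF a] \<sigma>r[OF b] fF(3)[OF qa] by simp
    show "rel_mem C SX a b \<longleftrightarrow> rel_mem C SQ (r \<cdot> a) (r \<cdot> b)"
      using SX(2) SQ(2) a b ra \<sigma>r[OF a] \<sigma>r[OF b] fF(4)[OF qa] by simp
  qed
  have q\<tau>: "(?X, q, (X, R, S)) \<in> hom (two_Eq C) ?X (X, R, S)"
    by (rule two_Eq_homI[OF qC(1) RX(1) SX(1) fC(2,3)]) (use RX(2) SX(2) in blast)+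
  have \<sigma>\<tau>: "(?Q, \<sigma>, (Y, RY, SY)) \<in> hom (two_Eq C) ?Q (Y, RY, SY)"
    by (rule two_Eq_homI[OF \<sigma> RQ(1) SQ(1) fC(4,5)]) (use RQ(2) SQ(2) in blast)+
  have u\<tau>: "(?X, u, (E, RE, SE)) \<in> hom (two_Eq C) ?X (E, RE, SE)"
  proof (rule two_Eq_homI[OF uC(1) RX(1) SX(1) eC(2,3)])
    fix t a b assume a: "a \<in> hom C t X'" and b: "b \<in> hom C t X'"
    note ua = comp_in_hom[OF a uC(1)] comp_in_hom[OF b uC(1)]
        and qa = comp_in_hom[OF a qC(1)] comp_in_hom[OF b qC(1)]
    have s: "p \<cdot> (u \<cdot> a) = g' \<cdot> (q \<cdot> a)" "p \<cdot> (u \<cdot> b) = g' \<cdot> (q \<cdot> b)"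
      using square_comp[OF sq_top a uC(1) p1C(1) qC(1) gC(1)] square_comp[OF sq_top b uC(1) p1C(1) qC(1) gC(1)]
          by auto
    show "rel_mem C RE (u \<cdot> a) (u \<cdot> b)" if "rel_mem C RX a b"
      using that RX(2) a b p1F(3)[OF ua] s gC(6)[OF qa(1), of "q \<cdot> b"] by simp
    show "rel_mem C SE (u \<cdot> a) (u \<cdot> b)" if "rel_mem C SX a b"
      using that SX(2) a b p1F(4)[OF ua] s gC(7)[OF qa(1), of "q \<cdot> b"] by simp
  qed
  have \<rho>\<tau>: "(?Q, \<rho>, (D, RD, SD)) \<in> hom (two_Eq C) ?Q (D, RD, SD)"
  proof (rule two_Eq_homI[OF \<rho> RQ(1) SQ(1) eC(4,5)])
    fix t a b assume a: "a \<in> hom C t Q" and b: "b \<in> hom C t Q"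
    note \<rho>a = comp_in_hom[OF a \<rho>] comp_in_hom[OF b \<rho>] and \<sigma>a = comp_in_hom[OF a \<sigma>] comp_in_hom[OF b \<sigma>]
    have s: "pd \<cdot> (\<rho> \<cdot> a) = j' \<cdot> (\<sigma> \<cdot> a)" "pd \<cdot> (\<rho> \<cdot> b) = j' \<cdot> (\<sigma> \<cdot> b)"
      using square_comp[OF sqQ a \<rho> p0C(1) \<sigma> jC(1)] square_comp[OF sqQ b \<rho> p0C(1) \<sigma> jC(1)] by auto
    show "rel_mem C RD (\<rho> \<cdot> a) (\<rho> \<cdot> b)" if "rel_mem C RQ a b"
      using that RQ(2) a b p0F(3)[OF \<rho>a] s jC(6)[OF \<sigma>a(1), of "\<sigma> \<cdot> b"] by simp
    show "rel_mem C SD (\<rho> \<cdot> a) (\<rho> \<cdot> b)" if "rel_mem C SQ a b"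
      using that SQ(2) a b p0F(4)[OF \<rho>a] s jC(7)[OF \<sigma>a(1), of "\<sigma> \<cdot> b"] by simp
  qed
  have to_f: "(\<tau>, ((?X, q, (X, R, S)), (?Q, \<sigma>, (Y, RY, SY))), f) \<in> hom ?E \<tau> f"
    by (rule Ext_homI[OF \<tau> duD(1)]) (use q\<tau> \<sigma>\<tau> r(3) in \<open>simp_all add: \<tau>_def f\<close>)
  have to_e: "(\<tau>, ((?X, u, (E, RE, SE)), (?Q, \<rho>, (D, RD, SD))), e) \<in> hom ?E \<tau> e"
    by (rule Ext_homI[OF \<tau> dpD(1)]) (use u\<tau> \<rho>\<tau> r(2) in \<open>simp_all add: \<tau>_def e\<close>)
  have "Comp ?E (e, (p1, p0), h) (\<tau>, ((?X, u, (E, RE, SE)), (?Q, \<rho>, (D, RD, SD))), e) =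
      Comp ?E (f, (g, j), h) (\<tau>, ((?X, q, (X, R, S)), (?Q, \<sigma>, (Y, RY, SY))), f)"
    using sq_top sqQ by (simp add: p1 p0 g j)
  then obtain m where m: "m \<in> hom ?E \<tau> f'"
    "Comp ?E (f', (u1, u0), e) m = (\<tau>, ((?X, u, (E, RE, SE)), (?Q, \<rho>, (D, RD, SD))), e)"
    "Comp ?E (f', (q1, q0), f) m = (\<tau>, ((?X, q, (X, R, S)), (?Q, \<sigma>, (Y, RY, SY))), f)"
    by (rule E.is_pullback_ex[OF pb dpD(5) duD(5) hh(1) to_e to_f])
  obtain m1 m0 where m10: "m = (\<tau>, (m1, m0), f')" "m1 \<in> hom (two_Eq C) ?X (X', R', S')"
    "m0 \<in> hom (two_Eq C) ?Q (Y', RY', SY')" "Comp (two_Eq C) f' m1 = Comp (two_Eq C) m0 \<tau>"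
    using m(1) unfolding Ext_hom_iff by (auto simp: \<tau>_def f')
  obtain w where w: "m1 = (?X, w, (X', R', S'))" using m10(2) by (auto simp: two_Eq_hom_iff)
  obtain w' where w': "m0 = (?Q, w', (Y', RY', SY'))" using m10(3) by (auto simp: two_Eq_hom_iff)
  note wC = two_Eq_homE[OF m10(2)[unfolded w]] and wC' = two_Eq_homE[OF m10(3)[unfolded w']]
  have X': "X' \<in> Obj C" using r(1) by (rule hom_Obj)
  have "u \<cdot> w = u" "q \<cdot> w = q" using m(2,3) by (simp_all add: m10(1) w u1 q1)
  then have wI: "w = Ide C X'"
    by (intro is_pullback_eqD[OF top p1C(1) gC(1) uC(1) wC(1) Ide_hom[OF X']]) (simp_all add: Comp_Ide[OF uC(1)]
        Comp_Ide[OF qC(1)])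
  have fC': "fX' \<in> hom C X' Y'" using two_Eq_homE(1)[OF fibrationD(1)[OF f'fib[unfolded f']]] .
  have fw: "fX' = w' \<cdot> r" using m10(4) by (simp add: f' w w' \<tau>_def wI Comp_Ide[OF fC'])
  have id: "w \<cdot> a = a" "w \<cdot> b = b" using ab wI by (auto simp: Ide_Comp)
  show "rel_mem C R' a b" if "rel_mem C R (q \<cdot> a) (q \<cdot> b)" using that wC(6)[OF ab(1), of b] RX(2) ab id by simp
  show "rel_mem C S' a b" if "rel_mem C S (q \<cdot> a) (q \<cdot> b)" using that wC(7)[OF ab(1), of b] SX(2) ab id by simp
  show "fX' \<cdot> a = fX' \<cdot> b" if "fX \<cdot> (q \<cdot> a) = fX \<cdot> (q \<cdot> b)" "e' \<cdot> (u \<cdot> a) = e' \<cdot> (u \<cdot> b)"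
  proof -
    have "r \<cdot> a = r \<cdot> b"
      by (rule is_pullback_eqD[OF pbQ p0C(1) jC(1) \<rho> comp_in_hom[OF ab(1) r(1)] comp_in_hom[OF ab(2) r(1)]])
        (use \<rho>r[OF ab(1)] \<rho>r[OF ab(2)] \<sigma>r[OF ab(1)] \<sigma>r[OF ab(2)] that in simp_all)
    then show ?thesis unfolding fw using Comp_assoc[OF ab(1) r(1) wC'(1)] Comp_assoc[OF ab(2) r(1) wC'(1)]
        by simp
  qed
qed

text \<open>Both parts of the argument take place over a trivial double extension with domain \<open>X'\<close>,
  which is the pullback of \<open>I\<close> and \<open>E\<close>. On \<open>X'\<close> the hypotheses of \<open>centralize_pullback\<close> hold
  because \<open>fI\<close> is central and because the kernel pair \<open>L'\<close> of \<open>u\<close> is contained in \<open>R'\<close> and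
  collapsed by \<open>u\<close>. For the descent along \<open>q\<close>, elements related by \<open>L\<close> or by the meet lift with
  unchanged coordinate in \<open>E\<close>, whereas elements related by the kernel pair of \<open>fX\<close> lift only
  locally, using that \<open>(p1, p0)\<close> is a double extension.\<close>

lemma double_central_extension_centralizes:
  assumes cen: "double_central_extension C (f, (g, j), h)"
    and f: "f = ((X, R, S), fX, (Y, RY, SY))" and g: "g = ((X, R, S), g', (Z, RZ, SZ))"
  shows "centralize C X (kernel_pair C fX) (kernel_pair C g')"
    "centralize C X (meet C X (kernel_pair C fX) (kernel_pair C g')) R"
    "centralize C X (meet C X (kernel_pair C fX) (kernel_pair C g')) S"
proof -
  let ?T = "two_Eq C" and ?E = "Ext (two_Eq C) (fibrations C)"
  obtain P U Q where du: "(f, (g, j), h) \<in> double_fibrations C" and dP: "P \<in> double_fibrations C"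
    and pb: "is_pullback ?E P (f, (g, j), h) U Q" and triv:
        "trivial_extension ?E (CExt C) (double_fibrations C) U"
    using cen unfolding double_central_extension_def central_extension_def monadic_extension_def by blast
  obtain \<eta> \<theta> v where dU: "U \<in> double_fibrations C"
    and \<eta>: "is_reflection_unit ?E (CExt C) (Dom ?E U) \<eta>" and \<theta>: "is_reflection_unit ?E (CExt C) (Cod ?E U) \<theta>"
    and v: "v \<in> hom ?E (Cod ?E \<eta>) (Cod ?E \<theta>)" and pbv: "is_pullback ?E v \<theta> \<eta> U"
    using triv unfolding trivial_extension_def by blast
  obtain e p1 p0 h2 where P0: "P = (e, (p1, p0), h2)" by (metis prod.exhaust)
  obtain f' u1 u0 e2 where U0: "U = (f', (u1, u0), e2)" by (metis prod.exhaust)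
  obtain f2 q1 q0 f3 where Q0: "Q = (f2, (q1, q0), f3)" by (metis prod.exhaust)
  have "Cod ?E P = Cod ?E (f, (g, j), h)" "Cod ?E U = Dom ?E P" "Dom ?E Q = Dom ?E U"
      "Cod ?E Q = Dom ?E (f, (g, j), h)"
    and Qh: "Q \<in> hom ?E (Dom ?E U) (Dom ?E (f, (g, j), h))"
    using pb unfolding is_pullback_def hom_def[of ?E] by auto
  then have eqs: "h2 = h" "e2 = e" "f2 = f'" "f3 = f" using P0 U0 Q0 by auto
  note P = P0[unfolded eqs] and U = U0[unfolded eqs] and Q = Q0[unfolded eqs]
  obtain F where F: "Cod ?E \<eta> = F" by blast
  obtain G where G: "Cod ?E \<theta> = G" by blast
  have \<eta>h: "\<eta> \<in> hom ?E f' F" and \<theta>h: "\<theta> \<in> hom ?E e G" and vh: "v \<in> hom ?E F G" and FC: "F \<in> CExt C"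
    using \<eta> \<theta> v F G U unfolding is_reflection_unit_def by auto
  obtain \<eta>1 \<eta>0 where \<eta>0: "\<eta> = (f', (\<eta>1, \<eta>0), F)" using \<eta>h unfolding Ext_hom_iff by blast
  obtain \<theta>1 \<theta>0 where \<theta>0: "\<theta> = (e, (\<theta>1, \<theta>0), G)" using \<theta>h unfolding Ext_hom_iff by blast
  obtain v1 v0 where v0: "v = (F, (v1, v0), G)" using vh unfolding Ext_hom_iff by blast
  note \<eta>E = Ext_homD[OF \<eta>h[unfolded \<eta>0]] and \<theta>E = Ext_homD[OF \<theta>h[unfolded \<theta>0]]
      and vE = Ext_homD[OF vh[unfolded v0]]
    and QE = Ext_homD[OF Qh[unfolded Q U, simplified]] and duD = double_fibrationD[OF du]
    and dPD = double_fibrationD[OF dP[unfolded P]] and dUD = double_fibrationD[OF dU[unfolded U]]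
  note PE = Ext_homD[OF dPD(5)] and uE = Ext_homD[OF duD(5)] and UE = Ext_homD[OF dUD(5)]
  obtain E RE SE e' D RD SD where e: "e = ((E, RE, SE), e', (D, RD, SD))" using dPD(1) by (rule fibrationE)
  obtain Z1 RZ1 SZ1 h' W RW SW where h0: "h = ((Z1, RZ1, SZ1), h', (W, RW, SW))" using duD(4)
      by (rule fibrationE)
  have "(Z1, RZ1, SZ1) = (Z, RZ, SZ)" using uE(3) f g h0 unfolding hom_def[of ?T] by simp
  then have h: "h = ((Z, RZ, SZ), h', (W, RW, SW))" using h0 by simp
  obtain X' R' S' fX' Y' RY' SY' where f': "f' = ((X', R', S'), fX', (Y', RY', SY'))" using dUD(1)
      by (rule fibrationE)
  obtain I RI SI fI J RJ SJ where Ft: "F = ((I, RI, SI), fI, (J, RJ, SJ))" using vE(1) by (rule fibrationE)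
  obtain K RK SK gK L RL SL where Gt: "G = ((K, RK, SK), gK, (L, RL, SL))" using vE(2) by (rule fibrationE)
  obtain p where p1: "p1 = ((E, RE, SE), p, (Z, RZ, SZ))" using PE(3) by (auto simp: two_Eq_hom_iff e h)
  obtain pd where p0: "p0 = ((D, RD, SD), pd, (W, RW, SW))" using PE(4) by (auto simp: two_Eq_hom_iff e h)
  obtain j' where j: "j = ((Y, RY, SY), j', (W, RW, SW))" using uE(4) by (auto simp: two_Eq_hom_iff f h)
  obtain u where u1: "u1 = ((X', R', S'), u, (E, RE, SE))" using UE(3) by (auto simp: two_Eq_hom_iff f' e)
  obtain q where q1: "q1 = ((X', R', S'), q, (X, R, S))" using QE(3) by (auto simp: two_Eq_hom_iff f' f)
  obtain \<eta>' where \<eta>1: "\<eta>1 = ((X', R', S'), \<eta>', (I, RI, SI))" using \<eta>E(3) by (auto simp: two_Eq_hom_iff f' Ft)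
  obtain \<eta>'' where \<eta>2: "\<eta>0 = ((Y', RY', SY'), \<eta>'', (J, RJ, SJ))" using \<eta>E(4)
      by (auto simp: two_Eq_hom_iff f' Ft)
  obtain \<theta>' where \<theta>1: "\<theta>1 = ((E, RE, SE), \<theta>', (K, RK, SK))" using \<theta>E(3) by (auto simp: two_Eq_hom_iff e Gt)
  obtain v' where v1: "v1 = ((I, RI, SI), v', (K, RK, SK))" using vE(3) by (auto simp: two_Eq_hom_iff Ft Gt)
  note \<eta>C = two_Eq_homE[OF \<eta>E(3)[unfolded f' Ft \<eta>1, simplified]]
      and \<eta>C0 = two_Eq_homE[OF \<eta>E(4)[unfolded f' Ft \<eta>2, simplified]]
    and \<theta>C = two_Eq_homE[OF \<theta>E(3)[unfolded e Gt \<theta>1, simplified]]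
        and vC = two_Eq_homE[OF vE(3)[unfolded Ft Gt v1, simplified]]
    and FCC = two_Eq_homE[OF fibrationD(1)[OF vE(1)[unfolded Ft]]]
    and uF = fibrationD[OF dUD(2)[unfolded u1]] and uC = two_Eq_homE[OF fibrationD(1)[OF dUD(2)[unfolded u1]]]
    and f'C = two_Eq_homE[OF fibrationD(1)[OF dUD(1)[unfolded f']]]
    and fC = two_Eq_homE[OF fibrationD(1)[OF duD(1)[unfolded f]]]
        and gC = two_Eq_homE[OF fibrationD(1)[OF duD(2)[unfolded g]]]
    and eC = two_Eq_homE[OF fibrationD(1)[OF dPD(1)[unfolded e]]] and p1F = fibrationD[OF dPD(2)[unfolded p1]]
    and hC = two_Eq_homE[OF fibrationD(1)[OF duD(4)[unfolded h]]]
        and p0C = two_Eq_homE[OF fibrationD(1)[OF dPD(3)[unfolded p0]]]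
    and jC = two_Eq_homE[OF fibrationD(1)[OF duD(3)[unfolded j]]]
    and qC = two_Eq_homE[OF QE(3)[unfolded f f' q1, simplified]]
  have p1C: "p \<in> hom C E Z" using p1F(2) by simp
  note pb' = pb[unfolded P U Q] and pbv' = pbv[unfolded v0 \<theta>0 \<eta>0 U]
  have top: "is_pullback C p g' u q" by (rule Ext_pullback_top[OF pb' p1 g u1 q1])
  have topv: "is_pullback C v' \<theta>' \<eta>' u" by (rule Ext_pullback_top[OF pbv' v1 \<theta>1 \<eta>1 u1])
  note dom = Ext_pullback_domain[OF pb' dP[unfolded P] du e h f f' p1 p0 g j u1 q1]
  have sq_top: "p \<cdot> u = g' \<cdot> q" by (rule is_pullback_hom(3)[OF top p1C gC(1)])
  have sq_gf: "h' \<cdot> g' = j' \<cdot> fX" using uE(5) by (simp add: h g j f)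
  have sq_pe: "h' \<cdot> p = pd \<cdot> e'" using PE(5) by (simp add: h p1 p0 e)
  have sq_\<eta>: "fI \<cdot> \<eta>' = \<eta>'' \<cdot> fX'" using \<eta>E(5) by (simp add: Ft \<eta>1 \<eta>2 f')
  have qc: "cover q X' X" by (rule pullback_cover_snd[OF top p1F(2) gC(1) uC(1)])
  let ?K' = "kernel_pair C fX'" and ?L' = "kernel_pair C u" and ?KI = "kernel_pair C fI"
  let ?M' = "meet C X' ?K' ?L'"
  let ?K = "kernel_pair C fX" and ?L = "kernel_pair C g'"
      and ?M = "meet C X (kernel_pair C fX) (kernel_pair C g')"
  note K' = kernel_pair_facts[OF f'C(1)] and L' = kernel_pair_facts[OF uC(1)]
      and KI = kernel_pair_facts[OF FCC(1)]
    and M' = meet_kernel_pair_mem[OF f'C(1) uC(1)]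
    and K = kernel_pair_facts[OF fC(1)] and L = kernel_pair_facts[OF gC(1)]
        and M = meet_kernel_pair_mem[OF fC(1) gC(1)]
  have \<eta>K: "rel_mem C ?KI (\<eta>' \<cdot> a) (\<eta>' \<cdot> b)" if a: "a \<in> hom C t X'" and b: "b \<in> hom C t X'"
      and e: "fX' \<cdot> a = fX' \<cdot> b" for t a b
    using KI(2)[OF comp_in_hom[OF a \<eta>C(1)] comp_in_hom[OF b \<eta>C(1)]] e
      square_comp[OF sq_\<eta> a \<eta>C(1) FCC(1) f'C(1) \<eta>C0(1)] square_comp[OF sq_\<eta> b \<eta>C(1) FCC(1) f'C(1) \<eta>C0(1)]
          by simp
  note cF = central_extension_centralizes[OF FC[unfolded Ft]]
  have KL': "centralize C X' ?K' ?L'"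
  proof (rule centralize_pullback[OF equiv_rel_reflexive[OF KI(1)] equiv_rel_reflexive[OF \<eta>C(4)]
      cF(1) vC(1) \<theta>C(1) \<eta>C(1) uC(1) topv
        equiv_rel_reflexive[OF K'(1)] equiv_rel_reflexive[OF L'(1)]])
    fix t a b assume a: "a \<in> hom C t X'" and b: "b \<in> hom C t X'"
    show "rel_mem C ?K' a b \<Longrightarrow> rel_mem C ?KI (\<eta>' \<cdot> a) (\<eta>' \<cdot> b)" using \<eta>K[OF a b] K'(2)[OF a b] by simp
    show "u \<cdot> a = u \<cdot> b" if "rel_mem C ?L' a b" using that L'(2)[OF a b] by simp
    show "rel_mem C RI (\<eta>' \<cdot> a) (\<eta>' \<cdot> b)" if "rel_mem C ?L' a b"
      using fibration_kernel_le(1)[OF dUD(2)[unfolded u1] a b] that L'(2)[OF a b] \<eta>C(6)[OF a, of b] by simp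
  qed
  have RM': "centralize C X' R' ?M'"
    by (rule centralize_pullback[OF equiv_rel_reflexive[OF \<eta>C(4)] equiv_rel_reflexive[OF KI(1)]
        centralize_sym[OF KI(1) \<eta>C(4) cF(1)]
          vC(1) \<theta>C(1) \<eta>C(1) uC(1) topv equiv_rel_reflexive[OF \<eta>C(2)] equiv_rel_reflexive[OF M'(1)]])
      (use \<eta>C(6) M'(2) \<eta>K in blast)+
  have SM': "centralize C X' S' ?M'"
    by (rule centralize_pullback[OF equiv_rel_reflexive[OF \<eta>C(5)] equiv_rel_reflexive[OF KI(1)]
        centralize_sym[OF KI(1) \<eta>C(5) cF(2)]
          vC(1) \<theta>C(1) \<eta>C(1) uC(1) topv equiv_rel_reflexive[OF \<eta>C(3)] equiv_rel_reflexive[OF M'(1)]])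
      (use \<eta>C(7) M'(2) \<eta>K in blast)+
  \<comment> \<open>\<open>q\<close> is a pullback of \<open>p\<close>, so a lift can keep the coordinate in \<open>E\<close>\<close>
  have liftL: "\<exists>x' \<in> hom C t X'. q \<cdot> x' = x \<and> u \<cdot> x' = u \<cdot> y"
    if y: "y \<in> hom C t X'" and x: "x \<in> hom C t X" and e: "g' \<cdot> x = g' \<cdot> (q \<cdot> y)" for t x y
  proof -
    have "p \<cdot> (u \<cdot> y) = g' \<cdot> x" using square_comp[OF sq_top y uC(1) p1C qC(1) gC(1)] e by simp
    then obtain x' where "x' \<in> hom C t X'" "u \<cdot> x' = u \<cdot> y" "q \<cdot> x' = x"
      by (rule is_pullback_ex[OF top p1C gC(1) uC(1) comp_in_hom[OF y uC(1)] x])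
    then show ?thesis by blast
  qed
  have liftK: "\<exists>t' c x'. cover c t' t \<and> x' \<in> hom C t' X' \<and> q \<cdot> x' = x \<cdot> c \<and> rel_mem C ?K' x' (y \<cdot> c)"
    if y: "y \<in> hom C t X'" and x: "x \<in> hom C t X" and m: "rel_mem C ?K x (q \<cdot> y)" for t y x
  proof -
    have qy: "q \<cdot> y \<in> hom C t X" and uy: "u \<cdot> y \<in> hom C t E"
        using comp_in_hom[OF y qC(1)] comp_in_hom[OF y uC(1)] by auto
    have fxy: "fX \<cdot> x = fX \<cdot> (q \<cdot> y)" using K(2)[OF x qy] m by simp
    have eq: "pd \<cdot> (e' \<cdot> (u \<cdot> y)) = h' \<cdot> (g' \<cdot> x)"
    proof -
      have "pd \<cdot> (e' \<cdot> (u \<cdot> y)) = h' \<cdot> (p \<cdot> (u \<cdot> y))" using square_comp[OF sq_pe uy p1C hC(1) eC(1) p0C(1)]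
          by simp
      also have "\<dots> = h' \<cdot> (g' \<cdot> (q \<cdot> y))" using square_comp[OF sq_top y uC(1) p1C qC(1) gC(1)] by simp
      also have "\<dots> = j' \<cdot> (fX \<cdot> (q \<cdot> y))" by (rule square_comp[OF sq_gf qy gC(1) hC(1) fC(1) jC(1)])
      also have "\<dots> = h' \<cdot> (g' \<cdot> x)" using square_comp[OF sq_gf x gC(1) hC(1) fC(1) jC(1)] fxy by simp
      finally show ?thesis .
    qed
    obtain t' c z where c: "cover c t' t" "z \<in> hom C t' E" "e' \<cdot> z = (e' \<cdot> (u \<cdot> y)) \<cdot> c" "p \<cdot> z = (g' \<cdot> x) \<cdot> c"
      by (rule double_fibration_lift[OF dP[unfolded P] e p1 p0 h comp_in_hom[OF uy eC(1)]
          comp_in_hom[OF x gC(1)] eq])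
    have ch: "c \<in> hom C t' t" using c by simp
    have "p \<cdot> z = g' \<cdot> (x \<cdot> c)" using c(4) Comp_assoc[OF ch x gC(1)] by simp
    then obtain x' where x': "x' \<in> hom C t' X'" "u \<cdot> x' = z" "q \<cdot> x' = x \<cdot> c"
      by (rule is_pullback_ex[OF top p1C gC(1) uC(1) c(2) comp_in_hom[OF ch x]])
    have yc: "y \<cdot> c \<in> hom C t' X'" using ch y by (rule comp_in_hom)
    have "fX' \<cdot> x' = fX' \<cdot> (y \<cdot> c)"
    proof (rule dom(3)[OF x'(1) yc])
      show "fX \<cdot> (q \<cdot> x') = fX \<cdot> (q \<cdot> (y \<cdot> c))"
        using x'(3) comp_eq_comp[OF fxy ch x fC(1)] Comp_assoc[OF ch qy fC(1)] Comp_assoc[OF ch y qC(1)] by simp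
      show "e' \<cdot> (u \<cdot> x') = e' \<cdot> (u \<cdot> (y \<cdot> c))"
        using x'(2) c(3) Comp_assoc[OF ch uy eC(1)] Comp_assoc[OF ch y uC(1)] by simp
    qed
    then show ?thesis using c(1) x' K'(2)[OF x'(1) yc] by blast
  qed
  have liftM: "\<exists>t' c x'. cover c t' t \<and> x' \<in> hom C t' X' \<and> q \<cdot> x' = x \<cdot> c \<and> rel_mem C ?M' x' (y \<cdot> c)"
    if y: "y \<in> hom C t X'" and x: "x \<in> hom C t X" and m: "rel_mem C ?M x (q \<cdot> y)" for t y x
  proof -
    have e: "fX \<cdot> x = fX \<cdot> (q \<cdot> y)" "g' \<cdot> x = g' \<cdot> (q \<cdot> y)" using M(2)[OF x comp_in_hom[OF y qC(1)]] m by auto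
    obtain x' where x': "x' \<in> hom C t X'" "q \<cdot> x' = x" "u \<cdot> x' = u \<cdot> y" using liftL[OF y x e(2)] by blast
    have "fX' \<cdot> x' = fX' \<cdot> y" by (rule dom(3)[OF x'(1) y]) (use x' e in auto)
    then have "rel_mem C ?M' x' y" using M'(2)[OF x'(1) y] x'(3) by simp
    then show ?thesis using x' cover_Ide[OF hom_Obj(1)[OF y]] Comp_Ide[OF x] Comp_Ide[OF y]
      by (intro exI[of _ t] exI[of _ "Ide C t"] exI[of _ x']) simp
  qed
  show "centralize C X ?K ?L"
  proof (rule centralize_descent[OF qc equiv_rel_reflexive[OF K'(1)] equiv_rel_reflexive[OF L'(1)]
      KL' equiv_rel_is_rel[OF K(1)]
        equiv_rel_is_rel[OF L(1)] liftK])
    fix t y z assume y: "y \<in> hom C t X'" and z: "z \<in> hom C t X" and m: "rel_mem C ?L (q \<cdot> y) z"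
    obtain z' where z': "z' \<in> hom C t X'" "q \<cdot> z' = z" "u \<cdot> z' = u \<cdot> y"
      using liftL[OF y z] m L(2)[OF comp_in_hom[OF y qC(1)] z] by auto
    then show "\<exists>t' c z'. cover c t' t \<and> z' \<in> hom C t' X' \<and> q \<cdot> z' = z \<cdot> c \<and> rel_mem C ?L' (y \<cdot> c) z'"
      using cover_Ide[OF hom_Obj(1)[OF y]] Comp_Ide[OF z] Comp_Ide[OF y] L'(2)[OF y z'(1)]
      by (intro exI[of _ t] exI[of _ "Ide C t"] exI[of _ z']) simp
  qed
  have down: "centralize C X ?M V"
    if V: "is_rel C X V" and V': "equiv_rel C X' V'" and c: "centralize C X' V' ?M'"
    and inv: "\<And>t a b. a \<in> hom C t X' \<Longrightarrow> b \<in> hom C t X' \<Longrightarrow> rel_mem C V (q \<cdot> a) (q \<cdot> b) \<Longrightarrow> rel_mem C V' a b"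
    for V V'
    by (rule centralize_descent[OF qc equiv_rel_reflexive[OF M'(1)] equiv_rel_reflexive[OF V']
          centralize_sym[OF V' M'(1) c] equiv_rel_is_rel[OF M(1)] V liftM inverse_image_lift[OF qc V inv]])
  show "centralize C X ?M R" by (rule down[OF equiv_rel_is_rel[OF fC(2)] \<eta>C(2) RM' dom(1)])
  show "centralize C X ?M S" by (rule down[OF equiv_rel_is_rel[OF fC(3)] \<eta>C(3) SM' dom(2)])
qed

end

theorem corollary1:
  fixes C :: "('o, 'm) cat"
    and f g h j :: "('o, 'm) arr2"
    and X :: 'o and R S :: "'m rl"
  assumes "exact_category C"
    and "maltsev_category C"
    and "has_coequalizers C"
    and "(f, (g, j), h) \<in> double_fibrations C"
    and "Dom (two_Eq C) f = (X, R, S)"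
    and "double_central_extension C (f, (g, j), h)"
  shows "rel_eq C (commutator C X (kernel_pair C (base_arr f)) (kernel_pair C (base_arr g))) (diag C X) \<and>
    rel_eq C (diag C X)
      (commutator C X (meet C X (kernel_pair C (base_arr f)) (kernel_pair C (base_arr g))) (join C X R S))"
proof -
  have reg: "regular_category C" using assms(1) by (simp add: exact_category_def)
  then have fc: "finitely_complete C" by (simp add: regular_category_def)
  then interpret category C by (simp add: finitely_complete_def)
  interpret regular_maltsev_cat C by unfold_locales (use fc reg assms(2) in auto)
  note D = double_fibrationD[OF assms(4)]
  obtain X1 R1 S1 f0 Y RY SY where "f = ((X1, R1, S1), f0, (Y, RY, SY))" using D(1) by (rule fibrationE)
  then have f: "f = ((X, R, S), f0, (Y, RY, SY))" using assms(5) by simp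
  obtain X2 R2 S2 g0 Z RZ SZ where g0: "g = ((X2, R2, S2), g0, (Z, RZ, SZ))" using D(2) by (rule fibrationE)
  have "(X2, R2, S2) = (X, R, S)" using Ext_homD(3)[OF D(5)] f g0 unfolding hom_def[of "two_Eq C"] by simp
  then have g: "g = ((X, R, S), g0, (Z, RZ, SZ))" using g0 by simp
  note fC = two_Eq_homE[OF fibrationD(1)[OF D(1)[unfolded f]]]
      and gC = two_Eq_homE[OF fibrationD(1)[OF D(2)[unfolded g]]]
  let ?K = "kernel_pair C f0" and ?L = "kernel_pair C g0"
  let ?M = "meet C X ?K ?L" and ?J = "join C X R S"
  note cen = double_central_extension_centralizes[OF assms(6) f g]
  note K = kernel_pair_facts[OF fC(1)] and L = kernel_pair_facts[OF gC(1)]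
      and M = meet_kernel_pair_mem[OF fC(1) gC(1)]
    and J = is_join_join[OF fC(2,3)]
  have Jr: "is_rel C X ?J" using J(1) by (simp add: is_join_def equiv_rel_is_rel)
  obtain W k where k: "k \<in> hom C X W"
    and kk: "\<And>t u v. u \<in> hom C t X \<Longrightarrow> v \<in> hom C t X \<Longrightarrow> k \<cdot>\<^bsub>C\<^esub> u = k \<cdot>\<^bsub>C\<^esub> v \<longleftrightarrow> f0 \<cdot>\<^bsub>C\<^esub> u = f0 \<cdot>\<^bsub>C\<^esub> v \<and>
        g0 \<cdot>\<^bsub>C\<^esub> u = g0 \<cdot>\<^bsub>C\<^esub> v"
    by (rule pairing_ex[OF fC(1) gC(1)]) blast
  have "centralize C X ?M ?J"
    by (rule centralize_composite[OF k equiv_rel_is_rel[OF M(1)] _ equiv_rel_reflexive[OF fC(2)]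
        equiv_rel_reflexive[OF fC(3)]
          Jr J(2) cen(2,3)]) (simp add: M(2) kk)
  then have "rel_eq C (commutator C X ?M ?J) (diag C X)"
    by (rule commutator_eq_diag[OF equiv_rel_is_rel[OF M(1)] Jr])
  moreover have "rel_eq C (commutator C X ?K ?L) (diag C X)"
    by (rule commutator_eq_diag[OF equiv_rel_is_rel[OF K(1)] equiv_rel_is_rel[OF L(1)] cen(1)])
  ultimately show ?thesis by (simp add: f g base_arr_def rel_eq_def)
qed

end
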